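(* Let $\mu\in\mathcal{P}(\mathbb{R}^n)$ be absolutely continuous with respect to the Lebesgue measure $\mathcal{L}^n$, with density strictly positive on a non-empty open set $U\subseteq\mathbb{R}^n$. Let $\mathscr{P}\subseteq\mathbb{S}^n_{++}\times\mathbb{R}^n$. For each $(A,b)\in\mathscr{P}$ define $T_{A,b}(x):=Ax+b$ and $\mu_{A,b}:=(T_{A,b})_\#\mu$. Let the cost $c:\mathbb{R}^n\times\mathbb{R}^n\to\mathbb{R}$ be translation-invariant, i.e. $c(x,y)=\tilde c(x-y)$, where $\tilde c\in C(\mathbb{R}^n)$ is twice continuously differentiable except on a finite set $\mathscr{S}\subset\mathbb{R}^n$. Assume that for each $(A,b)\in\mathscr{P}$ there exist upper semicontinuous functions $u_{A,b}\in L^1(\mu)$ and $v_{A,b}\in L^1(\mu_{A,b})$ such that $c(x,y)\ge u_{A,b}(x)+v_{A,b}(y)$ for all $x,y\in\mathbb{R}^n$, and that $$C_c(\mu,\mu_{A,b}):=\inf_{\gamma\in\Pi(\mu,\mu_{A,b})}\int_{\mathbb{R}^n\times\mathbb{R}^n}c(x,y)\,d\gamma(x,y)<+\infty.$$ (i) (Necessity) Suppose that for any $(A,b)\in\mathscr{P}$, $T_{A,b}$ is an optimal transport map with respect to $c$ (from $\mu$ to $\mu_{A,b}$). Assume that there exists at least one matrix $A$, with mutually distinct eigenvalues if $n\ge2$, and $A\ne[1]$ if $n=1$, such that $\{A\}\times\mathbb{R}^n\subseteq\mathscr{P}$. Then $\tilde c$ is a globally convex function that is separable with respect to the orthonormal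 basis of eigenvectors of $A$: if $A=QDQ^{\mathrm T}$ is the spectral decomposition, there exists a convex function $c_i$ for each $i\in\{1,\dots,n\}$ such that $\tilde c(z)=\sum_{i=1}^nc_i((Q^{\mathrm T}z)_i)$ for all $z\in\mathbb{R}^n$. Furthermore, if $n\ge2$, each $c_i$ belongs to $C^2(\mathbb{R})$. (ii) (Sufficiency) Conversely, if $\tilde c(z)=\sum_{i=1}^nc_i((Q^{\mathrm T}z)_i)$ for all $z\in\mathbb{R}^n$, where $Q$ is an orthogonal matrix and each $c_i\in C^2(\mathbb{R})$ is convex, then for any symmetric positive definite matrix $A$ diagonalized by $Q$ and any $b\in\mathbb{R}^n$, the affine map $T_{A,b}(x)=Ax+b$ is an optimal transport map with respect to $c$ between $\mu$ and $(T_{A,b})_\#\mu$. If, in addition, each $c_i$ is strictly convex, then $T_{A,b}$ is the unique optimal transport map. (iii) (Cross-coupling and quadratic costs) Additionally, suppose the hypotheses of (i) hold, with $A=QDQ^{\mathrm T}$ and $c_1,\dots,c_n$ as in (i). If $\mathscr{P}$ contains another matrix $\bar A$ in the sense that $\{\bar A\}\times\mathbb{R}^n\subseteq\mathscr{P}$, let $\bar A_Q:=Q^{\mathrm T}\bar AQ$. If the $(i,j)$-th entry of $\bar A_Q$ is non-zero for some $i\ne j$, then $c_i$ and $c_j$ must be quadratic functions sharing the same second derivative, i.e. there exists a constant $\kappa\ge0$ such that $c_i''(t)=c_j''(t)=\kappa$ for all $t\in\mathbb{R}$.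
   Context: $\mathcal{P}(\mathbb{R}^n)$ is the set of Borel probability measures on $\mathbb{R}^n$; $\mathbb{S}^n_{++}$ is the set of real symmetric positive definite $n\times n$ matrices; $(T)_\#\mu$ denotes push-forward; $\Pi(\mu_0,\mu_1)$ is the set of probability measures on $\mathbb{R}^n\times\mathbb{R}^n$ with marginals $\mu_0,\mu_1$; $(\cdot)_i$ is the $i$-th component of a vector. A measurable map $T$ is an optimal transport map from $\mu_0$ to $\mu_1$ with respect to $c$ if $T_\#\mu_0=\mu_1$ and $(\mathrm{Id},T)_\#\mu_0$ attains $\inf_{\gamma\in\Pi(\mu_0,\mu_1)}\int c\,d\gamma$. "$A$ is diagonalized by $Q$" means $Q^{\mathrm T}AQ$ is diagonal. "Quadratic" allows arbitrary lower-order terms and vanishing second derivative.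
   Formalization: In (ii), for pairs (A,b) possibly outside 𝒫, optimality assumes the upper semicontinuous integrable lower bound c ≥ u+v for μ and μ_{A,b}, and uniqueness also assumes C_c(μ,μ_{A,b}) < +∞; without these the claim is ill-defined or false. *)

theory Defs
  imports "HOL-Probability.Probability"
begin

section \<open>Matrices\<close>

definition diagonal_matrix :: "real^'n^'n \<Rightarrow> bool" where
  "diagonal_matrix M \<longleftrightarrow> (\<forall>i j. i \<noteq> j \<longrightarrow> M $ i $ j = 0)"

definition sym_pos_def :: "real^'n^'n \<Rightarrow> bool" where
  "sym_pos_def A \<longleftrightarrow> transpose A = A \<and> (\<forall>x. x \<noteq> 0 \<longrightarrow> x \<bullet> (A *v x) > 0)"

definition eigenvalues :: "real^'n^'n \<Rightarrow> real set" where
  "eigenvalues A = {l. \<exists>v. v \<noteq> 0 \<and> A *v v = l *\<^sub>R v}"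

text \<open>An \<open>n \<times> n\<close> matrix has at most \<open>n\<close> eigenvalues, counted with multiplicity; they are
  real for a symmetric matrix, and mutually distinct iff there are exactly \<open>n\<close> of them.\<close>

definition distinct_eigenvalues :: "real^'n^'n \<Rightarrow> bool" where
  "distinct_eigenvalues A \<longleftrightarrow> card (eigenvalues A) = CARD('n)"

definition spectral_decomposition :: "real^'n^'n \<Rightarrow> real^'n^'n \<Rightarrow> real^'n^'n \<Rightarrow> bool" where
  "spectral_decomposition A Q D \<longleftrightarrow>
     orthogonal_matrix Q \<and> diagonal_matrix D \<and> A = Q ** D ** transpose Q"

definition diagonalized_by :: "real^'n^'n \<Rightarrow> real^'n^'n \<Rightarrow> bool" where
  "diagonalized_by A Q \<longleftrightarrow> diagonal_matrix (transpose Q ** A ** Q)"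

definition affine_map :: "real^'n^'n \<Rightarrow> real^'n \<Rightarrow> real^'n \<Rightarrow> real^'n" where
  "affine_map A b x = A *v x + b"

section \<open>Regularity and convexity\<close>

text \<open>Twice continuously differentiable, in the Frechet sense; \<open>W\<close> is meant to be open.\<close>

definition C2_on :: "'a::real_normed_vector set \<Rightarrow> ('a \<Rightarrow> real) \<Rightarrow> bool" where
  "C2_on W f \<longleftrightarrow>
     (\<exists>(f' :: 'a \<Rightarrow> 'a \<Rightarrow>\<^sub>L real) (f'' :: 'a \<Rightarrow> 'a \<Rightarrow>\<^sub>L ('a \<Rightarrow>\<^sub>L real)).
        (\<forall>x\<in>W. (f has_derivative blinfun_apply (f' x)) (at x)) \<and>
        (\<forall>x\<in>W. (f' has_derivative blinfun_apply (f'' x)) (at x)) \<and>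
        continuous_on W f'')"

definition upper_semicontinuous :: "('a::topological_space \<Rightarrow> real) \<Rightarrow> bool" where
  "upper_semicontinuous f \<longleftrightarrow> (\<forall>a. open {x. f x < a})"

definition strictly_convex :: "('a::real_vector \<Rightarrow> real) \<Rightarrow> bool" where
  "strictly_convex f \<longleftrightarrow>
     (\<forall>x y t. x \<noteq> y \<longrightarrow> 0 < t \<longrightarrow> t < 1 \<longrightarrow>
        f ((1 - t) *\<^sub>R x + t *\<^sub>R y) < (1 - t) * f x + t * f y)"

definition separable_along :: "real^'n^'n \<Rightarrow> ('n \<Rightarrow> real \<Rightarrow> real) \<Rightarrow> (real^'n \<Rightarrow> real) \<Rightarrow> bool" where
  "separable_along Q c f \<longleftrightarrow> (\<forall>z. f z = (\<Sum>i\<in>UNIV. c i ((transpose Q *v z) $ i)))"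

section \<open>Optimal transport\<close>

definition couplings :: "'a measure \<Rightarrow> 'b measure \<Rightarrow> ('a \<times> 'b) measure set" where
  "couplings M N = {\<gamma>. prob_space \<gamma> \<and> sets \<gamma> = sets (M \<Otimes>\<^sub>M N) \<and>
                       distr \<gamma> M fst = M \<and> distr \<gamma> N snd = N}"

text \<open>The integral of \<open>c\<close> as an extended real, the difference of the integrals of the positive
  and the negative part. It has its usual meaning whenever the integral of the negative part is
  finite, which the bound \<open>has_integrable_minorant\<close> below guarantees for every coupling.
  (The Bochner integral would yield 0 instead of \<open>\<infinity>\<close>.)\<close>

definition transport_cost :: "('a \<Rightarrow> 'b \<Rightarrow> real) \<Rightarrow> ('a \<times> 'b) measure \<Rightarrow> ereal" where
  "transport_cost c \<gamma> =
     enn2ereal (\<integral>\<^sup>+ z. ennreal (c (fst z) (snd z)) \<partial>\<gamma>) -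
     enn2ereal (\<integral>\<^sup>+ z. ennreal (- c (fst z) (snd z)) \<partial>\<gamma>)"

definition optimal_cost :: "('a \<Rightarrow> 'b \<Rightarrow> real) \<Rightarrow> 'a measure \<Rightarrow> 'b measure \<Rightarrow> ereal" where
  "optimal_cost c M N = (INF \<gamma>\<in>couplings M N. transport_cost c \<gamma>)"

definition has_integrable_minorant ::
    "('a::topological_space \<Rightarrow> 'b::topological_space \<Rightarrow> real) \<Rightarrow> 'a measure \<Rightarrow> 'b measure \<Rightarrow> bool" where
  "has_integrable_minorant c M N \<longleftrightarrow>
     (\<exists>u v. upper_semicontinuous u \<and> upper_semicontinuous v \<and> integrable M u \<and> integrable N v \<and>
            (\<forall>x y. c x y \<ge> u x + v y))"

definition optimal_transport_map ::
    "('a \<Rightarrow> 'b \<Rightarrow> real) \<Rightarrow> 'a measure \<Rightarrow> 'b measure \<Rightarrow> ('a \<Rightarrow> 'b) \<Rightarrow> bool" where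
  "optimal_transport_map c M N T \<longleftrightarrow>
     T \<in> measurable M N \<and> distr M N T = N \<and>
     transport_cost c (distr M (M \<Otimes>\<^sub>M N) (\<lambda>x. (x, T x))) = optimal_cost c M N"

end

theory Submission
  imports Defs "HOL-Real_Asymp.Real_Asymp"
begin

text \<open>
\<^emph>\<open>Necessity.\<close> An optimal plan of finite cost cannot be improved by permuting the targets of finitely many small
portions of mass. Since the density is positive on \<open>U\<close> and cost and map are continuous, this
yields cyclical monotonicity at all points of \<open>U\<close> (\<open>optimal_map_permutation_monotone\<close>). The displacement
\<open>x - (A *v x + b)\<close> of a fixed point of \<open>U\<close> takes every value \<open>z\<close> as \<open>b\<close> varies, so these inequalities describe \<open>ct\<close>
near an arbitrary \<open>z\<close>.

Two points that differ by a multiple of an eigenvector of \<open>A\<close> give an inequality between increments of \<open>ct\<close>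
on the line in this direction, and hence its convexity there, also across the exceptional points
(\<open>convex_along_eigenvector\<close>). The vertices of a shrinking regular polygon with many vertices give, to second order,
that the Hessian of \<open>ct\<close> commutes with \<open>A\<close> (\<open>hessian_times_matrix_symmetric\<close>). If the eigenvalues of \<open>A\<close> are
distinct, the Hessian is therefore diagonal in the eigenbasis; the mixed differences of \<open>ct\<close> vanish, finitely
many bad points notwithstanding (\<open>mixed_difference_zero\<close>), and \<open>ct\<close> is a sum of convex functions of
the coordinates (\<open>cyclically_monotone_imp_separable_convex\<close>).

\<^emph>\<open>Cross-coupling.\<close> The diagonal Hessian also commutes with the second matrix. A nonzero off-diagonal entry
equates \<open>c\<^sub>i''\<close> and \<open>c\<^sub>j''\<close> at independent arguments, so both are the same constant
(\<open>coupled_coordinates_quadratic\<close>).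

\<^emph>\<open>Sufficiency.\<close> For a convex cost on the line, an increasing affine map has explicit dual potentials
(\<open>one_dimensional_potentials\<close>); in several dimensions their sums over the coordinates serve. The potentials need not
be integrable. They are truncated after subtracting the integrable minorant from the cost, and Fatou's lemma removes the
truncation (\<open>contact_map_cost_le\<close>). If the summands are strictly convex, the potentials touch the cost only on the graph,
which gives uniqueness (\<open>contact_map_unique\<close>).
\<close>

section \<open>Transport costs and couplings\<close>

lemma transport_cost_integrable:
  assumes "integrable \<gamma> (\<lambda>z. c (fst z) (snd z))"
  shows "transport_cost c \<gamma> = ereal (\<integral>z. c (fst z) (snd z) \<partial>\<gamma>)"
proof -
  have fin: "(\<integral>\<^sup>+ z. ennreal (c (fst z) (snd z)) \<partial>\<gamma>) < \<infinity>"
       "(\<integral>\<^sup>+ z. ennreal (- c (fst z) (snd z)) \<partial>\<gamma>) < \<infinity>"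
    using assms by (auto simp: real_integrable_def less_top)
  have e: "enn2ereal x = ereal (enn2real x)" if "x < \<infinity>" for x
    using that by (cases x) (auto simp: enn2ereal_ennreal)
  show ?thesis
    unfolding transport_cost_def real_lebesgue_integral_def[OF assms]
    using fin by (simp add: e)
qed

text \<open>Subtracting an integrable minorant turns the difference of positive and negative part into a single
nonnegative integral. This is the form in which costs are compared below; it also shows that a cost
is finite only if the cost function is integrable.\<close>

lemma transport_cost_above_minorant:
  assumes f: "(\<lambda>z. c (fst z) (snd z)) \<in> borel_measurable \<gamma>"
    and w: "integrable \<gamma> w" and le: "\<And>z. w z \<le> c (fst z) (snd z)"
  shows "transport_cost c \<gamma> =
           enn2ereal (\<integral>\<^sup>+ z. ennreal (c (fst z) (snd z) - w z) \<partial>\<gamma>) + ereal (\<integral>z. w z \<partial>\<gamma>)"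
    and "transport_cost c \<gamma> < \<infinity> \<longleftrightarrow> integrable \<gamma> (\<lambda>z. c (fst z) (snd z))"
proof -
  note [measurable] = f borel_measurable_integrable[OF w]
  let ?f = "\<lambda>z. c (fst z) (snd z)"
  have "transport_cost c \<gamma> =
           enn2ereal (\<integral>\<^sup>+ z. ennreal (c (fst z) (snd z) - w z) \<partial>\<gamma>) + ereal (\<integral>z. w z \<partial>\<gamma>)
    \<and> (transport_cost c \<gamma> < \<infinity> \<longleftrightarrow> integrable \<gamma> (\<lambda>z. c (fst z) (snd z)))"
  proof (cases "integrable \<gamma> ?f")
    case True
    have i: "integrable \<gamma> (\<lambda>z. ?f z - w z)" using True w by auto
    have "(\<integral>\<^sup>+ z. ennreal (?f z - w z) \<partial>\<gamma>) = ennreal (\<integral>z. ?f z - w z \<partial>\<gamma>)"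
      by (rule nn_integral_eq_integral[OF i]) (simp add: le)
    moreover have "(\<integral>z. ?f z - w z \<partial>\<gamma>) \<ge> 0" by (rule integral_nonneg_AE) (simp add: le)
    ultimately show ?thesis
      using True w by (simp add: transport_cost_integrable enn2ereal_ennreal)
  next
    case False
    have "(\<integral>\<^sup>+ z. ennreal (- ?f z) \<partial>\<gamma>) \<le> (\<integral>\<^sup>+ z. ennreal (- w z) \<partial>\<gamma>)"
      by (intro nn_integral_mono ennreal_leI) (simp add: le)
    also have "\<dots> < \<infinity>" using w by (auto simp: real_integrable_def less_top)
    finally have neg: "(\<integral>\<^sup>+ z. ennreal (- ?f z) \<partial>\<gamma>) < \<infinity>" .
    have pos: "(\<integral>\<^sup>+ z. ennreal (?f z) \<partial>\<gamma>) = \<infinity>"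
      using False neg f unfolding real_integrable_def by (auto simp: less_top[symmetric])
    have c: "transport_cost c \<gamma> = \<infinity>"
      unfolding transport_cost_def using pos neg by (cases "(\<integral>\<^sup>+ z. ennreal (- ?f z) \<partial>\<gamma>)") auto
    have "\<not> integrable \<gamma> (\<lambda>z. ?f z - w z)"
      using False Bochner_Integration.integrable_add[OF _ w, of "\<lambda>z. ?f z - w z"] by auto
    moreover have "integrable \<gamma> (\<lambda>z. ?f z - w z)" if "(\<integral>\<^sup>+ z. ennreal (?f z - w z) \<partial>\<gamma>) < \<infinity>"
      by (rule integrableI_nonneg) (use le that in auto)
    ultimately have "(\<integral>\<^sup>+ z. ennreal (?f z - w z) \<partial>\<gamma>) = \<infinity>"
      by (metis infinity_ennreal_def less_top)
    then show ?thesis using c False by auto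
  qed
  then show "transport_cost c \<gamma> =
           enn2ereal (\<integral>\<^sup>+ z. ennreal (c (fst z) (snd z) - w z) \<partial>\<gamma>) + ereal (\<integral>z. w z \<partial>\<gamma>)"
    and "transport_cost c \<gamma> < \<infinity> \<longleftrightarrow> integrable \<gamma> (\<lambda>z. c (fst z) (snd z))" by blast+
qed

lemma coupling_marginals:
  assumes "\<gamma> \<in> couplings M N"
  shows "fst \<in> measurable \<gamma> M" "snd \<in> measurable \<gamma> N" "prob_space \<gamma>"
    "sets \<gamma> = sets (M \<Otimes>\<^sub>M N)" "distr \<gamma> M fst = M" "distr \<gamma> N snd = N"
  using assms unfolding couplings_def by (auto cong: measurable_cong_sets)

lemma graph_coupling:
  assumes "prob_space M" and T: "T \<in> measurable M N" and "distr M N T = N"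
  shows "distr M (M \<Otimes>\<^sub>M N) (\<lambda>x. (x, T x)) \<in> couplings M N"
proof -
  have [measurable]: "(\<lambda>x. (x, T x)) \<in> measurable M (M \<Otimes>\<^sub>M N)" using T by measurable
  show ?thesis
    using assms unfolding couplings_def
    by (auto simp: distr_distr comp_def distr_id2 intro!: prob_space.prob_space_distr)
qed

section \<open>Exchanging mass along a permutation\<close>

lemma sum_of_disjoint_indicators:
  assumes fin: "finite I" and disj: "disjoint_family_on B I"
  shows "g (if \<exists>k\<in>I. x \<in> B k \<and> x' \<in> C k then a else b) =
     g b + (\<Sum>k\<in>I. indicator (B k \<times> C k) (x, x') * (g a - g b :: real))"
proof (cases "\<exists>k\<in>I. x \<in> B k \<and> x' \<in> C k")
  case True
  then obtain k where k: "k \<in> I" "x \<in> B k" "x' \<in> C k" by auto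
  have u: "j = k" if "j \<in> I" "x \<in> B j" for j
    using disj that k unfolding disjoint_family_on_def by blast
  have e: "indicator (B j \<times> C j) (x, x') * (g a - g b) = (if j = k then g a - g b else 0)"
    if j: "j \<in> I" for j
  proof (cases "j = k")
    case True
    then show ?thesis using k by simp
  next
    case False
    then have "x \<notin> B j" using u j by blast
    then show ?thesis using False by simp
  qed
  have "(\<Sum>j\<in>I. indicator (B j \<times> C j) (x, x') * (g a - g b)) = g a - g b"
    using fin k(1) by (subst sum.cong[OF refl e]) (simp_all only: sum.delta if_True)
  moreover have "(if \<exists>k\<in>I. x \<in> B k \<and> x' \<in> C k then a else b) = a" using True by (rule if_P)
  ultimately show ?thesis by simp
next
  case False
  then have "(\<Sum>j\<in>I. indicator (B j \<times> C j) (x, x') * (g a - g b)) = 0"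
    by (intro sum.neutral) (auto simp: indicator_def)
  moreover have "(if \<exists>k\<in>I. x \<in> B k \<and> x' \<in> C k then a else b) = b" using False by (rule if_not_P)
  ultimately show ?thesis by simp
qed

text \<open>The competitor to the map \<open>T\<close> is the law of a pair \<open>(X, Y)\<close>. Let \<open>X\<close> and \<open>X'\<close> be independent with law \<open>M\<close>,
and let \<open>Y = T X'\<close> if \<open>X \<in> B k\<close> and \<open>X' \<in> B (\<sigma> k)\<close> for some \<open>k\<close>, and \<open>Y = T X\<close> otherwise. Relative to the
law of \<open>T X\<close>, the law of \<open>Y\<close> gains \<open>m\<close> times the image of \<open>M\<close> restricted to \<open>B (\<sigma> k)\<close> and loses \<open>m\<close> times
the image of \<open>M\<close> restricted to \<open>B k\<close>, for each \<open>k\<close>. As all \<open>B k\<close> have the same mass \<open>m\<close>, these changes cancel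
when summed over \<open>k\<close>, because \<open>\<sigma>\<close> is a permutation. The cost changes by at most
\<open>m\<^sup>2 (\<Sum>k. a k - b k)\<close>, which optimality forbids to be negative.\<close>

lemma exchange_inequality:
  fixes M :: "'a measure" and N :: "'b measure" and c :: "'a \<Rightarrow> 'b \<Rightarrow> real" and B :: "'k \<Rightarrow> 'a set"
  assumes "prob_space M" and T[measurable]: "T \<in> measurable M N" and TN: "distr M N T = N"
    and c[measurable]: "(\<lambda>z. c (fst z) (snd z)) \<in> borel_measurable (M \<Otimes>\<^sub>M N)"
    and int: "integrable M (\<lambda>x. c x (T x))"
    and opt: "\<And>\<gamma>. \<gamma> \<in> couplings M N \<Longrightarrow> ereal (\<integral>x. c x (T x) \<partial>M) \<le> transport_cost c \<gamma>"
    and I: "finite I" and \<sigma>: "bij_betw \<sigma> I I"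
    and B: "\<And>k. k \<in> I \<Longrightarrow> B k \<in> sets M" and disj: "disjoint_family_on B I"
    and m: "\<And>k. k \<in> I \<Longrightarrow> measure M (B k) = m" "m > 0"
    and up: "\<And>k x x'. k \<in> I \<Longrightarrow> x \<in> B k \<Longrightarrow> x' \<in> B (\<sigma> k) \<Longrightarrow> c x (T x') \<le> a k"
    and lo: "\<And>k x. k \<in> I \<Longrightarrow> x \<in> B k \<Longrightarrow> b k \<le> c x (T x)"
    and bd: "\<And>k x x'. k \<in> I \<Longrightarrow> x \<in> B k \<Longrightarrow> x' \<in> B (\<sigma> k) \<Longrightarrow> \<bar>c x (T x')\<bar> \<le> K"
  shows "sum b I \<le> sum a I"
proof -
  interpret M: prob_space M by fact
  interpret P: pair_prob_space M M ..
  have \<sigma>I: "\<sigma> k \<in> I" if "k \<in> I" for k using \<sigma> that by (auto simp: bij_betw_def)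
  let ?P = "M \<Otimes>\<^sub>M M"
  let ?Q = "\<lambda>k. B k \<times> B (\<sigma> k)"
  define R where "R z = (if \<exists>k\<in>I. fst z \<in> B k \<and> snd z \<in> B (\<sigma> k) then T (snd z) else T (fst z))" for z
  have Q[measurable]: "?Q k \<in> sets ?P" if "k \<in> I" for k using B that \<sigma>I by auto
  have R[measurable]: "R \<in> measurable ?P N"
  proof -
    have "{z\<in>space ?P. \<exists>k\<in>I. fst z \<in> B k \<and> snd z \<in> B (\<sigma> k)} = (\<Union>k\<in>I. ?Q k)"
      using sets.sets_into_space[OF Q] by fastforce
    also have "\<dots> \<in> sets ?P" using I Q by auto
    finally have S: "{z\<in>space ?P. \<exists>k\<in>I. fst z \<in> B k \<and> snd z \<in> B (\<sigma> k)} \<in> sets ?P" .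
    show ?thesis unfolding R_def by (rule measurable_If[OF _ _ S]; measurable)
  qed
  have R_expand: "g (R z) = g (T (fst z)) +
      (\<Sum>k\<in>I. indicator (?Q k) z * (g (T (snd z)) - g (T (fst z))))" for g :: "_ \<Rightarrow> real" and z
    unfolding R_def using sum_of_disjoint_indicators[OF I disj, of g "fst z" "snd z" "\<lambda>k. B (\<sigma> k)"] by simp
  have mP: "measure ?P (X \<times> Y) = measure M X * measure M Y"
    if "X \<in> sets M" "Y \<in> sets M" for X Y
    using that by (simp add: measure_def M.emeasure_pair_measure_Times enn2real_mult)
  have dfst: "distr ?P M fst = M" by (rule M.distr_pair_fst)
  have Pfst: "integrable ?P (\<lambda>z. g (fst z))" "(\<integral>z. g (fst z) \<partial>?P) = (\<integral>x. g x \<partial>M)"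
    if "integrable M g" for g :: "'a \<Rightarrow> real"
  proof -
    show "integrable ?P (\<lambda>z. g (fst z))"
      using that by (subst integrable_distr_eq[of fst ?P M g, symmetric]) (auto simp: dfst)
    show "(\<integral>z. g (fst z) \<partial>?P) = (\<integral>x. g x \<partial>M)"
      using that by (subst integral_distr[of fst ?P M g, symmetric]) (auto simp: dfst)
  qed
  let ?h = "\<lambda>z. (fst z, R z)"
  let ?\<gamma> = "distr ?P (M \<Otimes>\<^sub>M N) ?h"
  have h[measurable]: "?h \<in> measurable ?P (M \<Otimes>\<^sub>M N)" by measurable
  \<comment> \<open>The second marginal: the contributions of the exchange telescope along the permutation.\<close>
  have RN: "distr ?P N R = N"
  proof (rule measure_eqI)
    fix E assume "E \<in> sets (distr ?P N R)"
    then have E[measurable]: "E \<in> sets N" by simp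
    let ?E = "T -` E \<inter> space M"
    have E'[measurable]: "?E \<in> sets M" by measurable
    have i: "indicator (?Q k) z * (indicator E (T (snd z)) - indicator E (T (fst z)) :: real)
       = indicator (B k \<times> (B (\<sigma> k) \<inter> ?E)) z - indicator ((B k \<inter> ?E) \<times> B (\<sigma> k)) z"
      if "k \<in> I" for k z
      using sets.sets_into_space[OF B[OF that]] sets.sets_into_space[OF B[OF \<sigma>I[OF that]]]
      by (cases z) (auto simp: indicator_def)
    have ii: "integrable ?P (\<lambda>z. indicator (B k \<times> (B (\<sigma> k) \<inter> ?E)) z :: real)"
       "integrable ?P (\<lambda>z. indicator ((B k \<inter> ?E) \<times> B (\<sigma> k)) z :: real)" if "k \<in> I" for k
      using B that \<sigma>I by (auto intro!: P.integrable_const_bound[of _ 1] borel_measurable_indicator)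
    have iE: "integrable M (\<lambda>x. indicator E (T x) :: real)"
      by (intro M.integrable_const_bound[of _ 1]) auto
    have "measure (distr ?P N R) E = (\<integral>y. indicator E y \<partial>distr ?P N R)" by simp
    also have "\<dots> = (\<integral>z. indicator E (R z) \<partial>?P)"
      by (subst integral_distr) auto
    also have "\<dots> = (\<integral>z. indicator E (T (fst z)) + (\<Sum>k\<in>I. 
        indicator (B k \<times> (B (\<sigma> k) \<inter> ?E)) z - indicator ((B k \<inter> ?E) \<times> B (\<sigma> k)) z) \<partial>?P)"
      by (subst R_expand) (simp add: i)
    also have "\<dots> = (\<integral>z. indicator E (T (fst z)) \<partial>?P) + (\<Sum>k\<in>I. 
        measure ?P (B k \<times> (B (\<sigma> k) \<inter> ?E)) - measure ?P ((B k \<inter> ?E) \<times> B (\<sigma> k)))"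
      using ii B \<sigma>I Pfst(1)[OF iE] by (simp add: Bochner_Integration.integral_sum)
    also have "(\<integral>z. indicator E (T (fst z)) \<partial>?P) = (\<integral>x. indicator E (T x) \<partial>M :: real)"
      by (rule Pfst(2)[OF iE])
    also have "\<dots> = (\<integral>y. indicator E y \<partial>distr M N T)" by (subst integral_distr) auto
    also have "(\<Sum>k\<in>I. measure ?P (B k \<times> (B (\<sigma> k) \<inter> ?E)) - measure ?P ((B k \<inter> ?E) \<times> B (\<sigma> k)))
       = (\<Sum>k\<in>I. m * measure M (B (\<sigma> k) \<inter> ?E)) - (\<Sum>k\<in>I. m * measure M (B k \<inter> ?E))"
      using B \<sigma>I m by (simp add: mP sum_subtractf mult.commute)
    also have "(\<Sum>k\<in>I. m * measure M (B (\<sigma> k) \<inter> ?E)) = (\<Sum>k\<in>I. m * measure M (B k \<inter> ?E))"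
      by (rule sum.reindex_bij_betw[OF \<sigma>])
    finally have "measure (distr ?P N R) E = measure N E" by (simp add: TN)
    moreover have "finite_measure (distr ?P N R)" "finite_measure (distr M N T)"
      by (simp_all add: P.finite_measure_distr M.finite_measure_distr)
    ultimately show "emeasure (distr ?P N R) E = emeasure N E"
      by (simp add: TN finite_measure.emeasure_eq_measure)
  qed simp
  have "prob_space ?\<gamma>" by (intro P.prob_space_distr h)
  then have coup: "?\<gamma> \<in> couplings M N"
    unfolding couplings_def by (simp add: distr_distr comp_def dfst RN)
  let ?d = "\<lambda>k z. indicator (?Q k) z * (c (fst z) (T (snd z)) - c (fst z) (T (fst z)))"
  have cfst: "integrable ?P (\<lambda>z. c (fst z) (T (fst z)))" by (rule Pfst(1)[OF int])
  have cm[measurable]: "(\<lambda>z. c (fst z) (T (snd z))) \<in> borel_measurable ?P"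
    using measurable_compose[of "\<lambda>z. (fst z, T (snd z))" ?P "M \<Otimes>\<^sub>M N", OF _ c] by simp
  have di: "integrable ?P (?d k)" if k: "k \<in> I" for k
  proof -
    note [measurable] = Q[OF k]
    have "integrable ?P (\<lambda>z. indicator (?Q k) z * c (fst z) (T (snd z)))"
      using order_trans[OF bd[OF k] abs_ge_self]
      by (intro P.integrable_const_bound[of _ "\<bar>K\<bar>"] AE_I2) (auto simp: indicator_def)
    moreover have "integrable ?P (\<lambda>z. indicator (?Q k) z * c (fst z) (T (fst z)))"
      using integrable_mult_indicator[OF Q[OF k] cfst] by simp
    ultimately show ?thesis by (simp add: right_diff_distrib)
  qed
  have dle: "(\<integral>z. ?d k z \<partial>?P) \<le> m * m * (a k - b k)" if k: "k \<in> I" for k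
  proof -
    note [measurable] = Q[OF k]
    have "(\<integral>z. ?d k z \<partial>?P) \<le> (\<integral>z. indicator (?Q k) z * (a k - b k) \<partial>?P)"
    proof (rule integral_mono[OF di[OF k]])
      show "integrable ?P (\<lambda>z. indicator (?Q k) z * (a k - b k))"
        by (intro P.integrable_const_bound[of _ "\<bar>a k - b k\<bar>"]) (auto simp: indicator_def)
      show "?d k z \<le> indicator (?Q k) z * (a k - b k)" for z
        using up[OF k, of "fst z" "snd z"] lo[OF k, of "fst z"] by (auto simp: indicator_def)
    qed
    also have "\<dots> = m * m * (a k - b k)"
      using B \<sigma>I k m by (simp add: mP)
    finally show ?thesis .
  qed
  have R2: "c (fst z) (R z) = c (fst z) (T (fst z)) + (\<Sum>k\<in>I. ?d k z)" for z
    by (rule R_expand)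
  have int2: "integrable ?P (\<lambda>z. c (fst z) (R z))"
    unfolding R2 using di cfst by auto
  have "integrable ?\<gamma> (\<lambda>z. c (fst z) (snd z))"
    using int2 by (subst integrable_distr_eq) auto
  then have "transport_cost c ?\<gamma> = ereal (\<integral>z. c (fst z) (snd z) \<partial>?\<gamma>)"
    by (rule transport_cost_integrable)
  also have "(\<integral>z. c (fst z) (snd z) \<partial>?\<gamma>) = (\<integral>z. c (fst z) (R z) \<partial>?P)"
    by (subst integral_distr) auto
  also have "\<dots> = (\<integral>x. c x (T x) \<partial>M) + (\<Sum>k\<in>I. (\<integral>z. ?d k z \<partial>?P))"
    unfolding R2 using di cfst by (simp add: Bochner_Integration.integral_sum Pfst(2)[OF int])
  finally have "0 \<le> (\<Sum>k\<in>I. (\<integral>z. ?d k z \<partial>?P))" using opt[OF coup] by simp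
  also have "\<dots> \<le> (\<Sum>k\<in>I. m * m * (a k - b k))" by (intro sum_mono dle)
  also have "\<dots> = m * m * (sum a I - sum b I)" by (simp add: sum_distrib_left[symmetric] sum_subtractf)
  finally show ?thesis using mult_pos_pos[OF m(2) m(2)] by (auto simp: zero_le_mult_iff)
qed

section \<open>Cyclical monotonicity of optimal maps\<close>

text \<open>Spheres are Lebesgue null sets, so the distribution function of the distance to \<open>a\<close> has no jumps.\<close>

lemma isCont_measure_cball:
  fixes M :: "'a::euclidean_space measure"
  assumes M: "prob_space M" "sets M = sets borel" and ac: "absolutely_continuous lborel M"
  shows "isCont (\<lambda>r. measure M (cball a r)) r"
proof -
  interpret M: prob_space M by (rule M)
  have sp: "space M = UNIV" using sets_eq_imp_space_eq[OF M(2)] by simp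
  have [measurable]: "dist a \<in> borel_measurable M"
    unfolding measurable_cong_sets[OF M(2) refl] by measurable
  let ?D = "distr M borel (dist a)"
  interpret D: real_distribution ?D
    by (rule M.real_distribution_distr) measurable
  have cdf: "cdf ?D = (\<lambda>r. measure M (cball a r))"
    by (auto simp: cdf_def fun_eq_iff measure_distr sp intro!: arg_cong[where f="measure M"])
  have "sphere a r \<in> null_sets lborel"
    using negligible_sphere[of a r] by (simp add: negligible_iff_null_sets null_sets_completion_iff)
  then have "sphere a r \<in> null_sets M" using ac by (auto simp: absolutely_continuous_def)
  then have "measure M (sphere a r) = 0" by (simp add: null_sets_def measure_def)
  moreover have "dist a -` {r} \<inter> space M = sphere a r" by (auto simp: sp)
  ultimately have "measure ?D {r} = 0" by (simp add: measure_distr)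
  then show ?thesis using D.isCont_cdf[of r] by (simp add: cdf)
qed

text \<open>Balls of prescribed equal mass exist by the intermediate value theorem; the exchange argument needs them.\<close>

lemma cball_of_given_mass:
  fixes M :: "'a::euclidean_space measure"
  assumes M: "prob_space M" "sets M = sets borel" and ac: "absolutely_continuous lborel M"
    and \<delta>: "0 \<le> \<delta>" and m: "0 \<le> m" "m \<le> measure M (cball a \<delta>)"
  obtains r where "r \<le> \<delta>" "measure M (cball a r) = m"
proof -
  have "{a} \<in> null_sets M" using ac finite_imp_null_set_lborel[of "{a}"] by (auto simp: absolutely_continuous_def)
  then have "measure M (cball a 0) = 0" by (simp add: null_sets_def measure_def)
  then have "\<exists>r\<ge>0. r \<le> \<delta> \<and> measure M (cball a r) = m"
    using m \<delta> isCont_measure_cball[OF M ac] by (intro IVT) auto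
  then show ?thesis using that by blast
qed

lemma cball_mass_pos:
  fixes \<rho> :: "'a::euclidean_space \<Rightarrow> ennreal"
  assumes [measurable]: "\<rho> \<in> borel_measurable borel" and M: "M = density lborel \<rho>" "prob_space M"
    and pos: "\<And>x. x \<in> cball a \<delta> \<Longrightarrow> \<rho> x > 0" and \<delta>: "\<delta> > 0"
  shows "measure M (cball a \<delta>) > 0"
proof -
  interpret M: prob_space M by (rule M)
  have "emeasure M (cball a \<delta>) \<noteq> 0"
  proof
    assume "emeasure M (cball a \<delta>) = 0"
    then have "cball a \<delta> \<in> null_sets (density lborel \<rho>)" by (simp add: null_sets_def M(1))
    then have "AE x in lborel. x \<in> cball a \<delta> \<longrightarrow> \<rho> x = 0" by (subst (asm) null_sets_density_iff) auto
    then have "AE x in lborel. x \<notin> cball a \<delta>" by eventually_elim (use pos in force)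
    then have "cball a \<delta> \<in> null_sets lborel" by (subst (asm) AE_iff_null) (auto simp: cball_def)
    then have "measure lborel (cball a \<delta>) = 0" by (simp add: null_sets_def measure_def)
    then show False using content_cball_pos[OF \<delta>, of a] by simp
  qed
  then show ?thesis by (simp add: M.emeasure_eq_measure zero_less_measure_iff)
qed

lemma continuous_cost_measurable:
  fixes c :: "'a::euclidean_space \<Rightarrow> 'b::euclidean_space \<Rightarrow> real"
  assumes "continuous_on UNIV (\<lambda>z. c (fst z) (snd z))" "sets M = sets borel" "sets N = sets borel"
  shows "(\<lambda>z. c (fst z) (snd z)) \<in> borel_measurable (M \<Otimes>\<^sub>M N)"
proof -
  have "sets (M \<Otimes>\<^sub>M N) = sets borel"
    unfolding borel_prod[symmetric] using assms by (intro sets_pair_measure_cong) auto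
  then show ?thesis using borel_measurable_continuous_onI[OF assms(1)] by (simp cong: measurable_cong_sets)
qed

text \<open>Cyclical monotonicity of the graph of an optimal map. Around the points \<open>x k\<close> one takes disjoint balls, so small
that the cost is almost constant on the relevant products, and shrinks them to a common mass. Then
\<open>exchange_inequality\<close> applies with errors that are arbitrarily small by continuity. Points where the density is
positive have neighbourhoods of positive mass, which is why the inequality holds at \<^emph>\<open>every\<close> point of \<open>U\<close>.\<close>

lemma optimal_map_permutation_monotone:
  fixes M :: "'a::euclidean_space measure" and T :: "'a \<Rightarrow> 'b::euclidean_space"
    and x :: "'k \<Rightarrow> 'a"
  assumes \<rho>: "\<rho> \<in> borel_measurable borel" and M: "M = density lborel \<rho>" "prob_space M"
    and U: "open U" "\<And>x. x \<in> U \<Longrightarrow> \<rho> x > 0"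
    and contT: "continuous_on UNIV T" and contc: "continuous_on UNIV (\<lambda>z. c (fst z) (snd z))"
    and opt: "optimal_transport_map c M (distr M borel T) T"
    and minorant: "has_integrable_minorant c M (distr M borel T)"
    and fin: "optimal_cost c M (distr M borel T) < \<infinity>"
    and I: "finite I" and \<sigma>: "bij_betw \<sigma> I I" and x: "inj_on x I" "\<And>k. k \<in> I \<Longrightarrow> x k \<in> U"
  shows "(\<Sum>k\<in>I. c (x k) (T (x k))) \<le> (\<Sum>k\<in>I. c (x k) (T (x (\<sigma> k))))"
proof (cases "I = {}")
  case False
  let ?N = "distr M borel T"
  interpret M: prob_space M by (rule M)
  have sM[measurable_cong]: "sets M = sets borel" by (simp add: M)
  have [measurable]: "T \<in> borel_measurable borel" using contT by (rule borel_measurable_continuous_onI)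
  have cT: "(\<lambda>z. c (fst z) (snd z)) \<in> borel_measurable (M \<Otimes>\<^sub>M ?N)"
    by (rule continuous_cost_measurable[OF contc sM]) simp
  have TN: "distr M ?N T = ?N" by (intro distr_cong) auto
  have TM[measurable]: "T \<in> measurable M ?N" by measurable
  have absc: "absolutely_continuous lborel M" unfolding M(1) using \<rho> by (intro absolutely_continuousI_density) simp
  let ?G = "distr M (M \<Otimes>\<^sub>M ?N) (\<lambda>x. (x, T x))"
  have gm: "(\<lambda>x. (x, T x)) \<in> measurable M (M \<Otimes>\<^sub>M ?N)" by measurable
  have cost: "transport_cost c ?G = optimal_cost c M ?N"
    using opt by (simp add: optimal_transport_map_def)
  obtain u v where uv: "integrable M u" "integrable ?N v" "\<And>x y. u x + v y \<le> c x y"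
    using minorant by (auto simp: has_integrable_minorant_def)
  have w: "integrable ?G (\<lambda>z. u (fst z) + v (snd z))"
  proof -
    note [measurable] = borel_measurable_integrable[OF uv(1)] borel_measurable_integrable[OF uv(2)]
    have "integrable M (\<lambda>x. v (T x))" using uv(2) by (subst (asm) integrable_distr_eq) auto
    then show ?thesis using uv(1) gm by (subst integrable_distr_eq) auto
  qed
  have "integrable ?G (\<lambda>z. c (fst z) (snd z))"
    using transport_cost_above_minorant(2)[OF _ w, of c] cT uv(3) cost fin by simp
  then have int: "integrable M (\<lambda>x. c x (T x))"
    using cT gm by (subst (asm) integrable_distr_eq) auto
  have "transport_cost c ?G = ereal (\<integral>z. c (fst z) (snd z) \<partial>?G)"
    by (rule transport_cost_integrable) fact
  also have "(\<integral>z. c (fst z) (snd z) \<partial>?G) = (\<integral>x. c x (T x) \<partial>M)"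
    using cT gm by (subst integral_distr) auto
  finally have le: "ereal (\<integral>x. c x (T x) \<partial>M) \<le> transport_cost c \<gamma>" if "\<gamma> \<in> couplings M ?N" for \<gamma>
    using cost that INF_lower[of \<gamma> "couplings M ?N" "transport_cost c"] by (simp add: optimal_cost_def)
  have approx: "(\<Sum>k\<in>I. c (x k) (T (x k)) - e) \<le> (\<Sum>k\<in>I. c (x k) (T (x (\<sigma> k))) + e)" if e: "e > 0" for e
  proof -
    have \<sigma>I: "\<sigma> k \<in> I" if "k \<in> I" for k using \<sigma> that by (auto simp: bij_betw_def)
    have near: "\<forall>\<^sub>F r in at_right 0. \<forall>y\<in>cball a r. \<forall>y'\<in>cball a' r. \<bar>c y (T y') - c a (T a')\<bar> < e" for a a'
    proof -
      have "continuous_on UNIV (\<lambda>z. (fst z, T (snd z)) :: 'a \<times> 'b)"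
        by (intro continuous_intros continuous_on_compose2[OF contT]) auto
      then have "continuous_on UNIV (\<lambda>z. c (fst z) (T (snd z)))"
        using continuous_on_compose2[OF contc, of UNIV "\<lambda>z. (fst z, T (snd z))"] by simp
      then have "isCont (\<lambda>z. c (fst z) (T (snd z))) (a, a')"
        by (simp add: continuous_on_eq_continuous_at)
      then obtain d where d: "d > 0" "\<And>z. dist z (a, a') < d \<Longrightarrow> \<bar>c (fst z) (T (snd z)) - c a (T a')\<bar> < e"
        using e unfolding continuous_at_eps_delta by (fastforce simp: dist_real_def)
      have "\<forall>\<^sub>F r in at_right 0. r < d / 2" using d(1) by (auto simp: eventually_at_right_field intro!: exI[of _ "d/2"])
      then show ?thesis
      proof eventually_elim
        case (elim r)
        show ?case
        proof (intro ballI)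
          fix y y' assume y: "y \<in> cball a r" "y' \<in> cball a' r"
          have "dist (y, y') (a, a') \<le> dist y a + dist y' a'"
            unfolding dist_Pair_Pair by (rule sqrt_sum_squares_le_sum) auto
          also have "\<dots> < d" using y elim by (auto simp: dist_commute)
          finally show "\<bar>c y (T y') - c a (T a')\<bar> < e" using d(2)[of "(y, y')"] by simp
        qed
      qed
    qed
    have inU: "\<forall>\<^sub>F r in at_right 0. cball a r \<subseteq> U" if "a \<in> U" for a
    proof -
      obtain d where d: "d > 0" "ball a d \<subseteq> U" using U(1) \<open>a \<in> U\<close> openE by blast
      have "\<forall>\<^sub>F r in at_right 0. r < d" using d(1) by (auto simp: eventually_at_right_field)
      then show ?thesis by eventually_elim (use d(2) in fastforce)
    qed
    have sep: "\<forall>\<^sub>F r in at_right 0. cball a r \<inter> cball a' r = {}" if "a \<noteq> a'" for a a' :: 'a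
    proof -
      have "\<forall>\<^sub>F r in at_right 0. r < dist a a' / 2"
        using that by (auto simp: eventually_at_right_field intro!: exI[of _ "dist a a' / 2"])
      then show ?thesis
      proof eventually_elim
        case (elim r)
        have False if "y \<in> cball a r" "y \<in> cball a' r" for y
          using that elim dist_triangle[of a a' y] by (auto simp: dist_commute)
        then show ?case by blast
      qed
    qed
    have "\<forall>\<^sub>F r in at_right 0. r > (0::real)" by (simp add: eventually_at_right_less)
    moreover have "\<forall>\<^sub>F r in at_right 0. \<forall>k\<in>I. \<forall>y\<in>cball (x k) r. \<forall>y'\<in>cball (x (\<sigma> k)) r.
        \<bar>c y (T y') - c (x k) (T (x (\<sigma> k)))\<bar> < e"
      by (intro eventually_ball_finite I ballI near)
    moreover have "\<forall>\<^sub>F r in at_right 0. \<forall>k\<in>I. \<forall>y\<in>cball (x k) r. \<forall>y'\<in>cball (x k) r.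
        \<bar>c y (T y') - c (x k) (T (x k))\<bar> < e"
      by (intro eventually_ball_finite I ballI near)
    moreover have "\<forall>\<^sub>F r in at_right 0. \<forall>k\<in>I. cball (x k) r \<subseteq> U"
      by (intro eventually_ball_finite I ballI inU x)
    moreover have "\<forall>\<^sub>F r in at_right 0. \<forall>k\<in>I. \<forall>j\<in>I. k \<noteq> j \<longrightarrow> cball (x k) r \<inter> cball (x j) r = {}"
    proof (intro eventually_ball_finite I ballI)
      fix k j assume "k \<in> I" "j \<in> I"
      then show "\<forall>\<^sub>F r in at_right 0. k \<noteq> j \<longrightarrow> cball (x k) r \<inter> cball (x j) r = {}"
        using sep[of "x k" "x j"] x(1) by (cases "k = j") (auto dest: inj_onD)
    qed
    ultimately have "\<forall>\<^sub>F r in at_right 0. r > 0 \<and> 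
        (\<forall>k\<in>I. \<forall>y\<in>cball (x k) r. \<forall>y'\<in>cball (x (\<sigma> k)) r. \<bar>c y (T y') - c (x k) (T (x (\<sigma> k)))\<bar> < e) \<and>
        (\<forall>k\<in>I. \<forall>y\<in>cball (x k) r. \<forall>y'\<in>cball (x k) r. \<bar>c y (T y') - c (x k) (T (x k))\<bar> < e) \<and>
        (\<forall>k\<in>I. cball (x k) r \<subseteq> U) \<and> (\<forall>k\<in>I. \<forall>j\<in>I. k \<noteq> j \<longrightarrow> cball (x k) r \<inter> cball (x j) r = {})"
      by eventually_elim blast
    from eventually_happens'[OF trivial_limit_at_right_real this]
    obtain \<delta> where \<delta>0: "\<delta> > 0 \<and> 
        (\<forall>k\<in>I. \<forall>y\<in>cball (x k) \<delta>. \<forall>y'\<in>cball (x (\<sigma> k)) \<delta>. \<bar>c y (T y') - c (x k) (T (x (\<sigma> k)))\<bar> < e) \<and>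
        (\<forall>k\<in>I. \<forall>y\<in>cball (x k) \<delta>. \<forall>y'\<in>cball (x k) \<delta>. \<bar>c y (T y') - c (x k) (T (x k))\<bar> < e) \<and>
        (\<forall>k\<in>I. cball (x k) \<delta> \<subseteq> U) \<and> (\<forall>k\<in>I. \<forall>j\<in>I. k \<noteq> j \<longrightarrow> cball (x k) \<delta> \<inter> cball (x j) \<delta> = {})"
      ..
    have \<delta>: "\<delta> > 0"
      "\<And>k y y'. k \<in> I \<Longrightarrow> y \<in> cball (x k) \<delta> \<Longrightarrow> y' \<in> cball (x (\<sigma> k)) \<delta> \<Longrightarrow> 
          \<bar>c y (T y') - c (x k) (T (x (\<sigma> k)))\<bar> < e"
      "\<And>k y y'. k \<in> I \<Longrightarrow> y \<in> cball (x k) \<delta> \<Longrightarrow> y' \<in> cball (x k) \<delta> \<Longrightarrow> 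
          \<bar>c y (T y') - c (x k) (T (x k))\<bar> < e"
      "\<And>k. k \<in> I \<Longrightarrow> cball (x k) \<delta> \<subseteq> U"
      "\<And>k j. k \<in> I \<Longrightarrow> j \<in> I \<Longrightarrow> k \<noteq> j \<Longrightarrow> cball (x k) \<delta> \<inter> cball (x j) \<delta> = {}"
      using \<delta>0 by (simp_all only: HOL.simp_thms)
    define m where "m = Min ((\<lambda>k. measure M (cball (x k) \<delta>)) ` I)"
    have "m > 0" unfolding m_def using I False \<delta>(1) \<delta>(4) U(2) cball_mass_pos[OF \<rho> M]
      by (subst Min_gr_iff) (auto simp: subset_iff)
    have mle: "m \<le> measure M (cball (x k) \<delta>)" if "k \<in> I" for k
      unfolding m_def using I that by (intro Min_le) auto
    have "\<exists>r. r \<le> \<delta> \<and> measure M (cball (x k) r) = m" if "k \<in> I" for k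
      by (rule cball_of_given_mass[OF M(2) sM absc, of \<delta> m "x k"])
         (use mle[OF that] \<delta>(1) \<open>m > 0\<close> in auto)
    then have "\<forall>k\<in>I. \<exists>r. r \<le> \<delta> \<and> measure M (cball (x k) r) = m" by blast
    from bchoice[OF this] obtain r where "\<forall>k\<in>I. r k \<le> \<delta> \<and> measure M (cball (x k) (r k)) = m" ..
    then have r: "\<And>k. k \<in> I \<Longrightarrow> r k \<le> \<delta>" "\<And>k. k \<in> I \<Longrightarrow> measure M (cball (x k) (r k)) = m"
      by simp_all
    have sub: "cball (x k) (r k) \<subseteq> cball (x k) \<delta>" if "k \<in> I" for k
      using r(1)[OF that] by (rule subset_cball)
    let ?K = "Max ((\<lambda>k. \<bar>c (x k) (T (x (\<sigma> k)))\<bar>) ` I) + e"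
    show ?thesis
    proof (rule exchange_inequality[OF M(2) TM TN cT int le I \<sigma>, of "\<lambda>k. cball (x k) (r k)"])
      show "disjoint_family_on (\<lambda>k. cball (x k) (r k)) I"
        unfolding disjoint_family_on_def using \<delta>(5) sub by blast
      show "measure M (cball (x k) (r k)) = m" if "k \<in> I" for k by (rule r(2)[OF that])
      fix k y y' assume k: "k \<in> I" and y: "y \<in> cball (x k) (r k)"
      then have y1: "y \<in> cball (x k) \<delta>" using sub by blast
      show "c (x k) (T (x k)) - e \<le> c y (T y)"
        using \<delta>(3)[OF k y1 y1] by (simp add: abs_less_iff)
      assume y': "y' \<in> cball (x (\<sigma> k)) (r (\<sigma> k))"
      have n: "\<bar>c y (T y') - c (x k) (T (x (\<sigma> k)))\<bar> < e"
        using y' sub[OF \<sigma>I[OF k]] by (intro \<delta>(2)[OF k y1]) auto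
      then show "c y (T y') \<le> c (x k) (T (x (\<sigma> k))) + e" by (simp add: abs_less_iff)
      have "\<bar>c (x k) (T (x (\<sigma> k)))\<bar> \<le> Max ((\<lambda>k. \<bar>c (x k) (T (x (\<sigma> k)))\<bar>) ` I)"
        using I k by (intro Max_ge) auto
      then show "\<bar>c y (T y')\<bar> \<le> ?K" using n by linarith
    qed (use \<open>m > 0\<close> sM in auto)
  qed
  have "(\<Sum>k\<in>I. c (x k) (T (x k))) \<le> (\<Sum>k\<in>I. c (x k) (T (x (\<sigma> k)))) + \<eta>" if "\<eta> > 0" for \<eta>
  proof -
    have "card I > 0" using False I by (simp add: card_gt_0_iff)
    then show ?thesis using approx[of "\<eta> / (2 * card I)"] that by (simp add: sum_subtractf sum.distrib)
  qed
  then show ?thesis by (rule field_le_epsilon)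
qed simp

section \<open>Convexity from increments, symmetry from polygons\<close>

text \<open>Where the difference to a chord is maximal, the midpoint inequality forces the same value at two symmetric
neighbours; moving as far as the nearer end point shows that the maximum is \<open>0\<close>.\<close>

lemma midpoint_convex_imp_convex:
  fixes f :: "real \<Rightarrow> real"
  assumes cont: "continuous_on UNIV f" and mid: "\<And>t p. p > 0 \<Longrightarrow> 2 * f t \<le> f (t - p) + f (t + p)"
  shows "convex_on UNIV f"
proof (rule convex_on_linorderI)
  fix t x y :: real
  assume t: "0 < t" "t < 1" and xy: "x < y"
  define \<kappa> where "\<kappa> = (f y - f x) / (y - x)"
  define L where "L s = f x + \<kappa> * (s - x)" for s
  define G where "G s = f s - L s" for s
  have L: "2 * L s = L (s - p) + L (s + p)" for s p by (simp add: L_def algebra_simps)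
  have Gmid: "2 * G s \<le> G (s - p) + G (s + p)" if "p > 0" for s p
    using mid[OF that, of s] L[of s p] by (simp add: G_def)
  have \<kappa>: "\<kappa> * (y - x) = f y - f x" using xy by (simp add: \<kappa>_def)
  then have ends: "G x = 0" "G y = 0" by (simp_all add: G_def L_def)
  have "continuous_on {x..y} G" unfolding G_def L_def
    by (intro continuous_intros continuous_on_subset[OF cont]) auto
  then obtain m where m: "m \<in> {x..y}" "\<And>s. s \<in> {x..y} \<Longrightarrow> G s \<le> G m"
    using continuous_attains_sup[of "{x..y}" G] xy by auto
  have "G m \<le> 0"
  proof (rule ccontr)
    assume "\<not> G m \<le> 0"
    then have mm: "x < m" "m < y" "G m > 0" using m(1) ends by (auto simp: order_less_le)
    define p where "p = min (m - x) (y - m)"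
    have p: "p > 0" "m - p \<in> {x..y}" "m + p \<in> {x..y}" using mm by (auto simp: p_def)
    have "m - p = x \<or> m + p = y" by (auto simp: p_def min_def)
    then show False using Gmid[OF p(1), of m] m(2)[OF p(2)] m(2)[OF p(3)] ends mm(3) by auto
  qed
  moreover have s: "(1 - t) * x + t * y \<in> {x..y}"
    using t xy convex_bound_le[of x y y "1 - t" t] convex_bound_le[of "-x" "-x" "-y" "1 - t" t] by auto
  ultimately have "G ((1 - t) * x + t * y) \<le> 0" using m(2) by force
  moreover have "L ((1 - t) * x + t * y) = (1 - t) * f x + t * f y"
  proof -
    have "L ((1 - t) * x + t * y) = f x + t * (\<kappa> * (y - x))" by (simp add: L_def algebra_simps)
    also have "\<dots> = (1 - t) * f x + t * f y" unfolding \<kappa> by (simp add: algebra_simps)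
    finally show ?thesis .
  qed
  ultimately show "f ((1 - t) *\<^sub>R x + t *\<^sub>R y) \<le> (1 - t) * f x + t * f y" by (simp add: G_def)
qed simp

text \<open>The hypothesis says that second differences with steps \<open>h\<close> and \<open>d * h\<close> are nonnegative for small \<open>h\<close>. Second
differences with steps \<open>k * h\<close> and \<open>l * d * h\<close> are sums of these. Letting \<open>h\<close> tend to \<open>0\<close> with both products
tending to the same \<open>p\<close> gives midpoint convexity by continuity, across kinks of \<open>g\<close> as well.\<close>

lemma increment_inequality_imp_convex:
  fixes g :: "real \<Rightarrow> real"
  assumes cont: "continuous_on UNIV g" and d: "d > 0" and \<delta>: "\<delta> > 0"
    and step: "\<And>t h. 0 < h \<Longrightarrow> h < \<delta> \<Longrightarrow> g (t + d * h) + g (t + h) \<le> g t + g (t + h + d * h)"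
  shows "convex_on UNIV g"
proof (rule midpoint_convex_imp_convex[OF cont])
  have long1: "g (t + d * h) + g (t + real k * h) \<le> g t + g (t + real k * h + d * h)"
    if h: "0 < h" "h < \<delta>" for t h k
  proof (induction k)
    case (Suc k)
    then show ?case using step[OF h, of "t + real k * h"] by (simp add: algebra_simps)
  qed simp
  have long2: "g (t + real l * d * h) + g (t + real k * h) \<le> g t + g (t + real k * h + real l * d * h)"
    if h: "0 < h" "h < \<delta>" for t h k l
  proof (induction l)
    case (Suc l)
    then show ?case using long1[OF h, of "t + real l * d * h" k] by (simp add: algebra_simps)
  qed simp
  fix t p :: real assume p: "p > 0"
  \<comment> \<open>With \<open>h = p / k\<close>, the value \<open>y k\<close> is the largest multiple of \<open>d * h\<close> that is at most \<open>p\<close>.\<close>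
  define y where "y k = real (nat \<lfloor>real k / d\<rfloor>) * d * (p / real k)" for k
  have "y \<longlonglongrightarrow> p"
  proof (rule tendsto_sandwich)
    show "(\<lambda>k. p - d * p / real k) \<longlonglongrightarrow> p" by real_asymp
    show "\<forall>\<^sub>F k in sequentially. p - d * p / real k \<le> y k"
    proof (rule eventually_sequentiallyI[of 1])
      fix k :: nat assume k: "1 \<le> k"
      have "real k / d - 1 \<le> real (nat \<lfloor>real k / d\<rfloor>)" using d by linarith
      then have "(real k / d - 1) * (d * (p / real k)) \<le> real (nat \<lfloor>real k / d\<rfloor>) * (d * (p / real k))"
        using d p by (intro mult_right_mono) auto
      moreover have "(real k / d - 1) * (d * (p / real k)) = p - d * p / real k"
        using k d by (simp add: field_simps)
      ultimately show "p - d * p / real k \<le> y k" by (simp add: y_def mult.assoc)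
    qed
    show "\<forall>\<^sub>F k in sequentially. y k \<le> p"
    proof (rule eventually_sequentiallyI[of 1])
      fix k :: nat assume k: "1 \<le> k"
      have "real (nat \<lfloor>real k / d\<rfloor>) \<le> real k / d" using d by (simp add: of_nat_nat)
      then have "real (nat \<lfloor>real k / d\<rfloor>) * (d * (p / real k)) \<le> real k / d * (d * (p / real k))"
        using d p by (intro mult_right_mono) auto
      then show "y k \<le> p" using k d by (simp add: y_def field_simps)
    qed
  qed auto
  moreover have "isCont g s" for s using cont by (simp add: continuous_on_eq_continuous_at)
  ultimately have lim: "(\<lambda>k. g (s + y k)) \<longlonglongrightarrow> g (s + p)" for s
    by (intro isCont_tendsto_compose[of _ g] tendsto_intros)
  have "g (t - p + p) + g (t - p + p) \<le> g (t - p) + g (t - p + p + p)"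
  proof (rule LIMSEQ_le)
    show "(\<lambda>k. g (t - p + y k) + g (t - p + p)) \<longlonglongrightarrow> g (t - p + p) + g (t - p + p)"
      by (intro tendsto_intros lim)
    show "(\<lambda>k. g (t - p) + g (t - p + p + y k)) \<longlonglongrightarrow> g (t - p) + g (t - p + p + p)"
      by (intro tendsto_intros lim)
    have "\<forall>\<^sub>F k in sequentially. p / real k < \<delta>" using \<delta> by real_asymp
    then have "\<forall>\<^sub>F k in sequentially. 1 \<le> k \<and> p / real k < \<delta>"
      using eventually_ge_at_top[of 1] by eventually_elim simp
    then obtain K where K: "\<And>k. k \<ge> K \<Longrightarrow> 1 \<le> k \<and> p / real k < \<delta>"
      by (auto simp: eventually_sequentially)
    have "g (t - p + y k) + g (t - p + p) \<le> g (t - p) + g (t - p + p + y k)" if "k \<ge> K" for k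
    proof -
      have k: "1 \<le> k" "p / real k < \<delta>" using K[OF that] by auto
      then have "real k * (p / real k) = p" by simp
      then show ?thesis
        using long2[of "p / real k" "t - p" "nat \<lfloor>real k / d\<rfloor>" k] k p by (simp add: y_def)
    qed
    then show "\<exists>K. \<forall>k\<ge>K. g (t - p + y k) + g (t - p + p) \<le> g (t - p) + g (t - p + p + y k)" by blast
  qed
  then show "2 * g t \<le> g (t - p) + g (t + p)" by simp
qed

lemma second_order_necessary:
  fixes G :: "real \<Rightarrow> real"
  assumes d1: "\<forall>\<^sub>F e in nhds 0. (G has_real_derivative G' e) (at e)" and 0: "G' 0 = 0"
    and d2: "(G' has_real_derivative q) (at 0)" and ge: "\<forall>\<^sub>F e in at_right 0. G e \<ge> G 0"
  shows "q \<ge> 0"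
proof (rule ccontr)
  assume "\<not> q \<ge> 0"
  then obtain d where d: "d > 0" "\<And>h. 0 < h \<Longrightarrow> h < d \<Longrightarrow> G' h < 0"
    using DERIV_neg_dec_right[OF d2] 0 by auto
  obtain r where r: "r > 0" "\<And>e. \<bar>e\<bar> < r \<Longrightarrow> (G has_real_derivative G' e) (at e)"
    using d1 by (auto simp: eventually_nhds_metric dist_real_def)
  obtain s where s: "s > 0" "\<And>e. 0 < e \<Longrightarrow> e < s \<Longrightarrow> G e \<ge> G 0"
    using ge by (auto simp: eventually_at_right_field)
  define e where "e = min d (min r s) / 2"
  have e: "0 < e" "e < d" "e < r" "e < s" using d(1) r(1) s(1) by (auto simp: e_def min_def)
  have "\<exists>z>0. z < e \<and> G e - G 0 = (e - 0) * G' z"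
    using e by (intro MVT2) (auto intro: r(2))
  then obtain z where z: "0 < z" "z < e" "G e - G 0 = e * G' z" by auto
  then have "G e - G 0 < 0" using d(2)[of z] e by (simp add: mult_pos_neg)
  then show False using s(2)[of e] e by simp
qed

text \<open>The points \<open>p k\<close> are the vertices of a regular \<open>N\<close>-gon with angle \<open>\<theta> = 2 * pi / N\<close> in the plane of \<open>u\<close> and \<open>v\<close>, and
\<open>\<sigma>\<close> moves each to the next. The symmetric part of \<open>B\<close> contributes half the sum of \<open>B\<close> over the edges, which is
of order \<open>N * \<theta>\<^sup>2\<close>. The antisymmetric part sees the area of the triangles at the centre and contributes
a multiple of \<open>N * sin \<theta> * (B u v - B v u)\<close>. As \<open>N\<close> grows the second term would dominate unless \<open>B u v \<le> B v u\<close>.\<close>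

lemma polygon_inequality_imp_le_swap:
  fixes B :: "'a::real_inner \<Rightarrow> 'a \<Rightarrow> real"
  assumes B: "bilinear B" and uv: "norm u = 1" "norm v = 1" "u \<bullet> v = 0"
    and cyc: "\<And>I \<sigma> p. finite (I :: nat set) \<Longrightarrow> bij_betw \<sigma> I I \<Longrightarrow> inj_on p I \<Longrightarrow>
                (\<Sum>k\<in>I. B (p k) (p (\<sigma> k))) \<le> (\<Sum>k\<in>I. B (p k) (p k))"
  shows "B u v \<le> B v u"
proof -
  note bil = bilinear_ladd[OF B] bilinear_radd[OF B] bilinear_lmul[OF B] bilinear_rmul[OF B]
    bilinear_lsub[OF B] bilinear_rsub[OF B]
  define C where "C = \<bar>B u u\<bar> + \<bar>B u v\<bar> + \<bar>B v u\<bar> + \<bar>B v v\<bar>"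
  define \<beta> where "\<beta> = B u v - B v u"
  have bound: "\<beta> * sin \<theta> \<le> C * \<theta>\<^sup>2" if N: "N \<ge> 1" and \<theta>: "\<theta> = 2 * pi / real N" for N :: nat and \<theta>
  proof -
    define p where "p k = cos (real k * \<theta>) *\<^sub>R u + sin (real k * \<theta>) *\<^sub>R v" for k :: nat
    define \<sigma> where "\<sigma> k = (if Suc k = N then 0 else Suc k)" for k
    let ?I = "{..<N}"
    have \<sigma>: "bij_betw \<sigma> ?I ?I"
    proof (rule bij_betw_byWitness[where f' = "\<lambda>k. if k = 0 then N - 1 else k - 1"])
    qed (use N in \<open>auto simp: \<sigma>_def\<close>)
    have p\<sigma>: "p (\<sigma> k) = p (Suc k)" for k
      using N by (auto simp: \<sigma>_def p_def \<theta>)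
    have inj: "inj_on p ?I"
    proof (rule inj_onI)
      fix j k assume jk: "j \<in> ?I" "k \<in> ?I" and eq: "p j = p k"
      have "cos (real j * \<theta>) = cos (real k * \<theta>)" "sin (real j * \<theta>) = sin (real k * \<theta>)"
        using arg_cong[OF eq, of "\<lambda>x. u \<bullet> x"] arg_cong[OF eq, of "\<lambda>x. v \<bullet> x"] uv
        by (simp_all add: p_def inner_add_right dot_square_norm inner_commute[of v u])
      then obtain n :: int where "real j * \<theta> = real k * \<theta> + 2 * pi * of_int n"
        using sin_cos_eq_iff[of "real j * \<theta>" "real k * \<theta>"] by auto
      then have "real j * (2 * pi) = (real k + real_of_int n * real N) * (2 * pi)"
        using N by (simp add: \<theta> field_simps)
      then have "real j = real k + real_of_int n * real N" by simp
      then have "real_of_int (int j) = real_of_int (int k + n * int N)" by simp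
      then have "int j = int k + n * int N" by (simp only: of_int_eq_iff)
      then have "int j mod int N = int k mod int N" by simp
      then show "j = k" using jk by simp
    qed
    have cross: "B (p k) (p (Suc k)) + B (p (Suc k)) (p k) =
        B (p k) (p k) + B (p (Suc k)) (p (Suc k)) - B (p (Suc k) - p k) (p (Suc k) - p k)" for k
      by (simp add: bil)
    have anti: "B (p k) (p (Suc k)) - B (p (Suc k)) (p k) = \<beta> * sin \<theta>" for k
    proof -
      have "sin \<theta> = sin (real (Suc k) * \<theta> - real k * \<theta>)" by (simp add: algebra_simps)
      also have "\<dots> = sin (real (Suc k) * \<theta>) * cos (real k * \<theta>) - cos (real (Suc k) * \<theta>) * sin (real k * \<theta>)"
        by (rule sin_diff)
      finally show ?thesis unfolding p_def \<beta>_def by (simp only: bil) (simp add: algebra_simps)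
    qed
    have small: "B (p (Suc k) - p k) (p (Suc k) - p k) \<le> C * \<theta>\<^sup>2" for k
    proof -
      define a where "a = cos (real (Suc k) * \<theta>) - cos (real k * \<theta>)"
      define b where "b = sin (real (Suc k) * \<theta>) - sin (real k * \<theta>)"
      have "\<theta> \<ge> 0" by (simp add: \<theta>)
      have step: "real (Suc k) * \<theta> - real k * \<theta> = \<theta>" by (simp add: algebra_simps)
      have a: "\<bar>a\<bar> \<le> \<theta>"
      proof -
        have "\<bar>cos x - cos y\<bar> \<le> \<bar>x - y\<bar>" for x y :: real
        proof -
          have "\<bar>cos x - cos y\<bar> = 2 * (\<bar>sin ((x + y) / 2)\<bar> * \<bar>sin ((y - x) / 2)\<bar>)"
            by (simp add: cos_diff_cos abs_mult)
          also have "\<dots> \<le> 2 * (1 * \<bar>(y - x) / 2\<bar>)"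
            by (intro mult_left_mono mult_mono abs_sin_le_one abs_sin_x_le_abs_x) auto
          finally show ?thesis by simp
        qed
        from this[of "real (Suc k) * \<theta>" "real k * \<theta>"] show ?thesis
          unfolding a_def step using \<open>\<theta> \<ge> 0\<close> by simp
      qed
      have b: "\<bar>b\<bar> \<le> \<theta>"
      proof -
        have "\<bar>sin x - sin y\<bar> \<le> \<bar>x - y\<bar>" for x y :: real
        proof -
          have "\<bar>sin x - sin y\<bar> = 2 * (\<bar>sin ((x - y) / 2)\<bar> * \<bar>cos ((x + y) / 2)\<bar>)"
            by (simp add: sin_diff_sin abs_mult)
          also have "\<dots> \<le> 2 * (\<bar>(x - y) / 2\<bar> * 1)"
            by (intro mult_left_mono mult_mono abs_cos_le_one abs_sin_x_le_abs_x) auto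
          finally show ?thesis by simp
        qed
        from this[of "real (Suc k) * \<theta>" "real k * \<theta>"] show ?thesis
          unfolding b_def step using \<open>\<theta> \<ge> 0\<close> by simp
      qed
      have dp: "p (Suc k) - p k = a *\<^sub>R u + b *\<^sub>R v" by (simp add: p_def a_def b_def algebra_simps)
      have m: "x * y * z \<le> \<theta>\<^sup>2 * \<bar>z\<bar>" if "\<bar>x\<bar> \<le> \<theta>" "\<bar>y\<bar> \<le> \<theta>" for x y z
      proof -
        have "x * y * z \<le> \<bar>x\<bar> * \<bar>y\<bar> * \<bar>z\<bar>" by (metis abs_ge_self abs_mult)
        also have "\<dots> \<le> \<theta> * \<theta> * \<bar>z\<bar>" using that \<open>\<theta> \<ge> 0\<close> by (intro mult_right_mono mult_mono) auto
        finally show ?thesis by (simp add: power2_eq_square)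
      qed
      have "B (p (Suc k) - p k) (p (Suc k) - p k) =
          a * a * B u u + a * b * B u v + b * a * B v u + b * b * B v v"
        unfolding dp by (simp add: bil algebra_simps)
      also have "\<dots> \<le> \<theta>\<^sup>2 * \<bar>B u u\<bar> + \<theta>\<^sup>2 * \<bar>B u v\<bar> + \<theta>\<^sup>2 * \<bar>B v u\<bar> + \<theta>\<^sup>2 * \<bar>B v v\<bar>"
        by (intro add_mono m a b)
      finally show ?thesis by (simp add: C_def algebra_simps)
    qed
    have shift: "(\<Sum>k\<in>?I. B (p (Suc k)) (p (Suc k))) = (\<Sum>k\<in>?I. B (p k) (p k))"
      using sum.reindex_bij_betw[OF \<sigma>, of "\<lambda>k. B (p k) (p k)"] by (simp add: p\<sigma>)
    have "real N * (\<beta> * sin \<theta>) = (\<Sum>k\<in>?I. \<beta> * sin \<theta>)" by simp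
    also have "\<dots> = (\<Sum>k\<in>?I. 2 * B (p k) (p (Suc k)) - B (p k) (p k) - B (p (Suc k)) (p (Suc k))
          + B (p (Suc k) - p k) (p (Suc k) - p k))"
    proof (intro sum.cong refl)
      fix k show "\<beta> * sin \<theta> = 2 * B (p k) (p (Suc k)) - B (p k) (p k) - B (p (Suc k)) (p (Suc k))
          + B (p (Suc k) - p k) (p (Suc k) - p k)"
        using cross[of k] anti[of k] by linarith
    qed
    also have "\<dots> = 2 * ((\<Sum>k\<in>?I. B (p k) (p (\<sigma> k))) - (\<Sum>k\<in>?I. B (p k) (p k)))
        + (\<Sum>k\<in>?I. B (p (Suc k) - p k) (p (Suc k) - p k))"
      by (simp add: sum.distrib sum_subtractf shift p\<sigma> sum_distrib_left[symmetric])
    also have "\<dots> \<le> 2 * 0 + (\<Sum>k\<in>?I. C * \<theta>\<^sup>2)"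
      using cyc[OF _ \<sigma> inj] by (intro add_mono mult_left_mono sum_mono small) auto
    also have "\<dots> = real N * (C * \<theta>\<^sup>2)" by simp
    finally show ?thesis using N by simp
  qed
  have lim1: "(\<lambda>N. \<beta> * (sin (2 * pi / real N) / (2 * pi / real N))) \<longlonglongrightarrow> \<beta> * 1"
  proof (intro tendsto_mult tendsto_const)
    show "(\<lambda>N. sin (2 * pi / real N) / (2 * pi / real N)) \<longlonglongrightarrow> 1" by real_asymp
  qed
  have lim2: "(\<lambda>N. C * (2 * pi / real N)) \<longlonglongrightarrow> C * 0"
    by (intro tendsto_mult tendsto_const) real_asymp
  have "\<beta> * 1 \<le> C * 0"
  proof (rule LIMSEQ_le[OF lim1 lim2])
    have "\<beta> * (sin (2 * pi / real N) / (2 * pi / real N)) \<le> C * (2 * pi / real N)" if "N \<ge> 1" for N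
    proof -
      have *: "\<beta> * (s / \<theta>) \<le> C * \<theta>" if "\<theta> > 0" "\<beta> * s \<le> C * \<theta>\<^sup>2" for s \<theta> :: real
        using that by (simp add: divide_le_eq power2_eq_square mult.assoc)
      show ?thesis by (rule *[OF _ bound[OF that refl]]) (use that in simp)
    qed
    then show "\<exists>N0. \<forall>N\<ge>N0. \<beta> * (sin (2 * pi / real N) / (2 * pi / real N)) \<le> C * (2 * pi / real N)" by blast
  qed
  then show ?thesis by (simp add: \<beta>_def)
qed

section \<open>Affine maps and translation-invariant costs\<close>

text \<open>Cyclical monotonicity of \<open>x \<mapsto> A *v x + b\<close> for the cost \<open>f (x - y)\<close> near a base point \<open>x0\<close>, written with
\<open>x = x0 + p k\<close>. When all translations \<open>b\<close> are admitted, the displacement \<open>z = x0 - A *v x0 - b\<close>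
is arbitrary, while the radius \<open>\<delta>\<close> depends on \<open>x0\<close> alone.\<close>

definition cyclically_monotone_near_diagonal ::
    "(real^'n^'n) \<Rightarrow> (real^'n \<Rightarrow> real) \<Rightarrow> real \<Rightarrow> bool" where
  "cyclically_monotone_near_diagonal A f \<delta> \<longleftrightarrow>
     (\<forall>z (I :: nat set) \<sigma> p. finite I \<longrightarrow> bij_betw \<sigma> I I \<longrightarrow> inj_on p I \<longrightarrow> (\<forall>k\<in>I. norm (p k) < \<delta>) \<longrightarrow>
        (\<Sum>k\<in>I. f (z + (p k - A *v p k))) \<le> (\<Sum>k\<in>I. f (z + (p k - A *v p (\<sigma> k)))))"

lemma affine_optimal_imp_cyclically_monotone:
  fixes M :: "(real^'n) measure" and c :: "real^'n \<Rightarrow> real^'n \<Rightarrow> real"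
  assumes \<rho>: "\<rho> \<in> borel_measurable borel" and M: "M = density lborel \<rho>" "prob_space M"
    and U: "open U" "U \<noteq> {}" "\<And>x. x \<in> U \<Longrightarrow> \<rho> x > 0"
    and c: "\<And>x y. c x y = f (x - y)" and contf: "continuous_on UNIV f"
    and opt: "\<And>b. optimal_transport_map c M (distr M borel (affine_map A b)) (affine_map A b)"
    and minorant: "\<And>b. has_integrable_minorant c M (distr M borel (affine_map A b))"
    and fin: "\<And>b. optimal_cost c M (distr M borel (affine_map A b)) < \<infinity>"
  obtains \<delta> where "\<delta> > 0" "cyclically_monotone_near_diagonal A f \<delta>"
proof -
  obtain x0 where x0: "x0 \<in> U" using U(2) by blast
  obtain \<delta> where \<delta>: "\<delta> > 0" "ball x0 \<delta> \<subseteq> U" using U(1) x0 openE by blast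
  have contc: "continuous_on UNIV (\<lambda>z. c (fst z) (snd z))"
    unfolding c by (intro continuous_on_compose2[OF contf] continuous_intros) auto
  have "cyclically_monotone_near_diagonal A f \<delta>"
    unfolding cyclically_monotone_near_diagonal_def
  proof (intro allI impI)
    fix z :: "real^'n" and I :: "nat set" and \<sigma> and p :: "nat \<Rightarrow> real^'n"
    assume I: "finite I" "bij_betw \<sigma> I I" "inj_on p I" "\<forall>k\<in>I. norm (p k) < \<delta>"
    \<comment> \<open>The translation for which the base point is displaced by \<open>z\<close>.\<close>
    define b where "b = x0 - A *v x0 - z"
    have contT: "continuous_on UNIV (affine_map A b)"
      unfolding affine_map_def by (intro continuous_intros)
    have "(\<Sum>k\<in>I. c (x0 + p k) (affine_map A b (x0 + p k))) \<le>
          (\<Sum>k\<in>I. c (x0 + p k) (affine_map A b (x0 + p (\<sigma> k))))"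
    proof (rule optimal_map_permutation_monotone[OF \<rho> M U(1,3) contT contc opt minorant fin I(1,2)])
      show "inj_on (\<lambda>k. x0 + p k) I" using I(3) by (auto simp: inj_on_def)
      show "x0 + p k \<in> U" if "k \<in> I" for k
        using \<delta>(2) I(4) that by (auto simp: dist_norm subset_iff)
    qed
    moreover have "c (x0 + p k) (affine_map A b (x0 + p j)) = f (z + (p k - A *v p j))" for k j
      by (simp add: c affine_map_def b_def matrix_vector_right_distrib algebra_simps)
    ultimately show "(\<Sum>k\<in>I. f (z + (p k - A *v p k))) \<le> (\<Sum>k\<in>I. f (z + (p k - A *v p (\<sigma> k))))"
      by simp
  qed
  then show thesis using that \<delta>(1) by blast
qed

text \<open>For two points that differ by \<open>h *\<^sub>R q\<close>, cyclical monotonicity is the increment inequality with steps \<open>h\<close> and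
\<open>d * h\<close> on the line through \<open>w\<close>.\<close>

lemma convex_along_eigenvector:
  fixes A :: "real^'n^'n"
  assumes cyc: "cyclically_monotone_near_diagonal A f \<delta>" "\<delta> > 0" and contf: "continuous_on UNIV f"
    and q: "A *v q = d *\<^sub>R q" "norm q = 1" "d > 0"
  shows "convex_on UNIV (\<lambda>t. f (w + t *\<^sub>R q))"
proof (rule increment_inequality_imp_convex[OF _ q(3) cyc(2)])
  show "continuous_on UNIV (\<lambda>t. f (w + t *\<^sub>R q))"
    by (intro continuous_on_compose2[OF contf] continuous_intros) auto
  fix t h :: real assume h: "0 < h" "h < \<delta>"
  define z where "z = w + (t + d * h) *\<^sub>R q"
  define p where "p k = (if k = 0 then 0 else h *\<^sub>R q)" for k :: nat
  define \<sigma> where "\<sigma> k = 1 - k" for k :: nat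
  have q0: "q \<noteq> 0" using q(2) by auto
  have "(\<Sum>k\<in>{0,1}. f (z + (p k - A *v p k))) \<le> (\<Sum>k\<in>{0,1}. f (z + (p k - A *v p (\<sigma> k))))"
  proof (rule cyc(1)[unfolded cyclically_monotone_near_diagonal_def, rule_format])
    show "bij_betw \<sigma> {0,1} {0,1}" by (auto simp: bij_betw_def inj_on_def \<sigma>_def)
    show "inj_on p {0,1}" using h q0 by (auto simp: inj_on_def p_def)
    show "norm (p k) < \<delta>" for k using h q(2) cyc(2) by (auto simp: p_def)
  qed auto
  then show "f (w + (t + d * h) *\<^sub>R q) + f (w + (t + h) *\<^sub>R q)
      \<le> f (w + t *\<^sub>R q) + f (w + (t + h + d * h) *\<^sub>R q)"
    by (simp add: p_def \<sigma>_def z_def matrix_vector_mult_scaleR q(1) algebra_simps)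
qed

text \<open>The second difference of \<open>f\<close> over a small parallelogram spanned by \<open>u\<close> and \<open>v\<close> equals, by applying the mean value
theorem twice, a value of the second derivative near \<open>z\<close>, in either order of the two arguments.\<close>

lemma C2_second_derivative_symmetric:
  fixes f :: "'a::real_normed_vector \<Rightarrow> real"
  assumes W: "open W" and f': "\<And>x. x \<in> W \<Longrightarrow> (f has_derivative blinfun_apply (f' x)) (at x)"
    and f'': "\<And>x. x \<in> W \<Longrightarrow> (f' has_derivative blinfun_apply (f'' x)) (at x)"
    and cont: "continuous_on W f''" and z: "z \<in> W"
  shows "f'' z u v = f'' z v u"
proof -
  have near: "\<exists>x. dist x z < e \<and> x \<in> W \<and> (\<exists>y. dist y z < e \<and> y \<in> W \<and> f'' x v u = f'' y u v)" if e: "e > 0" for e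
  proof -
    obtain r where r: "r > 0" "ball z r \<subseteq> W" using W z openE by blast
    define K where "K = norm u + norm v + 1"
    define s where "s = min e r / (2 * K)"
    have nz: "K > 0" unfolding K_def using norm_ge_zero[of u] norm_ge_zero[of v] by linarith
    have s: "s > 0" using e r(1) nz by (simp add: s_def)
    have box: "dist (z + a *\<^sub>R x + b *\<^sub>R y) z < min e r" if "0 \<le> a" "a \<le> s" "0 \<le> b" "b \<le> s"
      "norm x + norm y = norm u + norm v" for a b x y
    proof -
      have "dist (z + a *\<^sub>R x + b *\<^sub>R y) z = norm (a *\<^sub>R x + b *\<^sub>R y)" by (simp add: dist_norm)
      also have "\<dots> \<le> a * norm x + b * norm y" using that norm_triangle_ineq[of "a *\<^sub>R x" "b *\<^sub>R y"] by simp
      also have "\<dots> \<le> s * norm x + s * norm y" using that by (intro add_mono mult_right_mono) auto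
      also have "\<dots> = s * (norm u + norm v)" by (simp add: that(5)[symmetric] algebra_simps)
      also have "\<dots> \<le> s * K" using s by (simp add: K_def)
      also have "\<dots> = min e r / 2" using nz by (simp add: s_def)
      also have "\<dots> < min e r" using e r(1) by (auto simp: min_def)
      finally show ?thesis .
    qed
    have mvt: "\<exists>x. dist x z < e \<and> x \<in> W \<and>
        f (z + s *\<^sub>R x1 + s *\<^sub>R y1) - f (z + s *\<^sub>R x1) - f (z + s *\<^sub>R y1) + f z = s * s * f'' x y1 x1"
      if xy: "norm x1 + norm y1 = norm u + norm v" for x1 y1
    proof -
      have inW: "z + a *\<^sub>R x1 + b *\<^sub>R y1 \<in> W" if "0 \<le> a" "a \<le> s" "0 \<le> b" "b \<le> s" for a b
        using box[OF that xy] r(2) by (auto simp: dist_commute subset_iff)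
      have der: "((\<lambda>a. f (z + a *\<^sub>R x1 + b *\<^sub>R y1)) has_real_derivative f' (z + a *\<^sub>R x1 + b *\<^sub>R y1) x1) (at a)"
        if "0 \<le> a" "a \<le> s" "0 \<le> b" "b \<le> s" for a b
        unfolding has_field_derivative_def
        by (rule has_derivative_eq_rhs, rule has_derivative_compose[where f = "\<lambda>a. z + a *\<^sub>R x1 + b *\<^sub>R y1", OF _ f'[OF inW[OF that]]])
           (auto intro!: derivative_eq_intros simp: blinfun.scaleR_right mult.commute)
      have "\<exists>a>0. a < s \<and> (f (z + s *\<^sub>R x1 + s *\<^sub>R y1) - f (z + s *\<^sub>R x1 + 0 *\<^sub>R y1)) -
          (f (z + 0 *\<^sub>R x1 + s *\<^sub>R y1) - f (z + 0 *\<^sub>R x1 + 0 *\<^sub>R y1)) =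
          (s - 0) * (f' (z + a *\<^sub>R x1 + s *\<^sub>R y1) x1 - f' (z + a *\<^sub>R x1 + 0 *\<^sub>R y1) x1)"
        using s by (intro MVT2) (auto intro!: DERIV_diff der der[where b = 0, simplified])
      then obtain a where a: "0 < a" "a < s" "(f (z + s *\<^sub>R x1 + s *\<^sub>R y1) - f (z + s *\<^sub>R x1)) -
          (f (z + s *\<^sub>R y1) - f z) = s * (f' (z + a *\<^sub>R x1 + s *\<^sub>R y1) x1 - f' (z + a *\<^sub>R x1) x1)"
        by auto
      have der2: "((\<lambda>b. f' (z + a *\<^sub>R x1 + b *\<^sub>R y1) x1) has_real_derivative f'' (z + a *\<^sub>R x1 + b *\<^sub>R y1) y1 x1) (at b)"
        if "0 \<le> b" "b \<le> s" for b
      proof -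
        have "((\<lambda>b. f' (z + a *\<^sub>R x1 + b *\<^sub>R y1)) has_derivative (\<lambda>h. f'' (z + a *\<^sub>R x1 + b *\<^sub>R y1) (h *\<^sub>R y1))) (at b)"
          by (rule has_derivative_compose[where f = "\<lambda>b. z + a *\<^sub>R x1 + b *\<^sub>R y1", OF _ f''[OF inW]])
             (use a that in \<open>auto intro!: derivative_eq_intros\<close>)
        then show ?thesis unfolding has_field_derivative_def
          by (rule has_derivative_eq_rhs[OF bounded_linear.has_derivative[OF blinfun.bounded_linear_left]])
             (simp add: blinfun.scaleR_right blinfun.scaleR_left mult.commute fun_eq_iff)
      qed
      have "\<exists>b>0. b < s \<and> f' (z + a *\<^sub>R x1 + s *\<^sub>R y1) x1 - f' (z + a *\<^sub>R x1 + 0 *\<^sub>R y1) x1 =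
          (s - 0) * f'' (z + a *\<^sub>R x1 + b *\<^sub>R y1) y1 x1"
        using s by (intro MVT2) (auto intro!: der2 der2[of 0, simplified])
      then obtain b where b: "0 < b" "b < s" "f' (z + a *\<^sub>R x1 + s *\<^sub>R y1) x1 - f' (z + a *\<^sub>R x1) x1 =
          s * f'' (z + a *\<^sub>R x1 + b *\<^sub>R y1) y1 x1" by auto
      then show ?thesis using a b box[of a b x1 y1] inW[of a b] xy
        by (intro exI[of _ "z + a *\<^sub>R x1 + b *\<^sub>R y1"]) (simp add: algebra_simps)
    qed
    obtain x where x: "dist x z < e" "x \<in> W" 
      "f (z + s *\<^sub>R u + s *\<^sub>R v) - f (z + s *\<^sub>R u) - f (z + s *\<^sub>R v) + f z = s * s * f'' x v u"
      using mvt[of u v] by auto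
    obtain y where y: "dist y z < e" "y \<in> W" 
      "f (z + s *\<^sub>R v + s *\<^sub>R u) - f (z + s *\<^sub>R v) - f (z + s *\<^sub>R u) + f z = s * s * f'' y u v"
      using mvt[of v u] by auto
    have "z + s *\<^sub>R v + s *\<^sub>R u = z + s *\<^sub>R u + s *\<^sub>R v" by (simp add: add.assoc add.commute)
    then have "f (z + s *\<^sub>R v + s *\<^sub>R u) = f (z + s *\<^sub>R u + s *\<^sub>R v)" by (rule arg_cong)
    then have "s * s * f'' x v u = s * s * f'' y u v" using x(3) y(3) by linarith
    then have "f'' x v u = f'' y u v" using s by simp
    then show ?thesis using x y by blast
  qed
  have c: "continuous_on W (\<lambda>x. f'' x a b)" for a b
    by (intro continuous_intros cont)
  have "dist (f'' z v u) (f'' z u v) \<le> e" if e: "e > 0" for e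
  proof -
    obtain d1 where d1: "d1 > 0" "\<And>x. x \<in> W \<Longrightarrow> dist x z < d1 \<Longrightarrow> dist (f'' x v u) (f'' z v u) < e / 2"
      using c[of v u] z e unfolding continuous_on_iff by (meson half_gt_zero)
    obtain d2 where d2: "d2 > 0" "\<And>x. x \<in> W \<Longrightarrow> dist x z < d2 \<Longrightarrow> dist (f'' x u v) (f'' z u v) < e / 2"
      using c[of u v] z e unfolding continuous_on_iff by (meson half_gt_zero)
    obtain x y where "dist x z < min d1 d2" "x \<in> W" "dist y z < min d1 d2" "y \<in> W" "f'' x v u = f'' y u v"
      using near[of "min d1 d2"] d1(1) d2(1) by auto
    then have "dist (f'' y u v) (f'' z v u) < e / 2" "dist (f'' y u v) (f'' z u v) < e / 2"
      using d1(2)[of x] d2(2)[of y] by auto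
    then show ?thesis by (rule less_imp_le[OF dist_triangle_half_r])
  qed
  then have "dist (f'' z v u) (f'' z u v) \<le> 0" by (rule field_le_epsilon) simp
  then show ?thesis by simp
qed

section \<open>The Hessian of the cost commutes with the matrix\<close>

text \<open>Shrinking the configuration \<open>p\<close> by a factor \<open>\<epsilon>\<close>, the difference of the two sides of cyclical monotonicity is
nonnegative and vanishes at \<open>\<epsilon> = 0\<close>. Its first derivative there is \<open>0\<close> since \<open>\<sigma>\<close> is a permutation, so its second
derivative is nonnegative; the square terms cancel for the same reason and leave the mixed ones.\<close>

lemma hessian_polygon_inequality:
  fixes A :: "real^'n^'n" and f' :: "real^'n \<Rightarrow> (real^'n) \<Rightarrow>\<^sub>L real"
  assumes cyc: "cyclically_monotone_near_diagonal A f \<delta>" "\<delta> > 0"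
    and W: "open W" and f': "\<And>x. x \<in> W \<Longrightarrow> (f has_derivative blinfun_apply (f' x)) (at x)"
    and f'': "\<And>x. x \<in> W \<Longrightarrow> (f' has_derivative blinfun_apply (f'' x)) (at x)"
    and cont: "continuous_on W f''" and z: "z \<in> W"
    and I: "finite (I :: nat set)" "bij_betw \<sigma> I I" "inj_on p I"
  shows "(\<Sum>k\<in>I. f'' z (p k) (A *v p (\<sigma> k))) \<le> (\<Sum>k\<in>I. f'' z (p k) (A *v p k))"
proof -
  define w where "w k = p k - A *v p (\<sigma> k)" for k
  define w0 where "w0 k = p k - A *v p k" for k
  define G where "G \<epsilon> = (\<Sum>k\<in>I. f (z + \<epsilon> *\<^sub>R w k)) - (\<Sum>k\<in>I. f (z + \<epsilon> *\<^sub>R w0 k))" for \<epsilon>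
  define G' where "G' \<epsilon> = (\<Sum>k\<in>I. f' (z + \<epsilon> *\<^sub>R w k) (w k)) - (\<Sum>k\<in>I. f' (z + \<epsilon> *\<^sub>R w0 k) (w0 k))" for \<epsilon>
  have reindex: "(\<Sum>k\<in>I. g (\<sigma> k)) = (\<Sum>k\<in>I. g k)" for g :: "nat \<Rightarrow> 'z::comm_monoid_add"
    by (rule sum.reindex_bij_betw[OF I(2)])
  have near: "\<forall>\<^sub>F \<epsilon> in nhds 0. z + \<epsilon> *\<^sub>R y \<in> W" for y
  proof -
    have "((\<lambda>\<epsilon>. z + \<epsilon> *\<^sub>R y) \<longlongrightarrow> z + 0 *\<^sub>R y) (nhds 0)" by (intro tendsto_intros filterlim_ident)
    then show ?thesis using W z by (auto dest: topological_tendstoD)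
  qed
  have D1: "((\<lambda>\<epsilon>. f (z + \<epsilon> *\<^sub>R y)) has_real_derivative f' (z + \<epsilon> *\<^sub>R y) y) (at \<epsilon>)"
    if "z + \<epsilon> *\<^sub>R y \<in> W" for \<epsilon> y
    unfolding has_field_derivative_def
    by (rule has_derivative_eq_rhs, rule has_derivative_compose[where f = "\<lambda>\<epsilon>. z + \<epsilon> *\<^sub>R y", OF _ f'[OF that]])
       (auto intro!: derivative_eq_intros simp: blinfun.scaleR_right mult.commute)
  have D2: "((\<lambda>\<epsilon>. f' (z + \<epsilon> *\<^sub>R y) y) has_real_derivative f'' z y y) (at 0)" for y
  proof -
    have "((\<lambda>\<epsilon>. f' (z + \<epsilon> *\<^sub>R y)) has_derivative (\<lambda>h. f'' (z + 0 *\<^sub>R y) (h *\<^sub>R y))) (at 0)"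
      by (rule has_derivative_compose[where f = "\<lambda>\<epsilon>. z + \<epsilon> *\<^sub>R y", OF _ f''])
         (use z in \<open>auto intro!: derivative_eq_intros\<close>)
    then show ?thesis unfolding has_field_derivative_def
      by (rule has_derivative_eq_rhs[OF bounded_linear.has_derivative[OF blinfun.bounded_linear_left]])
         (simp add: blinfun.scaleR_right blinfun.scaleR_left mult.commute fun_eq_iff)
  qed
  have "0 \<le> (\<Sum>k\<in>I. f'' z (w k) (w k)) - (\<Sum>k\<in>I. f'' z (w0 k) (w0 k))"
  proof (rule second_order_necessary[of G G'])
    have "\<forall>\<^sub>F \<epsilon> in nhds 0. \<forall>k\<in>I. z + \<epsilon> *\<^sub>R w k \<in> W" "\<forall>\<^sub>F \<epsilon> in nhds 0. \<forall>k\<in>I. z + \<epsilon> *\<^sub>R w0 k \<in> W"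
      by (intro eventually_ball_finite I ballI near)+
    then show "\<forall>\<^sub>F \<epsilon> in nhds 0. (G has_real_derivative G' \<epsilon>) (at \<epsilon>)"
      unfolding G_def G'_def by eventually_elim (intro DERIV_diff DERIV_sum D1, auto)
    show "G' 0 = 0"
      by (simp add: G'_def w_def w0_def blinfun.diff_right sum_subtractf
          reindex[of "\<lambda>k. f' z (A *v p k)"])
    show "(G' has_real_derivative (\<Sum>k\<in>I. f'' z (w k) (w k)) - (\<Sum>k\<in>I. f'' z (w0 k) (w0 k))) (at 0)"
      unfolding G'_def by (intro DERIV_diff DERIV_sum D2)
    have small: "\<forall>\<^sub>F \<epsilon> in at_right 0. norm (\<epsilon> *\<^sub>R p k) < \<delta>" for k
    proof -
      have "((\<lambda>\<epsilon>. norm (\<epsilon> *\<^sub>R p k)) \<longlongrightarrow> norm (0 *\<^sub>R p k)) (at_right 0)" by (intro tendsto_intros)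
      then show ?thesis using cyc(2) by (auto dest: order_tendstoD)
    qed
    have "\<forall>\<^sub>F \<epsilon> in at_right (0::real). \<epsilon> > 0" by (simp add: eventually_at_right_less)
    moreover have "\<forall>\<^sub>F \<epsilon> in at_right 0. \<forall>k\<in>I. norm (\<epsilon> *\<^sub>R p k) < \<delta>"
      by (intro eventually_ball_finite I ballI small)
    ultimately show "\<forall>\<^sub>F \<epsilon> in at_right 0. G 0 \<le> G \<epsilon>"
    proof eventually_elim
      case (elim \<epsilon>)
      have "inj_on (\<lambda>k. \<epsilon> *\<^sub>R p k) I" using I(3) elim(1) by (auto simp: inj_on_def)
      then have "(\<Sum>k\<in>I. f (z + (\<epsilon> *\<^sub>R p k - A *v (\<epsilon> *\<^sub>R p k)))) \<le>
            (\<Sum>k\<in>I. f (z + (\<epsilon> *\<^sub>R p k - A *v (\<epsilon> *\<^sub>R p (\<sigma> k)))))"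
        using cyc(1) I(1,2) elim(2) unfolding cyclically_monotone_near_diagonal_def by blast
      then show ?case
        by (simp add: G_def w_def w0_def matrix_vector_mult_scaleR scaleR_diff_right)
    qed
  qed
  moreover have sym: "f'' z (A *v p j) (p k) = f'' z (p k) (A *v p j)" for j k
    by (rule C2_second_derivative_symmetric[OF W f' f'' cont z])
  have "f'' z (w k) (w k) = f'' z (p k) (p k) - 2 * f'' z (p k) (A *v p (\<sigma> k))
      + f'' z (A *v p (\<sigma> k)) (A *v p (\<sigma> k))" for k
    by (simp add: w_def blinfun.diff_right blinfun.diff_left sym)
  moreover have "f'' z (w0 k) (w0 k) = f'' z (p k) (p k) - 2 * f'' z (p k) (A *v p k)
      + f'' z (A *v p k) (A *v p k)" for k
    by (simp add: w0_def blinfun.diff_right blinfun.diff_left sym)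
  ultimately show ?thesis
    by (simp add: sum_subtractf sum.distrib reindex[of "\<lambda>k. f'' z (A *v p k) (A *v p k)"] sum_distrib_left[symmetric])
qed

text \<open>The infinitesimal content of optimality: the product of the Hessian with \<open>A\<close> is symmetric, i.e. the two
commute.\<close>

lemma hessian_times_matrix_symmetric:
  fixes A :: "real^'n^'n" and f' :: "real^'n \<Rightarrow> (real^'n) \<Rightarrow>\<^sub>L real"
  assumes cyc: "cyclically_monotone_near_diagonal A f \<delta>" "\<delta> > 0"
    and W: "open W" and f': "\<And>x. x \<in> W \<Longrightarrow> (f has_derivative blinfun_apply (f' x)) (at x)"
    and f'': "\<And>x. x \<in> W \<Longrightarrow> (f' has_derivative blinfun_apply (f'' x)) (at x)"
    and cont: "continuous_on W f''" and z: "z \<in> W"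
    and uv: "norm u = 1" "norm v = 1" "u \<bullet> v = 0"
  shows "f'' z u (A *v v) = f'' z v (A *v u)"
proof -
  let ?B = "\<lambda>x y. f'' z x (A *v y)"
  have B: "bilinear ?B"
    unfolding bilinear_def
    by (auto intro!: linearI simp: blinfun.add_left blinfun.scaleR_left blinfun.add_right blinfun.scaleR_right
        matrix_vector_right_distrib matrix_vector_mult_scaleR)
  note le = polygon_inequality_imp_le_swap[OF B]
  have "?B u v \<le> ?B v u"
    by (rule le[OF uv]) (rule hessian_polygon_inequality[OF cyc W f' f'' cont z])
  moreover have "?B v u \<le> ?B u v"
    using uv by (intro le) (auto simp: inner_commute intro: hessian_polygon_inequality[OF cyc W f' f'' cont z])
  ultimately show ?thesis by simp
qed

section \<open>Orthonormal eigenbases\<close>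

(* Coordinates are written with the transposed matrix throughout; the rule would turn
   them into vector-matrix products. *)
declare transpose_matrix_vector [simp del]

lemma column_inner_column:
  assumes "orthogonal_matrix (Q :: real^'n^'n)"
  shows "column i Q \<bullet> column j Q = (if i = j then 1 else 0)"
  using assms by (auto simp: orthogonal_matrix_orthonormal_columns orthogonal_def norm_eq_1)

lemma transpose_mult_vec_nth: "(transpose Q *v z) $ i = column i Q \<bullet> z" for Q :: "real^'n^'n"
  by (simp add: matrix_vector_mult_def transpose_def column_def inner_vec_def)

lemma orthonormal_expansion:
  assumes Q: "orthogonal_matrix (Q :: real^'n^'n)"
  shows "z = (\<Sum>i\<in>UNIV. (column i Q \<bullet> z) *\<^sub>R column i Q)"
proof -
  have "z = Q *v (transpose Q *v z)"
    using Q by (simp add: matrix_vector_mul_assoc orthogonal_matrix_def)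
  also have "\<dots> = (\<Sum>i\<in>UNIV. (column i Q \<bullet> z) *\<^sub>R column i Q)"
    by (subst matrix_mult_sum) (simp add: transpose_mult_vec_nth scalar_mult_eq_scaleR)
  finally show ?thesis .
qed

lemma transpose_mult_column:
  assumes "orthogonal_matrix (Q :: real^'n^'n)"
  shows "transpose Q *v column i Q = axis i 1"
  using column_inner_column[OF assms] by (simp add: vec_eq_iff transpose_mult_vec_nth axis_def)

lemma diagonal_mult_axis:
  assumes "diagonal_matrix (D :: real^'n^'n)"
  shows "D *v axis i 1 = D $ i $ i *\<^sub>R axis i 1"
  unfolding matrix_vector_mult_basis using assms
  by (auto simp: column_def vec_eq_iff axis_def diagonal_matrix_def)

lemma spectral_decomposition_eigenvector:
  assumes "spectral_decomposition A Q D"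
  shows "A *v column i Q = D $ i $ i *\<^sub>R column i Q"
proof -
  have "A *v column i Q = Q *v (D *v (transpose Q *v column i Q))"
    using assms by (simp add: spectral_decomposition_def matrix_vector_mul_assoc matrix_mul_assoc)
  also have "\<dots> = Q *v (D $ i $ i *\<^sub>R axis i 1)"
    using assms by (simp add: spectral_decomposition_def transpose_mult_column diagonal_mult_axis)
  also have "\<dots> = D $ i $ i *\<^sub>R column i Q"
    by (simp only: matrix_vector_mult_scaleR matrix_vector_mult_basis)
  finally show ?thesis .
qed

lemma diagonalized_by_imp_spectral_decomposition:
  assumes Q: "orthogonal_matrix (Q :: real^'n^'n)" and A: "diagonalized_by A Q"
  shows "spectral_decomposition A Q (transpose Q ** A ** Q)"
proof -
  have "Q ** (transpose Q ** A ** Q) ** transpose Q = (Q ** transpose Q) ** A ** (Q ** transpose Q)"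
    by (simp add: matrix_mul_assoc)
  then show ?thesis using assms by (simp add: spectral_decomposition_def diagonalized_by_def orthogonal_matrix_def)
qed

lemma spectral_decomposition_pos:
  assumes "spectral_decomposition A Q D" "sym_pos_def A"
  shows "D $ i $ i > 0"
proof -
  have n: "column i Q \<bullet> column i Q = 1"
    using assms column_inner_column[of Q i i] by (simp add: spectral_decomposition_def)
  then have "column i Q \<noteq> 0" by auto
  then have "0 < column i Q \<bullet> (A *v column i Q)" using assms(2) by (simp add: sym_pos_def_def)
  then show ?thesis by (simp add: spectral_decomposition_eigenvector[OF assms(1)] n)
qed

text \<open>Every eigenvalue occurs among the diagonal entries, so \<open>n\<close> eigenvalues need \<open>n\<close> different entries.\<close>

lemma spectral_decomposition_distinct:
  assumes sd: "spectral_decomposition (A :: real^'n^'n) Q D" and dist: "distinct_eigenvalues A"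
  shows "inj (\<lambda>i. D $ i $ i)"
proof (rule eq_card_imp_inj_on)
  have Q: "orthogonal_matrix Q" using sd by (simp add: spectral_decomposition_def)
  have "eigenvalues A \<subseteq> range (\<lambda>i. D $ i $ i)"
  proof
    fix l assume "l \<in> eigenvalues A"
    then obtain v where v: "v \<noteq> 0" "A *v v = l *\<^sub>R v" by (auto simp: eigenvalues_def)
    have "\<exists>i. column i Q \<bullet> v \<noteq> 0"
    proof (rule ccontr)
      assume "\<not> ?thesis"
      then show False using orthonormal_expansion[OF Q, of v] v(1) by simp
    qed
    then obtain i where i: "column i Q \<bullet> v \<noteq> 0" ..
    have "A *v v = (\<Sum>j\<in>UNIV. (column j Q \<bullet> v) *\<^sub>R (D $ j $ j *\<^sub>R column j Q))"
      by (subst orthonormal_expansion[OF Q, of v])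
         (simp only: linear_sum[OF matrix_vector_mul_linear] matrix_vector_mult_scaleR spectral_decomposition_eigenvector[OF sd])
    then have "column i Q \<bullet> (l *\<^sub>R v) =
        (\<Sum>j\<in>UNIV. (column j Q \<bullet> v) * D $ j $ j * (column i Q \<bullet> column j Q))"
      unfolding v(2) by (simp add: inner_sum_right mult.assoc)
    also have "\<dots> = (\<Sum>j\<in>UNIV. if i = j then (column j Q \<bullet> v) * D $ j $ j else 0)"
      by (intro sum.cong) (simp_all add: column_inner_column[OF Q])
    finally have "l * (column i Q \<bullet> v) = D $ i $ i * (column i Q \<bullet> v)" by (simp add: mult.commute)
    then show "l \<in> range (\<lambda>i. D $ i $ i)" using i by auto
  qed
  then have "card (eigenvalues A) \<le> card (range (\<lambda>i. D $ i $ i))" by (intro card_mono) auto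
  moreover have "card (range (\<lambda>i. D $ i $ i)) \<le> CARD('n)" by (rule card_image_le) simp
  ultimately show "card (range (\<lambda>i. D $ i $ i)) = card (UNIV :: 'n set)"
    using dist by (simp add: distinct_eigenvalues_def)
qed simp

text \<open>With \<open>n\<close> different eigenvalues, normalised eigenvectors are orthogonal by symmetry and hence
form the columns of \<open>Q\<close>.\<close>

lemma distinct_eigenvalues_imp_spectral_decomposition:
  assumes sym: "transpose A = (A :: real^'n^'n)" and dist: "distinct_eigenvalues A"
  shows "\<exists>Q D. spectral_decomposition A Q D"
proof -
  have "finite (eigenvalues A)"
    using dist by (intro card_ge_0_finite) (simp add: distinct_eigenvalues_def)
  then obtain e :: "'n \<Rightarrow> real" where e: "bij_betw e UNIV (eigenvalues A)"
    using finite_same_card_bij[of "UNIV :: 'n set" "eigenvalues A"] dist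
    by (auto simp: distinct_eigenvalues_def)
  have "\<exists>q. norm q = 1 \<and> A *v q = e i *\<^sub>R q" for i
  proof -
    have "e i \<in> eigenvalues A" using e by (auto simp: bij_betw_def)
    then obtain v where "v \<noteq> 0" "A *v v = e i *\<^sub>R v" by (auto simp: eigenvalues_def)
    then show ?thesis
      by (intro exI[of _ "(1 / norm v) *\<^sub>R v"]) (simp add: matrix_vector_mult_scaleR)
  qed
  then obtain q where q: "\<And>i. norm (q i) = 1" "\<And>i. A *v q i = e i *\<^sub>R q i" by metis
  have orth: "q i \<bullet> q j = 0" if "i \<noteq> j" for i j
  proof -
    have "e i * (q i \<bullet> q j) = (A *v q i) \<bullet> q j" by (simp add: q(2))
    also have "\<dots> = q i \<bullet> (A *v q j)"
      using dot_lmul_matrix[of "q i" A "q j"] transpose_matrix_vector[of A "q i"] by (simp add: sym)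
    also have "\<dots> = e j * (q i \<bullet> q j)" by (simp add: q(2))
    finally have "(e i - e j) * (q i \<bullet> q j) = 0" by (simp add: algebra_simps)
    moreover have "e i \<noteq> e j" using e that by (auto simp: bij_betw_def inj_on_def)
    ultimately show ?thesis by simp
  qed
  define Q :: "real^'n^'n" where "Q = (\<chi> r s. q s $ r)"
  define D :: "real^'n^'n" where "D = (\<chi> r s. if r = s then e r else 0)"
  have col: "column i Q = q i" for i by (simp add: column_def Q_def)
  have Q: "orthogonal_matrix Q"
    unfolding orthogonal_matrix_orthonormal_columns by (auto simp: col q(1) orthogonal_def orth)
  have D: "diagonal_matrix D" by (simp add: diagonal_matrix_def D_def)
  have "A ** Q = Q ** D"
  proof -
    have "column i (A ** Q) = column i (Q ** D)" for i
      unfolding matrix_vector_mult_basis[symmetric] matrix_vector_mul_assoc[symmetric]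
      by (simp add: diagonal_mult_axis[OF D] matrix_vector_mult_scaleR)
         (simp add: matrix_vector_mult_basis col q(2) D_def)
    then show ?thesis by (simp add: column_def vec_eq_iff)
  qed
  then have "A ** (Q ** transpose Q) = Q ** D ** transpose Q" by (simp add: matrix_mul_assoc)
  then have "A = Q ** D ** transpose Q" using Q by (simp add: orthogonal_matrix_def)
  then show ?thesis using Q D by (auto simp: spectral_decomposition_def)
qed

section \<open>Separable functions\<close>

text \<open>The increment of \<open>f\<close> under a step \<open>s *\<^sub>R u\<close> is a continuous function of the position \<open>t\<close> along \<open>v\<close>. Its derivative
vanishes for every \<open>t\<close> such that the line in direction \<open>u\<close> at height \<open>t\<close> misses \<open>S\<close>. Only finitely many heights
are excluded, so the increment is constant; thus the exceptional points are no obstruction to the conclusion.\<close>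

lemma mixed_difference_zero:
  fixes f :: "'a::real_inner \<Rightarrow> real" 
  assumes contf: "continuous_on UNIV f" and S: "finite S"
    and f': "\<And>x. x \<in> - S \<Longrightarrow> (f has_derivative blinfun_apply (f' x)) (at x)"
    and f'': "\<And>x. x \<in> - S \<Longrightarrow> (f' has_derivative blinfun_apply (f'' x)) (at x)"
    and mixed: "\<And>x. x \<in> - S \<Longrightarrow> f'' x u v = 0"
    and uv: "norm v = 1" "u \<bullet> v = 0"
  shows "f (a + s *\<^sub>R u + t *\<^sub>R v) - f (a + s *\<^sub>R u) = f (a + t *\<^sub>R v) - f a"
proof -
  define \<phi> where "\<phi> t = f (a + s *\<^sub>R u + t *\<^sub>R v) - f (a + t *\<^sub>R v)" for t
  define K where "K = (\<lambda>z. (z - a) \<bullet> v) ` S"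
  have vv: "v \<bullet> v = 1" using uv(1) by (simp add: norm_eq_1)
  have off: "a + r *\<^sub>R u + t *\<^sub>R v \<in> - S" if "t \<notin> K" for r t
  proof
    assume "a + r *\<^sub>R u + t *\<^sub>R v \<in> S"
    then have "(a + r *\<^sub>R u + t *\<^sub>R v - a) \<bullet> v \<in> K" unfolding K_def by blast
    then show False using that by (simp add: inner_add_left vv uv(2))
  qed
  have D: "(\<phi> has_derivative (\<lambda>h. 0)) (at t)" if t: "t \<notin> K" for t
  proof -
    have D1: "((\<lambda>t. f (a + r *\<^sub>R u + t *\<^sub>R v)) has_real_derivative f' (a + r *\<^sub>R u + t *\<^sub>R v) v) (at t)" for r
      unfolding has_field_derivative_def
      by (rule has_derivative_eq_rhs, rule has_derivative_compose[where f = "\<lambda>t. a + r *\<^sub>R u + t *\<^sub>R v", OF _ f'[OF off[OF t]]])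
         (auto intro!: derivative_eq_intros simp: blinfun.scaleR_right mult.commute)
    have D2: "((\<lambda>r. f' (a + r *\<^sub>R u + t *\<^sub>R v) v) has_real_derivative 0) (at r)" for r
    proof -
      have "((\<lambda>r. f' (a + r *\<^sub>R u + t *\<^sub>R v)) has_derivative (\<lambda>h. f'' (a + r *\<^sub>R u + t *\<^sub>R v) (h *\<^sub>R u))) (at r)"
        by (rule has_derivative_compose[where f = "\<lambda>r. a + r *\<^sub>R u + t *\<^sub>R v", OF _ f''[OF off[OF t]]])
           (auto intro!: derivative_eq_intros)
      then show ?thesis unfolding has_field_derivative_def
        by (rule has_derivative_eq_rhs[OF bounded_linear.has_derivative[OF blinfun.bounded_linear_left]])
           (simp add: blinfun.scaleR_right blinfun.scaleR_left mixed[OF off[OF t]] fun_eq_iff)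
    qed
    have "f' (a + s *\<^sub>R u + t *\<^sub>R v) v = f' (a + 0 *\<^sub>R u + t *\<^sub>R v) v"
      using DERIV_isconst_all[of "\<lambda>r. f' (a + r *\<^sub>R u + t *\<^sub>R v) v"] D2 by blast
    then have "(\<phi> has_real_derivative 0) (at t)"
      unfolding \<phi>_def using DERIV_diff[OF D1[of s] D1[of 0]] by simp
    then show ?thesis by (simp add: has_field_derivative_def lambda_zero)
  qed
  have "\<phi> t = \<phi> 0"
  proof (rule has_derivative_zero_unique_strong_convex[where S = UNIV and K = K and c = 0 and f = \<phi> and x = t and y = "\<phi> 0"])
    show "continuous_on UNIV \<phi>" unfolding \<phi>_def
      by (intro continuous_intros continuous_on_compose2[OF contf]) auto
    show "finite K" unfolding K_def using S by simp
  qed (use D in auto)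
  then show ?thesis by (simp add: \<phi>_def)
qed

text \<open>The increment of \<open>f\<close> in one coordinate does not depend on the others, so changing the coordinates one at a time
adds up the one-dimensional increments.\<close>

lemma separable_of_mixed_differences:
  fixes f :: "real^'n \<Rightarrow> real" and Q :: "real^'n^'n"
  assumes Q: "orthogonal_matrix Q"
    and mixed: "\<And>i j a s t. i \<noteq> j \<Longrightarrow> f (a + s *\<^sub>R column i Q + t *\<^sub>R column j Q) - f (a + s *\<^sub>R column i Q)
                   = f (a + t *\<^sub>R column j Q) - f a"
  shows "separable_along Q (\<lambda>i t. f (t *\<^sub>R column i Q) - f 0 + f 0 / real CARD('n)) f"
  unfolding separable_along_def
proof
  fix z
  let ?q = "\<lambda>i. column i Q"
  define a where "a i = ?q i \<bullet> z" for i
  have incr: "f ((\<Sum>i\<in>J. a i *\<^sub>R ?q i) + t *\<^sub>R ?q j) - f (\<Sum>i\<in>J. a i *\<^sub>R ?q i) = f (t *\<^sub>R ?q j) - f 0"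
    if "finite J" "j \<notin> J" for J j t
    using that
  proof (induction J)
    case (insert i J)
    then show ?case
      using mixed[of i j "\<Sum>i\<in>J. a i *\<^sub>R ?q i" "a i" t] by (auto simp: add.commute)
  qed simp
  have "f (\<Sum>i\<in>J. a i *\<^sub>R ?q i) = f 0 + (\<Sum>i\<in>J. f (a i *\<^sub>R ?q i) - f 0)" if "finite J" for J
    using that
  proof (induction J)
    case (insert j J)
    then show ?case using incr[of J j "a j"] by (simp add: add.commute)
  qed simp
  from this[of UNIV] have "f z = f 0 + (\<Sum>i\<in>UNIV. f (a i *\<^sub>R ?q i) - f 0)"
    using orthonormal_expansion[OF Q, of z] by (simp add: a_def)
  also have "\<dots> = (\<Sum>i\<in>UNIV. f (a i *\<^sub>R ?q i) - f 0 + f 0 / real CARD('n))"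
    by (simp add: sum.distrib)
  finally show "f z = (\<Sum>i\<in>UNIV. f ((transpose Q *v z) $ i *\<^sub>R ?q i) - f 0 + f 0 / real CARD('n))"
    by (simp add: a_def transpose_mult_vec_nth)
qed

lemma C2_on_line:
  fixes f :: "'a::real_normed_vector \<Rightarrow> real"
  assumes f: "C2_on W f" and line: "\<And>t. p + t *\<^sub>R q \<in> W"
  shows "C2_on UNIV (\<lambda>t. f (p + t *\<^sub>R q) + k)"
proof -
  obtain f' :: "'a \<Rightarrow> 'a \<Rightarrow>\<^sub>L real" and f'' :: "'a \<Rightarrow> 'a \<Rightarrow>\<^sub>L ('a \<Rightarrow>\<^sub>L real)" where
    f': "\<And>x. x \<in> W \<Longrightarrow> (f has_derivative blinfun_apply (f' x)) (at x)" and
    f'': "\<And>x. x \<in> W \<Longrightarrow> (f' has_derivative blinfun_apply (f'' x)) (at x)" and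
    cont: "continuous_on W f''" using f by (auto simp: C2_on_def)
  define L :: "real \<Rightarrow>\<^sub>L 'a" where "L = blinfun_scaleR_left q"
  have L: "blinfun_apply L t = t *\<^sub>R q" for t by (simp add: L_def)
  define \<Phi> :: "('a \<Rightarrow>\<^sub>L real) \<Rightarrow>\<^sub>L (real \<Rightarrow>\<^sub>L real)" where "\<Phi> = Blinfun (\<lambda>X. X o\<^sub>L L)"
  have \<Phi>: "blinfun_apply \<Phi> X = X o\<^sub>L L" for X
    unfolding \<Phi>_def by (simp add: bounded_linear_Blinfun_apply bounded_bilinear.bounded_linear_left[OF bounded_bilinear_blinfun_compose])
  have g: "((\<lambda>t. p + t *\<^sub>R q) has_derivative (\<lambda>h. h *\<^sub>R q)) (at t)" for t
    by (auto intro!: derivative_eq_intros)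
  have cg: "continuous_on UNIV (\<lambda>t::real. p + t *\<^sub>R q)" by (intro continuous_intros)
  show ?thesis
    unfolding C2_on_def
  proof (intro exI conjI ballI)
    fix t :: real
    have "((\<lambda>t. f (p + t *\<^sub>R q)) has_derivative (\<lambda>h. f' (p + t *\<^sub>R q) (h *\<^sub>R q))) (at t)"
      by (rule has_derivative_compose[OF g f'[OF line]])
    from has_derivative_add_const[OF this, of k]
    show "((\<lambda>t. f (p + t *\<^sub>R q) + k) has_derivative blinfun_apply (\<Phi> (f' (p + t *\<^sub>R q)))) (at t)"
      by (rule has_derivative_eq_rhs) (simp add: \<Phi> L fun_eq_iff)
    have "((\<lambda>t. f' (p + t *\<^sub>R q)) has_derivative (\<lambda>h. f'' (p + t *\<^sub>R q) (h *\<^sub>R q))) (at t)"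
      by (rule has_derivative_compose[OF g f''[OF line]])
    from bounded_linear.has_derivative[OF blinfun.bounded_linear_right this, of \<Phi>]
    show "((\<lambda>t. \<Phi> (f' (p + t *\<^sub>R q))) has_derivative blinfun_apply (\<Phi> o\<^sub>L (f'' (p + t *\<^sub>R q) o\<^sub>L L))) (at t)"
      by (rule has_derivative_eq_rhs) (simp add: L fun_eq_iff)
    show "continuous_on UNIV (\<lambda>t. \<Phi> o\<^sub>L (f'' (p + t *\<^sub>R q) o\<^sub>L L))"
      by (intro continuous_intros continuous_on_compose2[OF cont cg]) (use line in auto)
  qed
qed

lemma C2_on_UNIV_DERIV_deriv:
  assumes "C2_on UNIV (c :: real \<Rightarrow> real)"
  shows "(c has_real_derivative deriv c t) (at t)" "(deriv c has_real_derivative deriv (deriv c) t) (at t)"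
proof -
  obtain f' :: "real \<Rightarrow> real \<Rightarrow>\<^sub>L real" and f'' :: "real \<Rightarrow> real \<Rightarrow>\<^sub>L (real \<Rightarrow>\<^sub>L real)" where
    f': "\<And>x. (c has_derivative blinfun_apply (f' x)) (at x)" and
    f'': "\<And>x. (f' has_derivative blinfun_apply (f'' x)) (at x)" using assms by (auto simp: C2_on_def)
  have 1: "blinfun_apply (f' t) = (*) (f' t 1)" for t
  proof
    show "f' t h = f' t 1 * h" for h
      using blinfun.scaleR_right[of "f' t" h 1] by (simp only: real_scaleR_def mult_1_right mult_1_left mult.commute)
  qed
  have 2: "(\<lambda>h. blinfun_apply (f'' t h) 1) = (*) (f'' t 1 1)" for t
  proof
    fix h
    have "f'' t h = h *\<^sub>R f'' t 1"
      using blinfun.scaleR_right[of "f'' t" h 1] by (simp only: real_scaleR_def mult_1_right)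
    then have "f'' t h 1 = (h *\<^sub>R f'' t 1) 1"
      by (rule arg_cong[where f = "\<lambda>X. blinfun_apply X 1"])
    also have "\<dots> = f'' t 1 1 * h"
      by (simp only: blinfun.scaleR_left real_scaleR_def mult.commute)
    finally show "f'' t h 1 = f'' t 1 1 * h" .
  qed
  have c: "(c has_real_derivative f' t 1) (at t)" for t
    unfolding has_field_derivative_def by (rule has_derivative_eq_rhs[OF f' 1])
  have dc: "deriv c = (\<lambda>t. f' t 1)" using DERIV_imp_deriv[OF c] by (rule ext)
  have d2: "(deriv c has_real_derivative f'' t 1 1) (at t)" for t
    unfolding dc has_field_derivative_def
    by (rule has_derivative_eq_rhs[OF bounded_linear.has_derivative[OF blinfun.bounded_linear_left f''] 2])
  show "(c has_real_derivative deriv c t) (at t)" unfolding dc by (rule c)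
  show "(deriv c has_real_derivative deriv (deriv c) t) (at t)" unfolding DERIV_imp_deriv[OF d2] by (rule d2)
qed

lemma separable_convex_imp_convex:
  assumes "separable_along Q cs f" and cvx: "\<And>i. convex_on UNIV (cs i)"
  shows "convex_on UNIV f"
proof (rule convex_onI)
  fix t :: real and x y assume t: "0 < t" "t < 1"
  have "f ((1 - t) *\<^sub>R x + t *\<^sub>R y) =
      (\<Sum>i\<in>UNIV. cs i ((1 - t) *\<^sub>R (transpose Q *v x) $ i + t *\<^sub>R (transpose Q *v y) $ i))"
    using assms(1) by (simp add: separable_along_def matrix_vector_right_distrib matrix_vector_mult_scaleR)
  also have "\<dots> \<le> (\<Sum>i\<in>UNIV. (1 - t) * cs i ((transpose Q *v x) $ i) + t * cs i ((transpose Q *v y) $ i))"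
    using t by (intro sum_mono convex_onD[OF cvx]) auto
  also have "\<dots> = (1 - t) * f x + t * f y"
    using assms(1) by (simp add: separable_along_def sum.distrib sum_distrib_left)
  finally show "f ((1 - t) *\<^sub>R x + t *\<^sub>R y) \<le> (1 - t) * f x + t * f y" .
qed simp

section \<open>Optimality from potentials\<close>

definition clip :: "nat \<Rightarrow> real \<Rightarrow> real" where
  "clip n r = max (- real n) (min (real n) r)"

text \<open>Truncated potentials are still dominated by the nonnegative cost \<open>s\<close>, and they are bounded, hence integrable whatever
the integrability of the potentials themselves.\<close>

lemma clip_add_le: "a + b \<le> s \<Longrightarrow> 0 \<le> s \<Longrightarrow> clip n a + clip n b \<le> s"
  unfolding clip_def max_def min_def by (simp split: if_split)

lemma clip_add_nonneg: "0 \<le> a + b \<Longrightarrow> 0 \<le> clip n a + clip n b"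
  unfolding clip_def by linarith

lemma abs_clip_le: "\<bar>clip n a\<bar> \<le> real n"
  unfolding clip_def by auto

lemma clip_tendsto: "(\<lambda>n. clip n a) \<longlonglongrightarrow> a"
proof (rule tendsto_eventually)
  obtain N :: nat where "\<bar>a\<bar> \<le> real N" using real_arch_simple by blast
  then show "\<forall>\<^sub>F n in sequentially. clip n a = a"
    by (intro eventually_sequentiallyI[of N]) (auto simp: clip_def)
qed

lemma clip_measurable[measurable]: "clip n \<in> borel_measurable borel"
  unfolding clip_def by measurable

text \<open>The integral depends on the marginals only, hence is the same for all couplings.\<close>

lemma clipped_potentials_integral:
  assumes \<gamma>: "\<gamma> \<in> couplings M N" and [measurable]: "a \<in> borel_measurable M" "b \<in> borel_measurable N"
  shows "integrable \<gamma> (\<lambda>z. clip n (a (fst z)) + clip n (b (snd z)))"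
    and "(\<integral>z. clip n (a (fst z)) + clip n (b (snd z)) \<partial>\<gamma>) = (\<integral>x. clip n (a x) \<partial>M) + (\<integral>y. clip n (b y) \<partial>N)"
proof -
  note [measurable] = coupling_marginals(1,2)[OF \<gamma>]
  note d = coupling_marginals(5,6)[OF \<gamma>]
  interpret \<gamma>: prob_space \<gamma> using \<gamma> by (rule coupling_marginals)
  have 1: "integrable \<gamma> (\<lambda>z. clip n (a (fst z)))" "integrable \<gamma> (\<lambda>z. clip n (b (snd z)))"
    by (auto intro!: \<gamma>.integrable_const_bound[of _ "real n"] simp: abs_clip_le)
  then show "integrable \<gamma> (\<lambda>z. clip n (a (fst z)) + clip n (b (snd z)))" by auto
  have "(\<integral>x. clip n (a x) \<partial>distr \<gamma> M fst) = (\<integral>z. clip n (a (fst z)) \<partial>\<gamma>)"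
    by (rule integral_distr) measurable
  moreover have "(\<integral>y. clip n (b y) \<partial>distr \<gamma> N snd) = (\<integral>z. clip n (b (snd z)) \<partial>\<gamma>)"
    by (rule integral_distr) measurable
  ultimately show "(\<integral>z. clip n (a (fst z)) + clip n (b (snd z)) \<partial>\<gamma>) = (\<integral>x. clip n (a x) \<partial>M) + (\<integral>y. clip n (b y) \<partial>N)"
    using 1 by (simp add: d)
qed

lemma integrable_sum_of_marginals:
  assumes \<gamma>: "\<gamma> \<in> couplings M N" and i: "integrable M (u :: _ \<Rightarrow> real)" "integrable N v"
  shows "integrable \<gamma> (\<lambda>z. u (fst z) + v (snd z))"
    and "(\<integral>z. u (fst z) + v (snd z) \<partial>\<gamma>) = (\<integral>x. u x \<partial>M) + (\<integral>y. v y \<partial>N)"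
proof -
  note [measurable] = coupling_marginals(1,2)[OF \<gamma>] borel_measurable_integrable[OF i(1)] borel_measurable_integrable[OF i(2)]
  note d = coupling_marginals(5,6)[OF \<gamma>]
  have 1: "integrable \<gamma> (\<lambda>z. u (fst z))"
    using i(1) by (subst integrable_distr_eq[of fst \<gamma> M u, symmetric]) (auto simp: d)
  have 2: "integrable \<gamma> (\<lambda>z. v (snd z))"
    using i(2) by (subst integrable_distr_eq[of snd \<gamma> N v, symmetric]) (auto simp: d)
  show "integrable \<gamma> (\<lambda>z. u (fst z) + v (snd z))" using 1 2 by auto
  have "(\<integral>x. u x \<partial>distr \<gamma> M fst) = (\<integral>z. u (fst z) \<partial>\<gamma>)"
    by (rule integral_distr) measurable
  moreover have "(\<integral>y. v y \<partial>distr \<gamma> N snd) = (\<integral>z. v (snd z) \<partial>\<gamma>)"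
    by (rule integral_distr) measurable
  ultimately show "(\<integral>z. u (fst z) + v (snd z) \<partial>\<gamma>) = (\<integral>x. u x \<partial>M) + (\<integral>y. v y \<partial>N)"
    using 1 2 by (simp add: d)
qed

text \<open>Duality without integrable potentials. Subtract the integrable minorant, so that the cost \<open>s\<close> becomes nonnegative,
and truncate the two potentials. The truncated potentials stay below \<open>s\<close> everywhere, and their integral \<open>J n\<close> is the
same for every coupling; so \<open>J n\<close> is at most the cost of \<open>\<gamma>\<close>. On the graph of \<open>T\<close> they are nonnegative and
converge to \<open>s\<close>, so by Fatou's lemma the cost of the graph is at most the lower limit of \<open>J n\<close>.\<close>

lemma contact_map_cost_le:
  fixes c :: "'a \<Rightarrow> 'b \<Rightarrow> real"
  assumes M: "prob_space M" and T[measurable]: "T \<in> measurable M N" and TN: "distr M N T = N"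
    and c[measurable]: "(\<lambda>z. c (fst z) (snd z)) \<in> borel_measurable (M \<Otimes>\<^sub>M N)"
    and i: "integrable M u0" "integrable N v0" and le0: "\<And>x y. u0 x + v0 y \<le> c x y"
    and m[measurable]: "u \<in> borel_measurable M" "v \<in> borel_measurable N"
    and le: "\<And>x y. u x + v y \<le> c x y" and contact: "\<And>x. u x + v (T x) = c x (T x)"
    and \<gamma>: "\<gamma> \<in> couplings M N"
  shows "transport_cost c (distr M (M \<Otimes>\<^sub>M N) (\<lambda>x. (x, T x))) \<le> transport_cost c \<gamma>"
proof -
  note [measurable] = borel_measurable_integrable[OF i(1)] borel_measurable_integrable[OF i(2)]
  let ?G = "distr M (M \<Otimes>\<^sub>M N) (\<lambda>x. (x, T x))"
  have G: "?G \<in> couplings M N" by (rule graph_coupling[OF M T TN])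
  let ?w = "\<lambda>z. u0 (fst z) + v0 (snd z)"
  let ?\<xi> = "\<lambda>n z. clip n (u (fst z) - u0 (fst z)) + clip n (v (snd z) - v0 (snd z))"
  define J where "J n = (\<integral>x. clip n (u x - u0 x) \<partial>M) + (\<integral>y. clip n (v y - v0 y) \<partial>N)" for n
  have J: "integrable \<eta> (?\<xi> n)" "(\<integral>z. ?\<xi> n z \<partial>\<eta>) = J n" if "\<eta> \<in> couplings M N" for \<eta> n
    using clipped_potentials_integral[OF that, of "\<lambda>x. u x - u0 x" "\<lambda>y. v y - v0 y" n]
    by (simp_all add: J_def)
  have cost: "transport_cost c \<eta> = enn2ereal (\<integral>\<^sup>+z. ennreal (c (fst z) (snd z) - ?w z) \<partial>\<eta>)
      + ereal ((\<integral>x. u0 x \<partial>M) + (\<integral>y. v0 y \<partial>N))" if "\<eta> \<in> couplings M N" for \<eta>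
  proof -
    have "(\<lambda>z. c (fst z) (snd z)) \<in> borel_measurable \<eta>"
      using c coupling_marginals(4)[OF that] by (simp cong: measurable_cong_sets)
    from transport_cost_above_minorant(1)[OF this integrable_sum_of_marginals(1)[OF that i] le0]
    show ?thesis by (simp add: integrable_sum_of_marginals(2)[OF that i])
  qed
  have Jle: "ennreal (J n) \<le> (\<integral>\<^sup>+z. ennreal (c (fst z) (snd z) - ?w z) \<partial>\<gamma>)" for n
  proof -
    have ip: "integrable \<gamma> (\<lambda>z. max 0 (?\<xi> n z))" using J(1)[OF \<gamma>] by auto
    have "J n \<le> (\<integral>z. max 0 (?\<xi> n z) \<partial>\<gamma>)"
      unfolding J(2)[OF \<gamma>, symmetric] by (rule integral_mono[OF J(1)[OF \<gamma>] ip]) simp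
    then have "ennreal (J n) \<le> ennreal (\<integral>z. max 0 (?\<xi> n z) \<partial>\<gamma>)" by (rule ennreal_leI)
    also have "\<dots> = (\<integral>\<^sup>+z. ennreal (max 0 (?\<xi> n z)) \<partial>\<gamma>)"
      by (rule nn_integral_eq_integral[symmetric, OF ip]) simp
    also have "\<dots> \<le> (\<integral>\<^sup>+z. ennreal (c (fst z) (snd z) - ?w z) \<partial>\<gamma>)"
    proof (intro nn_integral_mono ennreal_leI)
      fix z
      have "?\<xi> n z \<le> c (fst z) (snd z) - ?w z"
        using le[of "fst z" "snd z"] le0[of "fst z" "snd z"] by (intro clip_add_le) auto
      then show "max 0 (?\<xi> n z) \<le> c (fst z) (snd z) - ?w z" using le0[of "fst z" "snd z"] by simp
    qed
    finally show ?thesis .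
  qed
  have gm[measurable]: "(\<lambda>x. (x, T x)) \<in> measurable M (M \<Otimes>\<^sub>M N)" by measurable
  have cw: "(\<lambda>z. ennreal (c (fst z) (snd z) - ?w z)) \<in> borel_measurable (M \<Otimes>\<^sub>M N)" by measurable
  have "(\<integral>\<^sup>+z. ennreal (c (fst z) (snd z) - ?w z) \<partial>?G) = (\<integral>\<^sup>+x. ennreal (c x (T x) - (u0 x + v0 (T x))) \<partial>M)"
    using nn_integral_distr[OF gm, of "\<lambda>z. ennreal (c (fst z) (snd z) - ?w z)"] cw by simp
  also have "\<dots> = (\<integral>\<^sup>+x. liminf (\<lambda>n. ennreal (?\<xi> n (x, T x))) \<partial>M)"
  proof (rule nn_integral_cong)
    fix x
    have "(\<lambda>n. ?\<xi> n (x, T x)) \<longlonglongrightarrow> (u x - u0 x) + (v (T x) - v0 (T x))"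
      unfolding fst_conv snd_conv by (intro tendsto_add clip_tendsto)
    also have "(u x - u0 x) + (v (T x) - v0 (T x)) = c x (T x) - (u0 x + v0 (T x))"
      using contact[of x] by simp
    finally have "(\<lambda>n. ennreal (?\<xi> n (x, T x))) \<longlonglongrightarrow> ennreal (c x (T x) - (u0 x + v0 (T x)))"
      by (rule tendsto_ennrealI)
    then show "ennreal (c x (T x) - (u0 x + v0 (T x))) = liminf (\<lambda>n. ennreal (?\<xi> n (x, T x)))"
      by (intro lim_imp_Liminf[symmetric]) auto
  qed
  also have "\<dots> \<le> liminf (\<lambda>n. \<integral>\<^sup>+x. ennreal (?\<xi> n (x, T x)) \<partial>M)"
    by (rule nn_integral_liminf) measurable
  also have "\<dots> = liminf (\<lambda>n. ennreal (J n))"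
  proof -
    have "(\<integral>\<^sup>+x. ennreal (?\<xi> n (x, T x)) \<partial>M) = ennreal (J n)" for n
    proof -
      have ix: "integrable M (\<lambda>x. ?\<xi> n (x, T x))"
        using J(1)[OF G, of n] by (subst (asm) integrable_distr_eq) auto
      have "(\<integral>\<^sup>+x. ennreal (?\<xi> n (x, T x)) \<partial>M) = ennreal (\<integral>x. ?\<xi> n (x, T x) \<partial>M)"
      proof (rule nn_integral_eq_integral[OF ix], rule AE_I2)
        show "0 \<le> ?\<xi> n (x, T x)" for x
          unfolding fst_conv snd_conv using contact[of x] le0[of x "T x"] by (intro clip_add_nonneg) simp
      qed
      also have "(\<integral>x. ?\<xi> n (x, T x) \<partial>M) = (\<integral>z. ?\<xi> n z \<partial>?G)"
        by (subst integral_distr) auto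
      finally show ?thesis by (simp add: J(2)[OF G, simplified])
    qed
    then show ?thesis by simp
  qed
  also have "\<dots> \<le> liminf (\<lambda>n. \<integral>\<^sup>+z. ennreal (c (fst z) (snd z) - ?w z) \<partial>\<gamma>)"
    by (rule Liminf_mono) (simp add: Jle)
  also have "\<dots> = (\<integral>\<^sup>+z. ennreal (c (fst z) (snd z) - ?w z) \<partial>\<gamma>)"
    by (simp add: Liminf_const)
  finally show ?thesis
    unfolding cost[OF G] cost[OF \<gamma>] by (intro add_right_mono) (simp add: less_eq_ennreal.rep_eq)
qed

lemma contact_map_optimal:
  fixes c :: "'a \<Rightarrow> 'b \<Rightarrow> real"
  assumes M: "prob_space M" and T: "T \<in> measurable M N" and TN: "distr M N T = N"
    and c: "(\<lambda>z. c (fst z) (snd z)) \<in> borel_measurable (M \<Otimes>\<^sub>M N)"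
    and i: "integrable M u0" "integrable N v0" and le0: "\<And>x y. u0 x + v0 y \<le> c x y"
    and m: "u \<in> borel_measurable M" "v \<in> borel_measurable N"
    and le: "\<And>x y. u x + v y \<le> c x y" and contact: "\<And>x. u x + v (T x) = c x (T x)"
  shows "optimal_transport_map c M N T"
proof -
  let ?G = "distr M (M \<Otimes>\<^sub>M N) (\<lambda>x. (x, T x))"
  have "transport_cost c ?G = optimal_cost c M N"
    unfolding optimal_cost_def
  proof (rule antisym)
    show "transport_cost c ?G \<le> (INF \<gamma>\<in>couplings M N. transport_cost c \<gamma>)"
      by (rule INF_greatest) (rule contact_map_cost_le[OF assms])
    show "(INF \<gamma>\<in>couplings M N. transport_cost c \<gamma>) \<le> transport_cost c ?G"
      by (rule INF_lower) (rule graph_coupling[OF M T TN])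
  qed
  then show ?thesis using T TN by (simp add: optimal_transport_map_def)
qed

text \<open>The costs reduced by the minorant have the same finite integral along the graphs of the optimal maps \<open>S\<close> and \<open>T\<close>,
and \<open>J n\<close> converges to it by dominated convergence along the graph of \<open>T\<close>. Hence the integral of the gap between the cost and the truncated potentials along the graph of \<open>S\<close> tends
to \<open>0\<close>, and by Fatou's lemma the gap \<open>c - u - v\<close> is zero almost everywhere on that graph.\<close>

lemma contact_map_unique:
  fixes c :: "'a \<Rightarrow> 'b \<Rightarrow> real"
  assumes M: "prob_space M" and T[measurable]: "T \<in> measurable M N" and TN: "distr M N T = N"
    and c[measurable]: "(\<lambda>z. c (fst z) (snd z)) \<in> borel_measurable (M \<Otimes>\<^sub>M N)"
    and i: "integrable M u0" "integrable N v0" and le0: "\<And>x y. u0 x + v0 y \<le> c x y"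
    and m[measurable]: "u \<in> borel_measurable M" "v \<in> borel_measurable N"
    and le: "\<And>x y. u x + v y \<le> c x y" and contact: "\<And>x. u x + v (T x) = c x (T x)"
    and only: "\<And>x y. u x + v y = c x y \<Longrightarrow> y = T x"
    and fin: "optimal_cost c M N < \<infinity>" and S: "optimal_transport_map c M N S"
  shows "AE x in M. S x = T x"
proof -
  note [measurable] = borel_measurable_integrable[OF i(1)] borel_measurable_integrable[OF i(2)]
  let ?w = "\<lambda>z. u0 (fst z) + v0 (snd z)"
  let ?\<xi> = "\<lambda>n z. clip n (u (fst z) - u0 (fst z)) + clip n (v (snd z) - v0 (snd z))"
  let ?\<Gamma> = "\<lambda>R. distr M (M \<Otimes>\<^sub>M N) (\<lambda>x. (x, R x))"
  let ?e = "\<lambda>R x. c x (R x) - (u0 x + v0 (R x))"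
  define J where "J n = (\<integral>x. clip n (u x - u0 x) \<partial>M) + (\<integral>y. clip n (v y - v0 y) \<partial>N)" for n
  have opt: "optimal_transport_map c M N T" by (rule contact_map_optimal[OF assms(1-11)])
  have S'[measurable]: "S \<in> measurable M N" using S by (simp add: optimal_transport_map_def)
  have along: "integrable M (?e R)" "(\<integral>x. ?e R x \<partial>M) = real_of_ereal (optimal_cost c M N) - ((\<integral>x. u0 x \<partial>M) + (\<integral>y. v0 y \<partial>N))"
     "integrable M (\<lambda>x. ?\<xi> n (x, R x))" "(\<integral>x. ?\<xi> n (x, R x) \<partial>M) = J n"
    if R: "optimal_transport_map c M N R" for R n
  proof -
    have Rm[measurable]: "R \<in> measurable M N" and RN: "distr M N R = N"
      and Rc: "transport_cost c (?\<Gamma> R) = optimal_cost c M N"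
      using R by (simp_all add: optimal_transport_map_def)
    have gm[measurable]: "(\<lambda>x. (x, R x)) \<in> measurable M (M \<Otimes>\<^sub>M N)" by measurable
    have G: "?\<Gamma> R \<in> couplings M N" by (rule graph_coupling[OF M Rm RN])
    note w = integrable_sum_of_marginals[OF G i]
    have ic: "integrable (?\<Gamma> R) (\<lambda>z. c (fst z) (snd z))"
      using transport_cost_above_minorant(2)[OF _ w(1) le0] Rc fin c by simp
    have ed: "integrable (?\<Gamma> R) (\<lambda>z. c (fst z) (snd z) - ?w z)" using ic w(1) by auto
    then show "integrable M (?e R)"
      by (subst (asm) integrable_distr_eq) auto
    have "(\<integral>x. ?e R x \<partial>M) = (\<integral>z. c (fst z) (snd z) - ?w z \<partial>?\<Gamma> R)"
      by (subst integral_distr) auto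
    also have "\<dots> = (\<integral>z. c (fst z) (snd z) \<partial>?\<Gamma> R) - (\<integral>z. ?w z \<partial>?\<Gamma> R)"
      by (rule Bochner_Integration.integral_diff[OF ic w(1)])
    finally have e: "(\<integral>x. ?e R x \<partial>M) = (\<integral>z. c (fst z) (snd z) \<partial>?\<Gamma> R) - (\<integral>z. ?w z \<partial>?\<Gamma> R)" .
    have "optimal_cost c M N = ereal (\<integral>z. c (fst z) (snd z) \<partial>?\<Gamma> R)"
      using Rc transport_cost_integrable[OF ic] by simp
    then show "(\<integral>x. ?e R x \<partial>M) = real_of_ereal (optimal_cost c M N) - ((\<integral>x. u0 x \<partial>M) + (\<integral>y. v0 y \<partial>N))"
      unfolding e w(2) by simp
    have mu: "(\<lambda>x. u x - u0 x) \<in> borel_measurable M" "(\<lambda>y. v y - v0 y) \<in> borel_measurable N"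
      by measurable
    note k = clipped_potentials_integral[OF G mu, of n]
    have k\<xi>: "?\<xi> n \<in> borel_measurable (M \<Otimes>\<^sub>M N)" by measurable
    show "integrable M (\<lambda>x. ?\<xi> n (x, R x))"
      using k(1) unfolding integrable_distr_eq[OF gm k\<xi>] .
    have "(\<integral>x. ?\<xi> n (x, R x) \<partial>M) = (\<integral>z. ?\<xi> n z \<partial>?\<Gamma> R)"
      by (rule integral_distr[OF gm k\<xi>, symmetric])
    then show "(\<integral>x. ?\<xi> n (x, R x) \<partial>M) = J n" unfolding k(2) J_def .
  qed
  have lim: "(\<lambda>n. ?\<xi> n (x, R x)) \<longlonglongrightarrow> (u x - u0 x) + (v (R x) - v0 (R x))" for R x
    unfolding fst_conv snd_conv by (intro tendsto_add clip_tendsto)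
  have \<xi>le: "?\<xi> n (x, R x) \<le> ?e R x" for n R x
    unfolding fst_conv snd_conv using le[of x "R x"] le0[of x "R x"] by (intro clip_add_le) auto
  have "(\<lambda>n. \<integral>x. ?\<xi> n (x, T x) \<partial>M) \<longlonglongrightarrow> (\<integral>x. ?e T x \<partial>M)"
  proof (rule integral_dominated_convergence[where w = "?e T"])
    show "AE x in M. (\<lambda>n. ?\<xi> n (x, T x)) \<longlonglongrightarrow> ?e T x"
    proof (rule AE_I2)
      fix x
      have "(u x - u0 x) + (v (T x) - v0 (T x)) = ?e T x" using contact[of x] by simp
      with lim[of x T] show "(\<lambda>n. ?\<xi> n (x, T x)) \<longlonglongrightarrow> ?e T x" by (simp only:)
    qed
    show "AE x in M. norm (?\<xi> n (x, T x)) \<le> ?e T x" for n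
    proof (rule AE_I2)
      fix x
      have "0 \<le> ?\<xi> n (x, T x)"
        unfolding fst_conv snd_conv using contact[of x] le0[of x "T x"] by (intro clip_add_nonneg) simp
      then show "norm (?\<xi> n (x, T x)) \<le> ?e T x" using \<xi>le[of n x T] by simp
    qed
    show "integrable M (?e T)" by (rule along(1)[OF opt])
    show "?e T \<in> borel_measurable M" by (rule borel_measurable_integrable[OF along(1)[OF opt]])
    show "(\<lambda>x. ?\<xi> n (x, T x)) \<in> borel_measurable M" for n
      by (rule borel_measurable_integrable[OF along(3)[OF opt]])
  qed
  then have "J \<longlonglongrightarrow> (\<integral>x. ?e T x \<partial>M)" by (simp only: along(4)[OF opt])
  also have "(\<integral>x. ?e T x \<partial>M) = (\<integral>x. ?e S x \<partial>M)" by (simp only: along(2)[OF opt] along(2)[OF S])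
  finally have Jlim: "J \<longlonglongrightarrow> (\<integral>x. ?e S x \<partial>M)" .
  have eS[measurable]: "?e S \<in> borel_measurable M"
    by (rule borel_measurable_integrable[OF along(1)[OF S]])
  have \<xi>S[measurable]: "(\<lambda>x. ?\<xi> n (x, S x)) \<in> borel_measurable M" for n
    by (rule borel_measurable_integrable[OF along(3)[OF S]])
  let ?gap = "\<lambda>x. c x (S x) - (u x + v (S x))"
  have "(\<integral>\<^sup>+x. ennreal (?gap x) \<partial>M) = (\<integral>\<^sup>+x. liminf (\<lambda>n. ennreal (?e S x - ?\<xi> n (x, S x))) \<partial>M)"
  proof (rule nn_integral_cong)
    fix x
    have "(\<lambda>n. ?e S x - ?\<xi> n (x, S x)) \<longlonglongrightarrow> ?e S x - ((u x - u0 x) + (v (S x) - v0 (S x)))"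
      by (intro tendsto_diff tendsto_const lim)
    then have "(\<lambda>n. ennreal (?e S x - ?\<xi> n (x, S x))) \<longlonglongrightarrow> ennreal (?gap x)"
      by (intro tendsto_ennrealI) (simp add: algebra_simps)
    then show "ennreal (?gap x) = liminf (\<lambda>n. ennreal (?e S x - ?\<xi> n (x, S x)))"
      by (intro lim_imp_Liminf[symmetric]) auto
  qed
  also have "\<dots> \<le> liminf (\<lambda>n. \<integral>\<^sup>+x. ennreal (?e S x - ?\<xi> n (x, S x)) \<partial>M)"
    by (rule nn_integral_liminf) measurable
  also have "\<dots> = liminf (\<lambda>n. ennreal ((\<integral>x. ?e S x \<partial>M) - J n))"
  proof -
    have "(\<integral>\<^sup>+x. ennreal (?e S x - ?\<xi> n (x, S x)) \<partial>M) = ennreal ((\<integral>x. ?e S x \<partial>M) - J n)" for n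
    proof -
      have "(\<integral>\<^sup>+x. ennreal (?e S x - ?\<xi> n (x, S x)) \<partial>M) = ennreal (\<integral>x. ?e S x - ?\<xi> n (x, S x) \<partial>M)"
      proof (rule nn_integral_eq_integral)
        show "integrable M (\<lambda>x. ?e S x - ?\<xi> n (x, S x))"
          by (rule Bochner_Integration.integrable_diff[OF along(1)[OF S] along(3)[OF S]])
        show "AE x in M. 0 \<le> ?e S x - ?\<xi> n (x, S x)"
        proof (rule AE_I2)
          fix x show "0 \<le> ?e S x - ?\<xi> n (x, S x)" using \<xi>le[of n x S] by linarith
        qed
      qed
      also have "(\<integral>x. ?e S x - ?\<xi> n (x, S x) \<partial>M) = (\<integral>x. ?e S x \<partial>M) - J n"
        by (subst Bochner_Integration.integral_diff[OF along(1)[OF S] along(3)[OF S]]) (simp only: along(4)[OF S])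
      finally show ?thesis .
    qed
    then show ?thesis by simp
  qed
  also have "\<dots> = 0"
  proof (rule lim_imp_Liminf)
    have "(\<lambda>n. (\<integral>x. ?e S x \<partial>M) - J n) \<longlonglongrightarrow> (\<integral>x. ?e S x \<partial>M) - (\<integral>x. ?e S x \<partial>M)"
      by (intro tendsto_diff tendsto_const Jlim)
    from tendsto_ennrealI[OF this]
    show "(\<lambda>n. ennreal ((\<integral>x. ?e S x \<partial>M) - J n)) \<longlonglongrightarrow> 0"
      by (simp only: diff_self ennreal_0)
  qed simp
  finally have "(\<integral>\<^sup>+x. ennreal (?gap x) \<partial>M) = 0" by simp
  moreover have "?gap \<in> borel_measurable M"
  proof -
    have "(\<lambda>x. (x, S x)) \<in> measurable M (M \<Otimes>\<^sub>M N)" by measurable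
    from measurable_compose[OF this c] have "(\<lambda>x. c x (S x)) \<in> borel_measurable M" by simp
    then show ?thesis by measurable
  qed
  ultimately have "AE x in M. ennreal (?gap x) = 0" by (subst (asm) nn_integral_0_iff_AE) auto
  then show ?thesis
  proof eventually_elim
    case (elim x)
    then have "?gap x \<le> 0" by (simp add: ennreal_eq_0_iff)
    then show ?case using le[of x "S x"] by (intro only) simp
  qed
qed

section \<open>Potentials for separable costs\<close>

lemma convex_derivative_mono:
  fixes c :: "real \<Rightarrow> real"
  assumes cvx: "convex_on UNIV c" and D: "\<And>t. (c has_real_derivative c1 t) (at t)" and "x \<le> y"
  shows "c1 x \<le> c1 y"
proof (cases "x = y")
  case False
  then have "x < y" using assms(3) by simp
  have "c1 x * (y - x) \<le> c y - c x" "c1 y * (x - y) \<le> c x - c y"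
    using convex_on_imp_above_tangent[OF cvx connected_UNIV _ _ D] by auto
  then have "c1 x * (y - x) \<le> c1 y * (y - x)" by (simp add: algebra_simps)
  then show ?thesis using \<open>x < y\<close> by simp
qed simp

lemma strictly_convex_derivative_strict_mono:
  fixes c :: "real \<Rightarrow> real"
  assumes cvx: "convex_on UNIV c" and sc: "strictly_convex c"
    and D: "\<And>t. (c has_real_derivative c1 t) (at t)" and xy: "x < y"
  shows "c1 x < c1 y"
proof (rule ccontr)
  assume "\<not> c1 x < c1 y"
  then have eq: "c1 x = c1 y" using convex_derivative_mono[OF cvx D, of x y] xy by simp
  define m where "m = (1 - 1/2) *\<^sub>R x + (1/2) *\<^sub>R y"
  have tan: "c1 s * (r - s) \<le> c r - c s" for r s
    using convex_on_imp_above_tangent[OF cvx connected_UNIV _ _ D] by auto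
  have "c m < (1 - 1/2) * c x + (1/2) * c y"
    using sc[unfolded strictly_convex_def, rule_format, of x y "1/2"] xy by (simp add: m_def)
  moreover have "c1 x * (m - x) \<le> c m - c x" "c1 y * (m - y) \<le> c m - c y" by (rule tan)+
  moreover have "c1 x * (m - x) + c1 y * (m - y) = 0" unfolding eq m_def by (simp add: algebra_simps)
  ultimately show False by simp
qed

text \<open>The first-order condition along the graph prescribes \<open>u' x = c1 (x - (d * x + \<beta>))\<close>, which is integrated
explicitly, and \<open>v\<close> is determined by equality on the graph. For fixed \<open>y\<close>, the function
\<open>c (x - y) - u x\<close> decreases up to the point \<open>x0 y\<close> that is mapped to \<open>y\<close> and increases afterwards, because \<open>c1\<close> is
increasing and \<open>d > 0\<close>; so its minimum is \<open>v y\<close>.\<close>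

lemma one_dimensional_potentials:
  fixes c :: "real \<Rightarrow> real"
  assumes cvx: "convex_on UNIV c" and D: "\<And>t. (c has_real_derivative c1 t) (at t)" and d: "d > 0"
  obtains u v where "continuous_on UNIV u" "continuous_on UNIV v"
    "\<And>x y. u x + v y \<le> c (x - y)" "\<And>x. u x + v (d * x + \<beta>) = c (x - (d * x + \<beta>))"
    "\<And>x y. strictly_convex c \<Longrightarrow> u x + v y = c (x - y) \<Longrightarrow> y = d * x + \<beta>"
proof -
  \<comment> \<open>For \<open>d = 1\<close> the displacement is the constant \<open>- \<beta>\<close> and the antiderivative is linear.\<close>
  define u where "u x = (if d = 1 then c1 (- \<beta>) * x else c ((1 - d) * x - \<beta>) / (1 - d))" for x
  have Du: "(u has_real_derivative c1 (x - (d * x + \<beta>))) (at x)" for x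
  proof (cases "d = 1")
    case True
    then show ?thesis unfolding u_def by (auto intro!: derivative_eq_intros)
  next
    case False
    have "((\<lambda>x. c ((1 - d) * x - \<beta>)) has_real_derivative c1 ((1 - d) * x - \<beta>) * (1 - d)) (at x)"
      by (rule DERIV_chain2[OF D]) (auto intro!: derivative_eq_intros)
    from DERIV_cdivide[OF this, of "1 - d"]
    have "((\<lambda>x. c ((1 - d) * x - \<beta>) / (1 - d)) has_real_derivative c1 ((1 - d) * x - \<beta>)) (at x)"
      using False by simp
    moreover have "u = (\<lambda>x. c ((1 - d) * x - \<beta>) / (1 - d))" using False by (simp add: u_def fun_eq_iff)
    moreover have "(1 - d) * x - \<beta> = x - (d * x + \<beta>)" by (simp add: algebra_simps)
    ultimately show ?thesis by simp
  qed
  define x0 where "x0 y = (y - \<beta>) / d" for y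
  define v where "v y = c (x0 y - y) - u (x0 y)" for y
  have x0: "d * x0 y + \<beta> = y" for y using d by (simp add: x0_def)
  define G where "G y x = c (x - y) - u x" for x y
  have DG: "(G y has_real_derivative c1 (x - y) - c1 (x - (d * x + \<beta>))) (at x)" for x y
    unfolding G_def
    by (auto intro!: derivative_eq_intros Du DERIV_chain2[OF D])
  have vG: "v y = G y (x0 y)" for y by (simp add: v_def G_def)
  have right: "\<exists>\<xi>. G y x - G y (x0 y) = (x - x0 y) * (c1 (\<xi> - y) - c1 (\<xi> - (d * \<xi> + \<beta>))) \<and>
      \<xi> - (d * \<xi> + \<beta>) < \<xi> - y" if lt: "x0 y < x" for x y
  proof -
    obtain \<xi> where "x0 y < \<xi>" "G y x - G y (x0 y) = (x - x0 y) * (c1 (\<xi> - y) - c1 (\<xi> - (d * \<xi> + \<beta>)))"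
      using MVT2[OF lt, of "G y", OF DG] by blast
    moreover have "d * x0 y < d * \<xi>" using d calculation(1) by simp
    ultimately show ?thesis using x0[of y] by (intro exI[of _ \<xi>]) auto
  qed
  have left: "\<exists>\<xi>. G y x - G y (x0 y) = (x0 y - x) * (c1 (\<xi> - (d * \<xi> + \<beta>)) - c1 (\<xi> - y)) \<and>
      \<xi> - y < \<xi> - (d * \<xi> + \<beta>)" if lt: "x < x0 y" for x y
  proof -
    obtain \<xi> where "\<xi> < x0 y" "G y (x0 y) - G y x = (x0 y - x) * (c1 (\<xi> - y) - c1 (\<xi> - (d * \<xi> + \<beta>)))"
      using MVT2[OF lt, of "G y", OF DG] by blast
    moreover have "d * \<xi> < d * x0 y" using d calculation(1) by simp
    ultimately show ?thesis using x0[of y] by (intro exI[of _ \<xi>]) (auto simp: algebra_simps)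
  qed
  have cu: "continuous_on UNIV u" 
    by (rule DERIV_continuous_on[OF has_field_derivative_at_within[OF Du]])
  have cc: "continuous_on UNIV c" 
    by (rule DERIV_continuous_on[OF has_field_derivative_at_within[OF D]])
  show thesis
  proof (rule that[OF cu])
    show "continuous_on UNIV v" unfolding v_def x0_def
      using d by (intro continuous_intros continuous_on_compose2[OF cc] continuous_on_compose2[OF cu]) auto
    show "u x + v (d * x + \<beta>) = c (x - (d * x + \<beta>))" for x
      using d by (simp add: v_def x0_def)
    show "u x + v y \<le> c (x - y)" for x y
    proof -
      have "0 \<le> G y x - G y (x0 y)"
      proof (cases x "x0 y" rule: linorder_cases)
        case less
        obtain \<xi> where "G y x - G y (x0 y) = (x0 y - x) * (c1 (\<xi> - (d * \<xi> + \<beta>)) - c1 (\<xi> - y))"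
          "\<xi> - y < \<xi> - (d * \<xi> + \<beta>)" using left[OF less] by blast
        then show ?thesis using less convex_derivative_mono[OF cvx D, of "\<xi> - y" "\<xi> - (d * \<xi> + \<beta>)"] by simp
      next
        case greater
        obtain \<xi> where "G y x - G y (x0 y) = (x - x0 y) * (c1 (\<xi> - y) - c1 (\<xi> - (d * \<xi> + \<beta>)))"
          "\<xi> - (d * \<xi> + \<beta>) < \<xi> - y" using right[OF greater] by blast
        then show ?thesis using greater convex_derivative_mono[OF cvx D, of "\<xi> - (d * \<xi> + \<beta>)" "\<xi> - y"] by simp
      qed simp
      then show ?thesis by (simp add: vG) (simp add: G_def)
    qed
    show "y = d * x + \<beta>" if sc: "strictly_convex c" and eq: "u x + v y = c (x - y)" for x y
    proof -
      note mono = strictly_convex_derivative_strict_mono[OF cvx sc D]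
      have z: "G y x - G y (x0 y) = 0" using eq by (simp add: vG) (simp add: G_def)
      have "x = x0 y"
      proof (cases x "x0 y" rule: linorder_cases)
        case less
        obtain \<xi> where "G y x - G y (x0 y) = (x0 y - x) * (c1 (\<xi> - (d * \<xi> + \<beta>)) - c1 (\<xi> - y))"
          "\<xi> - y < \<xi> - (d * \<xi> + \<beta>)" using left[OF less] by blast
        then show ?thesis using z less mono[of "\<xi> - y" "\<xi> - (d * \<xi> + \<beta>)"] by simp
      next
        case greater
        obtain \<xi> where "G y x - G y (x0 y) = (x - x0 y) * (c1 (\<xi> - y) - c1 (\<xi> - (d * \<xi> + \<beta>)))"
          "\<xi> - (d * \<xi> + \<beta>) < \<xi> - y" using right[OF greater] by blast
        then show ?thesis using z greater mono[of "\<xi> - (d * \<xi> + \<beta>)" "\<xi> - y"] by simp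
      qed
      then show ?thesis using x0[of y] by simp
    qed
  qed
qed

lemma affine_map_coordinate:
  assumes sd: "spectral_decomposition A Q D" and sym: "transpose A = A"
  shows "(transpose Q *v affine_map A b x) $ i = D $ i $ i * (transpose Q *v x) $ i + (transpose Q *v b) $ i"
proof -
  have "column i Q \<bullet> (A *v x) = (A *v column i Q) \<bullet> x"
    using dot_lmul_matrix[of "column i Q" A x] transpose_matrix_vector[of A "column i Q"] by (simp add: sym)
  then show ?thesis
    by (simp add: affine_map_def transpose_mult_vec_nth inner_add_right spectral_decomposition_eigenvector[OF sd])
qed

text \<open>In the coordinates given by the columns of \<open>Q\<close> the affine map acts on each coordinate separately, so the potentials
are sums of one-dimensional ones. A sum of nonnegative gaps vanishes only if each of them does.\<close>

lemma separable_potentials: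
  fixes f :: "real^'n \<Rightarrow> real"
  assumes sep: "separable_along Q cs f" and C2: "\<And>i. C2_on UNIV (cs i)" and cvx: "\<And>i. convex_on UNIV (cs i)"
    and sd: "spectral_decomposition A Q D" and A: "sym_pos_def A"
  obtains u v where "continuous_on UNIV u" "continuous_on UNIV v"
    "\<And>x y. u x + v y \<le> f (x - y)" "\<And>x. u x + v (affine_map A b x) = f (x - affine_map A b x)"
    "\<And>x y. (\<And>i. strictly_convex (cs i)) \<Longrightarrow> u x + v y = f (x - y) \<Longrightarrow> y = affine_map A b x"
proof -
  have Q: "orthogonal_matrix Q" using sd by (simp add: spectral_decomposition_def)
  have sym: "transpose A = A" using A by (simp add: sym_pos_def_def)
  have "\<forall>i. \<exists>u v. continuous_on UNIV u \<and> continuous_on UNIV v \<and>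
    (\<forall>x y. u x + v y \<le> cs i (x - y)) \<and>
    (\<forall>x. u x + v (D $ i $ i * x + (transpose Q *v b) $ i) = cs i (x - (D $ i $ i * x + (transpose Q *v b) $ i))) \<and>
    (\<forall>x y. strictly_convex (cs i) \<longrightarrow> u x + v y = cs i (x - y) \<longrightarrow> y = D $ i $ i * x + (transpose Q *v b) $ i)"
  proof
    fix i
    show "\<exists>u v. continuous_on UNIV u \<and> continuous_on UNIV v \<and>
    (\<forall>x y. u x + v y \<le> cs i (x - y)) \<and>
    (\<forall>x. u x + v (D $ i $ i * x + (transpose Q *v b) $ i) = cs i (x - (D $ i $ i * x + (transpose Q *v b) $ i))) \<and>
    (\<forall>x y. strictly_convex (cs i) \<longrightarrow> u x + v y = cs i (x - y) \<longrightarrow> y = D $ i $ i * x + (transpose Q *v b) $ i)"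
      by (rule one_dimensional_potentials[OF cvx[of i] C2_on_UNIV_DERIV_deriv(1)[OF C2[of i]] spectral_decomposition_pos[OF sd A, of i], where \<beta> = "(transpose Q *v b) $ i"])
         blast
  qed
  from choice[OF this] obtain u where "\<forall>i. \<exists>v. continuous_on UNIV (u i) \<and> continuous_on UNIV v \<and>
    (\<forall>x y. u i x + v y \<le> cs i (x - y)) \<and>
    (\<forall>x. u i x + v (D $ i $ i * x + (transpose Q *v b) $ i) = cs i (x - (D $ i $ i * x + (transpose Q *v b) $ i))) \<and>
    (\<forall>x y. strictly_convex (cs i) \<longrightarrow> u i x + v y = cs i (x - y) \<longrightarrow> y = D $ i $ i * x + (transpose Q *v b) $ i)" ..
  from choice[OF this] obtain v where uv: "\<And>i. continuous_on UNIV (u i)" "\<And>i. continuous_on UNIV (v i)"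
    "\<And>i x y. u i x + v i y \<le> cs i (x - y)"
    "\<And>i x. u i x + v i (D $ i $ i * x + (transpose Q *v b) $ i) = cs i (x - (D $ i $ i * x + (transpose Q *v b) $ i))"
    "\<And>i x y. strictly_convex (cs i) \<Longrightarrow> u i x + v i y = cs i (x - y) \<Longrightarrow> y = D $ i $ i * x + (transpose Q *v b) $ i"
    by blast
  define U where "U x = (\<Sum>i\<in>UNIV. u i ((transpose Q *v x) $ i))" for x
  define V where "V y = (\<Sum>i\<in>UNIV. v i ((transpose Q *v y) $ i))" for y
  have cont: "continuous_on UNIV (\<lambda>x. \<Sum>i\<in>UNIV. g i ((transpose Q *v x) $ i))"
    if "\<And>i. continuous_on UNIV (g i)" for g :: "'n \<Rightarrow> real \<Rightarrow> real"
    unfolding transpose_mult_vec_nth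
    by (intro continuous_on_sum continuous_on_compose2[OF that] continuous_intros) auto
  have f: "f (x - y) = (\<Sum>i\<in>UNIV. cs i ((transpose Q *v x) $ i - (transpose Q *v y) $ i))" for x y
    using sep by (simp add: separable_along_def matrix_vector_mult_diff_distrib)
  have UV: "U x + V y = (\<Sum>i\<in>UNIV. u i ((transpose Q *v x) $ i) + v i ((transpose Q *v y) $ i))" for x y
    by (simp add: U_def V_def sum.distrib)
  show thesis
  proof (rule that)
    show "continuous_on UNIV U" "continuous_on UNIV V"
      unfolding U_def V_def by (intro cont uv(1,2))+
    show "U x + V y \<le> f (x - y)" for x y unfolding UV f by (intro sum_mono uv(3))
    show "U x + V (affine_map A b x) = f (x - affine_map A b x)" for x
      unfolding UV f affine_map_coordinate[OF sd sym] by (intro sum.cong refl uv(4))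
    show "y = affine_map A b x" if sc: "\<And>i. strictly_convex (cs i)" and eq: "U x + V y = f (x - y)" for x y
    proof -
      have "(\<Sum>i\<in>UNIV. cs i ((transpose Q *v x) $ i - (transpose Q *v y) $ i) -
          (u i ((transpose Q *v x) $ i) + v i ((transpose Q *v y) $ i))) = 0"
        using eq unfolding UV f by (simp add: sum_subtractf)
      then have "\<forall>i\<in>UNIV. cs i ((transpose Q *v x) $ i - (transpose Q *v y) $ i) -
          (u i ((transpose Q *v x) $ i) + v i ((transpose Q *v y) $ i)) = 0"
        by (subst (asm) sum_nonneg_eq_0_iff) (auto simp: uv(3))
      then have "(transpose Q *v y) $ i = (transpose Q *v affine_map A b x) $ i" for i
        unfolding affine_map_coordinate[OF sd sym] by (intro uv(5)[OF sc]) simp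
      then have "transpose Q *v y = transpose Q *v affine_map A b x" by (simp add: vec_eq_iff)
      then have "Q *v (transpose Q *v y) = Q *v (transpose Q *v affine_map A b x)" by simp
      then show ?thesis using Q by (simp add: matrix_vector_mul_assoc orthogonal_matrix_def)
    qed
  qed
qed

section \<open>Necessity, cross-coupling and sufficiency\<close>

text \<open>In the eigenbasis, a matrix that commutes with a diagonal matrix vanishes where the diagonal entries differ.\<close>

lemma hessian_off_diagonal_zero:
  fixes A :: "real^'n^'n" and f' :: "real^'n \<Rightarrow> (real^'n) \<Rightarrow>\<^sub>L real"
  assumes cyc: "cyclically_monotone_near_diagonal A f \<delta>" "\<delta> > 0"
    and W: "open W" and f': "\<And>x. x \<in> W \<Longrightarrow> (f has_derivative blinfun_apply (f' x)) (at x)"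
    and f'': "\<And>x. x \<in> W \<Longrightarrow> (f' has_derivative blinfun_apply (f'' x)) (at x)"
    and cont: "continuous_on W f''" and z: "z \<in> W"
    and sd: "spectral_decomposition A Q D" and ne: "D $ i $ i \<noteq> D $ j $ j"
  shows "f'' z (column i Q) (column j Q) = 0"
proof -
  have Q: "orthogonal_matrix Q" using sd by (simp add: spectral_decomposition_def)
  have ij: "i \<noteq> j" using ne by auto
  have n: "norm (column k Q) = 1" for k by (simp add: norm_eq_1 column_inner_column[OF Q])
  have "f'' z (column i Q) (A *v column j Q) = f'' z (column j Q) (A *v column i Q)"
    by (rule hessian_times_matrix_symmetric[OF cyc W f' f'' cont z])
       (simp_all add: n column_inner_column[OF Q] ij)
  moreover have "f'' z (column j Q) (column i Q) = f'' z (column i Q) (column j Q)"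
    by (rule C2_second_derivative_symmetric[OF W f' f'' cont z])
  ultimately have "(D $ j $ j - D $ i $ i) * f'' z (column i Q) (column j Q) = 0"
    by (simp add: spectral_decomposition_eigenvector[OF sd] blinfun.scaleR_right left_diff_distrib)
  then show ?thesis using ne by simp
qed

text \<open>The \<open>i\<close>-th summand is \<open>f\<close> along the \<open>i\<close>-th axis up to a constant. Convexity is inherited from the axis, but
the axis may pass through exceptional points. By separability \<open>f\<close> has the same shape on every parallel line, and in
dimension at least two one of these lines misses the finite set \<open>S\<close>; this gives \<open>C2_on\<close>.\<close>

lemma cyclically_monotone_imp_separable_convex:
  fixes f :: "real^'n \<Rightarrow> real"
  assumes cyc: "cyclically_monotone_near_diagonal A f \<delta>" "\<delta> > 0"
    and contf: "continuous_on UNIV f" and S: "finite S" and C2: "C2_on (- S) f"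
    and A: "sym_pos_def A" and sd: "spectral_decomposition A Q D"
    and inj: "CARD('n) \<ge> 2 \<Longrightarrow> inj (\<lambda>i. D $ i $ i)"
  shows "\<exists>cs. (\<forall>i. convex_on UNIV (cs i)) \<and> separable_along Q cs f \<and>
              (CARD('n) \<ge> 2 \<longrightarrow> (\<forall>i. C2_on UNIV (cs i)))"
proof -
  let ?q = "\<lambda>i. column i Q"
  have Q: "orthogonal_matrix Q" using sd by (simp add: spectral_decomposition_def)
  have n: "norm (?q k) = 1" for k by (simp add: norm_eq_1 column_inner_column[OF Q])
  obtain f' :: "real^'n \<Rightarrow> (real^'n) \<Rightarrow>\<^sub>L real" and f'' :: "real^'n \<Rightarrow> (real^'n) \<Rightarrow>\<^sub>L ((real^'n) \<Rightarrow>\<^sub>L real)" where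
    f': "\<And>x. x \<in> - S \<Longrightarrow> (f has_derivative blinfun_apply (f' x)) (at x)" and
    f'': "\<And>x. x \<in> - S \<Longrightarrow> (f' has_derivative blinfun_apply (f'' x)) (at x)" and
    cont: "continuous_on (- S) f''" using C2 unfolding C2_on_def by blast
  have W: "open (- S)" using S by (simp add: finite_imp_closed open_Compl)
  have two: "CARD('n) \<ge> 2" if "i \<noteq> j" for i j :: 'n
    using card_mono[of UNIV "{i, j}"] that by simp
  have mixed: "f (a + s *\<^sub>R ?q i + t *\<^sub>R ?q j) - f (a + s *\<^sub>R ?q i) = f (a + t *\<^sub>R ?q j) - f a"
    if ij: "i \<noteq> j" for i j a s t
  proof (rule mixed_difference_zero[OF contf S f' f''])
    have d: "D $ i $ i \<noteq> D $ j $ j" using inj[OF two[OF ij]] ij by (auto dest: injD)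
    show "f'' x (?q i) (?q j) = 0" if "x \<in> - S" for x
      by (rule hessian_off_diagonal_zero[OF cyc W f' f'' cont that sd d])
  qed (auto simp: n column_inner_column[OF Q] ij)
  let ?k = "f 0 / real CARD('n)"
  have cvx: "convex_on UNIV (\<lambda>t. f (t *\<^sub>R ?q i) - f 0 + ?k)" for i
  proof -
    have "convex_on UNIV (\<lambda>t. f (0 + t *\<^sub>R ?q i) + (?k - f 0))"
      by (intro convex_on_add convex_along_eigenvector[OF cyc contf spectral_decomposition_eigenvector[OF sd] n]
            spectral_decomposition_pos[OF sd A]) (simp add: convex_on_const)
    then show ?thesis by (simp add: algebra_simps)
  qed
  have smooth: "C2_on UNIV (\<lambda>t. f (t *\<^sub>R ?q i) - f 0 + ?k)" if card: "CARD('n) \<ge> 2" for i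
  proof -
    obtain j where ji: "j \<noteq> i"
    proof -
      have "UNIV \<noteq> {i}"
      proof
        assume "UNIV = {i}"
        then have "CARD('n) = card {i}" by (rule arg_cong)
        then show False using card by simp
      qed
      then show thesis using that by blast
    qed
    obtain s where s: "s \<notin> (\<lambda>z. ?q j \<bullet> z) ` S"
      using ex_new_if_finite[OF infinite_UNIV_char_0 finite_imageI[OF S]] by blast
    have line: "s *\<^sub>R ?q j + t *\<^sub>R ?q i \<in> - S" for t
    proof
      assume "s *\<^sub>R ?q j + t *\<^sub>R ?q i \<in> S"
      then have "?q j \<bullet> (s *\<^sub>R ?q j + t *\<^sub>R ?q i) \<in> (\<lambda>z. ?q j \<bullet> z) ` S" by (rule imageI)
      then show False using s ji by (simp add: inner_add_right column_inner_column[OF Q])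
    qed
    have "f (t *\<^sub>R ?q i) - f 0 + ?k = f (s *\<^sub>R ?q j + t *\<^sub>R ?q i) + (?k - f (s *\<^sub>R ?q j))" for t
      using mixed[OF ji, of 0 s t] by simp
    then show ?thesis using C2_on_line[OF C2 line, of "?k - f (s *\<^sub>R ?q j)"] by (simp only:)
  qed
  have "separable_along Q (\<lambda>i t. f (t *\<^sub>R ?q i) - f 0 + ?k) f"
    by (rule separable_of_mixed_differences[OF Q mixed])
  then show ?thesis
    by (intro exI[of _ "\<lambda>i t. f (t *\<^sub>R ?q i) - f 0 + ?k"] conjI allI impI cvx smooth)
qed

lemma separable_hessian:
  fixes f :: "real^'n \<Rightarrow> real" and f' :: "real^'n \<Rightarrow> (real^'n) \<Rightarrow>\<^sub>L real"
  assumes sep: "separable_along Q cs f"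
    and c1: "\<And>i t. (cs i has_real_derivative c1 i t) (at t)" and c2: "\<And>i t. (c1 i has_real_derivative c2 i t) (at t)"
    and W: "open W" and f': "\<And>x. x \<in> W \<Longrightarrow> (f has_derivative blinfun_apply (f' x)) (at x)"
    and f'': "\<And>x. x \<in> W \<Longrightarrow> (f' has_derivative blinfun_apply (f'' x)) (at x)" and z: "z \<in> W"
  shows "f'' z x y = (\<Sum>k\<in>UNIV. c2 k (column k Q \<bullet> z) * (column k Q \<bullet> x) * (column k Q \<bullet> y))"
proof -
  let ?q = "\<lambda>i. column i Q"
  have f: "f = (\<lambda>z. \<Sum>k\<in>UNIV. cs k (?q k \<bullet> z))"
    using sep by (simp add: separable_along_def transpose_mult_vec_nth fun_eq_iff)
  have chain: "((\<lambda>z. g (?q k \<bullet> z)) has_derivative (\<lambda>h. g' * (?q k \<bullet> h))) (at z)"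
    if "(g has_real_derivative g') (at (?q k \<bullet> z))" for g g' k z
    by (rule has_derivative_compose[where f = "\<lambda>z. ?q k \<bullet> z", OF has_derivative_inner_right[OF has_derivative_ident]
          that[unfolded has_field_derivative_def]])
  have grad: "f' z y = (\<Sum>k\<in>UNIV. c1 k (?q k \<bullet> z) * (?q k \<bullet> y))" if "z \<in> W" for z
  proof -
    have "(f has_derivative (\<lambda>h. \<Sum>k\<in>UNIV. c1 k (?q k \<bullet> z) * (?q k \<bullet> h))) (at z)"
      unfolding f by (intro has_derivative_sum chain c1)
    from has_derivative_unique[OF f'[OF that] this] show ?thesis by (simp add: fun_eq_iff)
  qed
  have 1: "((\<lambda>z. f' z y) has_derivative (\<lambda>h. f'' z h y)) (at z)"
    by (rule bounded_linear.has_derivative[OF blinfun.bounded_linear_left f''[OF z]])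
  have 2: "((\<lambda>z. \<Sum>k\<in>UNIV. c1 k (?q k \<bullet> z) * (?q k \<bullet> y)) has_derivative
      (\<lambda>h. \<Sum>k\<in>UNIV. c2 k (?q k \<bullet> z) * (?q k \<bullet> h) * (?q k \<bullet> y))) (at z)"
    by (intro has_derivative_sum has_derivative_mult_left chain c2)
  have "((\<lambda>z. f' z y) has_derivative
      (\<lambda>h. \<Sum>k\<in>UNIV. c2 k (?q k \<bullet> z) * (?q k \<bullet> h) * (?q k \<bullet> y))) (at z)"
    by (rule has_derivative_transform_within_open[OF 2 W z]) (simp add: grad)
  from has_derivative_unique[OF 1 this] show ?thesis by (simp add: fun_eq_iff)
qed

text \<open>The Hessian of \<open>f\<close> at \<open>z\<close> is diagonal in the basis of columns, with entries \<open>cs k''\<close> at the coordinates of \<open>z\<close>. As its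
product with \<open>A\<close> is symmetric, a nonzero entry of \<open>A\<close> at \<open>(i, j)\<close> gives \<open>cs i'' s = cs j'' t\<close> whenever some point
outside \<open>S\<close> has the coordinates \<open>s\<close> and \<open>t\<close>. The two coordinates vary independently, so both functions are
constant.\<close>

lemma coupled_coordinates_quadratic:
  fixes f :: "real^'n \<Rightarrow> real"
  assumes cyc: "cyclically_monotone_near_diagonal A f \<delta>" "\<delta> > 0" and sym: "transpose A = A"
    and S: "finite S" and C2: "C2_on (- S) f"
    and Q: "orthogonal_matrix Q" and sep: "separable_along Q cs f"
    and cvx: "\<And>i. convex_on UNIV (cs i)" and C2cs: "\<And>i. C2_on UNIV (cs i)"
    and ij: "i \<noteq> j" and ne: "(transpose Q ** A ** Q) $ i $ j \<noteq> 0"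
  shows "\<exists>\<kappa>\<ge>0. \<forall>t. deriv (deriv (cs i)) t = \<kappa> \<and> deriv (deriv (cs j)) t = \<kappa>"
proof -
  let ?q = "\<lambda>i. column i Q"
  have n: "norm (?q k) = 1" for k by (simp add: norm_eq_1 column_inner_column[OF Q])
  obtain f' :: "real^'n \<Rightarrow> (real^'n) \<Rightarrow>\<^sub>L real" and f'' :: "real^'n \<Rightarrow> (real^'n) \<Rightarrow>\<^sub>L ((real^'n) \<Rightarrow>\<^sub>L real)" where
    f': "\<And>x. x \<in> - S \<Longrightarrow> (f has_derivative blinfun_apply (f' x)) (at x)" and
    f'': "\<And>x. x \<in> - S \<Longrightarrow> (f' has_derivative blinfun_apply (f'' x)) (at x)" and
    cont: "continuous_on (- S) f''" using C2 unfolding C2_on_def by blast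
  have W: "open (- S)" using S by (simp add: finite_imp_closed open_Compl)
  note c1 = C2_on_UNIV_DERIV_deriv(1)[OF C2cs] and c2 = C2_on_UNIV_DERIV_deriv(2)[OF C2cs]
  let ?c2 = "\<lambda>k. deriv (deriv (cs k))"
  define \<alpha> where "\<alpha> = ?q i \<bullet> (A *v ?q j)"
  have "(transpose Q ** A ** Q) $ i $ j = \<alpha>"
  proof -
    have "(transpose Q ** A ** Q) *v axis j 1 = transpose Q *v (A *v ?q j)"
      by (simp only: matrix_vector_mult_basis[of Q, symmetric] matrix_vector_mul_assoc matrix_mul_assoc)
    then have "((transpose Q ** A ** Q) *v axis j 1) $ i = \<alpha>" by (simp add: transpose_mult_vec_nth \<alpha>_def)
    then show ?thesis by (simp add: matrix_vector_mult_basis column_def)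
  qed
  then have \<alpha>: "\<alpha> \<noteq> 0" using ne by simp
  have \<alpha>': "?q j \<bullet> (A *v ?q i) = \<alpha>"
    using dot_lmul_matrix[of "?q j" A "?q i"] transpose_matrix_vector[of A "?q j"]
    by (simp add: sym \<alpha>_def inner_commute)
  have pick: "(\<Sum>k\<in>UNIV. ?c2 k (?q k \<bullet> z) * (?q k \<bullet> ?q l) * (?q k \<bullet> y)) = ?c2 l (?q l \<bullet> z) * (?q l \<bullet> y)" for l y z
  proof -
    have "(\<Sum>k\<in>UNIV. ?c2 k (?q k \<bullet> z) * (?q k \<bullet> ?q l) * (?q k \<bullet> y)) =
        (\<Sum>k\<in>UNIV. if k = l then ?c2 k (?q k \<bullet> z) * (?q k \<bullet> y) else 0)"
      by (intro sum.cong refl) (simp add: column_inner_column[OF Q])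
    then show ?thesis by simp
  qed
  have eq: "?c2 i (?q i \<bullet> z) = ?c2 j (?q j \<bullet> z)" if z: "z \<in> - S" for z
  proof -
    have "f'' z (?q i) (A *v ?q j) = f'' z (?q j) (A *v ?q i)"
      by (rule hessian_times_matrix_symmetric[OF cyc W f' f'' cont z])
         (simp_all add: n column_inner_column[OF Q] ij)
    moreover have "f'' z (?q l) y = ?c2 l (?q l \<bullet> z) * (?q l \<bullet> y)" for l y
      by (rule trans[OF separable_hessian[OF sep c1 c2 W f' f'' z] pick])
    ultimately have "?c2 i (?q i \<bullet> z) * (?q i \<bullet> (A *v ?q j)) = ?c2 j (?q j \<bullet> z) * (?q j \<bullet> (A *v ?q i))"
      by (simp only:)
    then have "?c2 i (?q i \<bullet> z) * \<alpha> = ?c2 j (?q j \<bullet> z) * \<alpha>" unfolding \<alpha>' \<alpha>_def[symmetric] .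
    then show ?thesis using \<alpha> by simp
  qed
  have coord: "?q i \<bullet> (s *\<^sub>R ?q i + t *\<^sub>R ?q j) = s" "?q j \<bullet> (s *\<^sub>R ?q i + t *\<^sub>R ?q j) = t" for s t
    using ij by (simp_all add: inner_add_right column_inner_column[OF Q])
  have fresh: "\<exists>s. s \<notin> (\<lambda>z. ?q k \<bullet> z) ` S" for k
    using ex_new_if_finite[OF infinite_UNIV_char_0 finite_imageI[OF S]] by blast
  \<comment> \<open>Heights that no exceptional point attains: fixing one coordinate there frees the other one.\<close>
  obtain t0 where t0: "t0 \<notin> (\<lambda>z. ?q j \<bullet> z) ` S" using fresh by blast
  obtain s0 where s0: "s0 \<notin> (\<lambda>z. ?q i \<bullet> z) ` S" using fresh by blast
  have i: "?c2 i s = ?c2 j t0" for s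
  proof -
    have "s *\<^sub>R ?q i + t0 *\<^sub>R ?q j \<in> - S" using t0 coord(2)[of s t0] by force
    from eq[OF this] show ?thesis by (simp add: coord)
  qed
  have j: "?c2 j t = ?c2 j t0" for t
  proof -
    have "s0 *\<^sub>R ?q i + t *\<^sub>R ?q j \<in> - S" using s0 coord(1)[of s0 t] by force
    from eq[OF this] show ?thesis by (simp add: coord i)
  qed
  have "mono_on UNIV (deriv (cs j))"
    by (rule mono_onI) (rule convex_derivative_mono[OF cvx c1])
  then have "?c2 j t0 \<ge> 0" by (rule mono_on_imp_deriv_nonneg[OF _ c2]) simp
  then show ?thesis using i j by auto
qed

lemma separable_cost_affine_map_optimal:
  fixes M :: "(real^'n) measure" and f :: "real^'n \<Rightarrow> real"
  assumes M: "prob_space M" "sets M = sets borel"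
    and c: "\<And>x y. c x y = f (x - y)" and contf: "continuous_on UNIV f"
    and sep: "separable_along Q cs f" and C2: "\<And>i. C2_on UNIV (cs i)" and cvx: "\<And>i. convex_on UNIV (cs i)"
    and Q: "orthogonal_matrix Q" and A: "sym_pos_def A" "diagonalized_by A Q"
    and minorant: "has_integrable_minorant c M (distr M borel (affine_map A b))"
  shows "optimal_transport_map c M (distr M borel (affine_map A b)) (affine_map A b)"
    and "\<lbrakk>optimal_cost c M (distr M borel (affine_map A b)) < \<infinity>; \<And>i. strictly_convex (cs i);
          optimal_transport_map c M (distr M borel (affine_map A b)) T\<rbrakk> \<Longrightarrow> AE x in M. T x = affine_map A b x"
proof -
  let ?T = "affine_map A b" and ?N = "distr M borel (affine_map A b)"
  obtain u v where cont: "continuous_on UNIV u" "continuous_on UNIV v"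
    and uv: "\<And>x y. u x + v y \<le> f (x - y)" "\<And>x. u x + v (?T x) = f (x - ?T x)"
    "\<And>x y. (\<And>i. strictly_convex (cs i)) \<Longrightarrow> u x + v y = f (x - y) \<Longrightarrow> y = ?T x"
    using separable_potentials[OF sep C2 cvx diagonalized_by_imp_spectral_decomposition[OF Q A(2)] A(1)] by blast
  obtain u0 v0 where m: "integrable M u0" "integrable ?N v0" "\<And>x y. u0 x + v0 y \<le> c x y"
    using minorant by (auto simp: has_integrable_minorant_def)
  have contT: "continuous_on UNIV ?T" unfolding affine_map_def by (intro continuous_intros)
  have T: "?T \<in> measurable M ?N"
    using borel_measurable_continuous_onI[OF contT] M(2) by (simp cong: measurable_cong_sets)
  have TN: "distr M ?N ?T = ?N" by (intro distr_cong) auto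
  have contc: "continuous_on UNIV (\<lambda>z. c (fst z) (snd z))"
    unfolding c by (intro continuous_on_compose2[OF contf] continuous_intros) auto
  have cm: "(\<lambda>z. c (fst z) (snd z)) \<in> borel_measurable (M \<Otimes>\<^sub>M ?N)"
    by (rule continuous_cost_measurable[OF contc M(2)]) simp
  have um: "u \<in> borel_measurable M" "v \<in> borel_measurable ?N"
    using borel_measurable_continuous_onI[OF cont(1)] borel_measurable_continuous_onI[OF cont(2)] M(2)
    by (simp_all cong: measurable_cong_sets)
  have le: "u x + v y \<le> c x y" and contact: "u x + v (?T x) = c x (?T x)" for x y
    using uv(1,2) by (simp_all add: c)
  show "optimal_transport_map c M ?N ?T"
    by (rule contact_map_optimal[OF M(1) T TN cm m um le contact])
  show "AE x in M. T x = ?T x"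
    if "optimal_cost c M ?N < \<infinity>" "\<And>i. strictly_convex (cs i)" "optimal_transport_map c M ?N T"
  proof (rule contact_map_unique[OF M(1) T TN cm m um le contact _ that(1,3)])
    show "y = ?T x" if "u x + v y = c x y" for x y using uv(3) \<open>\<And>i. strictly_convex (cs i)\<close> that by (simp add: c)
  qed
qed

lemma trivial_spectral_decomposition:
  assumes "CARD('n) = 1"
  shows "spectral_decomposition (A :: real^'n^'n) (mat 1) A"
proof -
  obtain a :: 'n where "UNIV = {a}" using assms card_1_singletonE by blast
  then have "i = j" for i j :: 'n by (metis UNIV_I singletonD)
  then show ?thesis
    by (auto simp: spectral_decomposition_def diagonal_matrix_def orthogonal_matrix_id)
qed

theorem theorem5p4:
  fixes \<mu> :: "(real^'n) measure"
    and \<rho> :: "real^'n \<Rightarrow> ennreal"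
    and U :: "(real^'n) set"
    and P :: "((real^'n^'n) \<times> (real^'n)) set"
    and c :: "real^'n \<Rightarrow> real^'n \<Rightarrow> real"
    and ct :: "real^'n \<Rightarrow> real"
    and S :: "(real^'n) set"
    and push :: "real^'n^'n \<Rightarrow> real^'n \<Rightarrow> (real^'n) measure"
  defines "push \<equiv> (\<lambda>A b. distr \<mu> borel (affine_map A b))"
  assumes mu: "prob_space \<mu>" "\<rho> \<in> borel_measurable borel" "\<mu> = density lborel \<rho>"
    and U: "open U" "U \<noteq> {}" "\<And>x. x \<in> U \<Longrightarrow> \<rho> x > 0"
    and P: "\<And>A b. (A, b) \<in> P \<Longrightarrow> sym_pos_def A"
    and c: "\<And>x y. c x y = ct (x - y)"
    and ct: "continuous_on UNIV ct" "finite S" "C2_on (- S) ct"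
    and minorant: "\<And>A b. (A, b) \<in> P \<Longrightarrow> has_integrable_minorant c \<mu> (push A b)"
    and finite_cost: "\<And>A b. (A, b) \<in> P \<Longrightarrow> optimal_cost c \<mu> (push A b) < \<infinity>"
  shows
    "\<comment> \<open>(i) necessity\<close>
     ((\<forall>(A, b)\<in>P. optimal_transport_map c \<mu> (push A b) (affine_map A b)) \<longrightarrow>
       (\<forall>A. {A} \<times> UNIV \<subseteq> P \<and> (CARD('n) \<ge> 2 \<longrightarrow> distinct_eigenvalues A) \<and>
            (CARD('n) = 1 \<longrightarrow> A \<noteq> mat 1) \<longrightarrow>
          convex_on UNIV ct \<and>
          (\<forall>Q D. spectral_decomposition A Q D \<longrightarrow>
             (\<exists>cs :: 'n \<Rightarrow> real \<Rightarrow> real.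
                (\<forall>i. convex_on UNIV (cs i)) \<and> separable_along Q cs ct \<and>
                (CARD('n) \<ge> 2 \<longrightarrow> (\<forall>i. C2_on UNIV (cs i)))))))
     \<and>
     \<comment> \<open>(ii) sufficiency\<close>
     (\<forall>Q (cs :: 'n \<Rightarrow> real \<Rightarrow> real).
       orthogonal_matrix Q \<and> separable_along Q cs ct \<and>
       (\<forall>i. C2_on UNIV (cs i) \<and> convex_on UNIV (cs i)) \<longrightarrow>
       (\<forall>A b. sym_pos_def A \<and> diagonalized_by A Q \<and> has_integrable_minorant c \<mu> (push A b) \<longrightarrow>
          optimal_transport_map c \<mu> (push A b) (affine_map A b) \<and>
          (optimal_cost c \<mu> (push A b) < \<infinity> \<and> (\<forall>i. strictly_convex (cs i)) \<longrightarrow>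
             (\<forall>T. optimal_transport_map c \<mu> (push A b) T \<longrightarrow>
                (AE x in \<mu>. T x = affine_map A b x)))))
     \<and>
     \<comment> \<open>(iii) cross-coupling and quadratic costs\<close>
     ((\<forall>(A, b)\<in>P. optimal_transport_map c \<mu> (push A b) (affine_map A b)) \<longrightarrow>
       (\<forall>A Q D (cs :: 'n \<Rightarrow> real \<Rightarrow> real) A'.
          {A} \<times> UNIV \<subseteq> P \<and> (CARD('n) \<ge> 2 \<longrightarrow> distinct_eigenvalues A) \<and>
          (CARD('n) = 1 \<longrightarrow> A \<noteq> mat 1) \<and>
          spectral_decomposition A Q D \<and>
          (\<forall>i. convex_on UNIV (cs i)) \<and> separable_along Q cs ct \<and>
          (CARD('n) \<ge> 2 \<longrightarrow> (\<forall>i. C2_on UNIV (cs i))) \<and>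
          {A'} \<times> UNIV \<subseteq> P \<longrightarrow>
          (\<forall>i j. i \<noteq> j \<and> (transpose Q ** A' ** Q) $ i $ j \<noteq> 0 \<longrightarrow>
             (\<exists>\<kappa>\<ge>0. \<forall>t. deriv (deriv (cs i)) t = \<kappa> \<and> deriv (deriv (cs j)) t = \<kappa>))))"
proof -
  interpret \<mu>: prob_space \<mu> by (rule mu)
  have sets_\<mu>: "sets \<mu> = sets borel" by (simp add: mu(3))
  let ?opt = "\<forall>(A, b)\<in>P. optimal_transport_map c \<mu> (push A b) (affine_map A b)"
  let ?distinct = "\<lambda>A :: real^'n^'n. CARD('n) \<ge> 2 \<longrightarrow> distinct_eigenvalues A"
  have cyc: "\<exists>\<delta>>0. cyclically_monotone_near_diagonal A ct \<delta>" if opt: ?opt and A: "{A} \<times> UNIV \<subseteq> P" for A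
  proof -
    have AP: "(A, b) \<in> P" for b using A by auto
    have "optimal_transport_map c \<mu> (distr \<mu> borel (affine_map A b)) (affine_map A b)" for b
      using opt AP[of b] by (auto simp: push_def)
    moreover note minorant[OF AP, unfolded push_def] finite_cost[OF AP, unfolded push_def]
    ultimately show ?thesis
      using affine_optimal_imp_cyclically_monotone[OF mu(2,3,1) U c ct(1), of A] by metis
  qed
  have separable: "\<exists>cs. (\<forall>i. convex_on UNIV (cs i)) \<and> separable_along Q cs ct \<and>
        (CARD('n) \<ge> 2 \<longrightarrow> (\<forall>i. C2_on UNIV (cs i)))"
    if opt: ?opt and A: "{A} \<times> UNIV \<subseteq> P" "?distinct A" and sd: "spectral_decomposition A Q D" for A Q D
  proof -
    obtain \<delta> where \<delta>: "\<delta> > 0" "cyclically_monotone_near_diagonal A ct \<delta>" using cyc[OF opt A(1)] by blast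
    have spd: "sym_pos_def A" using P[of A 0] A(1) by auto
    show ?thesis
      by (rule cyclically_monotone_imp_separable_convex[OF \<delta>(2,1) ct spd sd])
         (use A(2) spectral_decomposition_distinct[OF sd] in blast)
  qed
  show ?thesis
  proof (intro conjI allI impI)
    fix A assume opt: ?opt and A: "{A} \<times> UNIV \<subseteq> P \<and> ?distinct A \<and> (CARD('n) = 1 \<longrightarrow> A \<noteq> mat 1)"
    have "transpose A = A" using P[of A 0] A by (auto simp: sym_pos_def_def)
    moreover have "distinct_eigenvalues A \<or> CARD('n) = 1"
      using A zero_less_card_finite[where 'a = 'n] by linarith
    ultimately obtain Q D where sd: "spectral_decomposition A Q D"
      using distinct_eigenvalues_imp_spectral_decomposition trivial_spectral_decomposition by blast
    show "convex_on UNIV ct" using separable[OF opt _ _ sd] A separable_convex_imp_convex by blast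
  next
    fix A Q D assume opt: ?opt and A: "{A} \<times> UNIV \<subseteq> P \<and> ?distinct A \<and> (CARD('n) = 1 \<longrightarrow> A \<noteq> mat 1)"
      and sd: "spectral_decomposition A Q D"
    show "\<exists>cs. (\<forall>i. convex_on UNIV (cs i)) \<and> separable_along Q cs ct \<and>
        (CARD('n) \<ge> 2 \<longrightarrow> (\<forall>i. C2_on UNIV (cs i)))"
      using separable[OF opt _ _ sd] A by blast
  next
    fix Q A b and cs :: "'n \<Rightarrow> real \<Rightarrow> real"
    assume cs: "orthogonal_matrix Q \<and> separable_along Q cs ct \<and> (\<forall>i. C2_on UNIV (cs i) \<and> convex_on UNIV (cs i))"
      and A: "sym_pos_def A \<and> diagonalized_by A Q \<and> has_integrable_minorant c \<mu> (push A b)"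
    note * = separable_cost_affine_map_optimal[OF mu(1) sets_\<mu> c ct(1), of Q cs A b]
    show "optimal_transport_map c \<mu> (push A b) (affine_map A b)"
      unfolding push_def by (rule *(1)) (use cs A in \<open>auto simp: push_def\<close>)
    fix T
    assume "optimal_cost c \<mu> (push A b) < \<infinity> \<and> (\<forall>i. strictly_convex (cs i))"
      and "optimal_transport_map c \<mu> (push A b) T"
    then show "AE x in \<mu>. T x = affine_map A b x"
      by (intro *(2)) (use cs A in \<open>auto simp: push_def\<close>)
  next
    fix A Q D A' i j and cs :: "'n \<Rightarrow> real \<Rightarrow> real"
    assume opt: ?opt and H: "{A} \<times> UNIV \<subseteq> P \<and> ?distinct A \<and> (CARD('n) = 1 \<longrightarrow> A \<noteq> mat 1) \<and>
          spectral_decomposition A Q D \<and>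
          (\<forall>i. convex_on UNIV (cs i)) \<and> separable_along Q cs ct \<and>
          (CARD('n) \<ge> 2 \<longrightarrow> (\<forall>i. C2_on UNIV (cs i))) \<and> {A'} \<times> UNIV \<subseteq> P"
      and ij: "i \<noteq> j \<and> (transpose Q ** A' ** Q) $ i $ j \<noteq> 0"
    have A': "{A'} \<times> UNIV \<subseteq> P" using H by (elim conjE)
    have sd: "spectral_decomposition A Q D" using H by (elim conjE)
    have cs: "separable_along Q cs ct" "\<forall>i. convex_on UNIV (cs i)"
        "CARD('n) \<ge> 2 \<longrightarrow> (\<forall>i. C2_on UNIV (cs i))"
      using H by simp_all
    have card: "CARD('n) \<ge> 2" using card_mono[of UNIV "{i, j}"] ij by simp
    obtain \<delta> where \<delta>: "\<delta> > 0" "cyclically_monotone_near_diagonal A' ct \<delta>"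
      using cyc[OF opt A'] by blast
    have sym: "transpose A' = A'" using P[of A' 0] A' by (auto simp: sym_pos_def_def)
    have Q: "orthogonal_matrix Q" using sd by (simp add: spectral_decomposition_def)
    have "convex_on UNIV (cs k)" "C2_on UNIV (cs k)" for k using cs(2,3) card by blast+
    note cs = cs(1) this
    show "\<exists>\<kappa>\<ge>0. \<forall>t. deriv (deriv (cs i)) t = \<kappa> \<and> deriv (deriv (cs j)) t = \<kappa>"
      using coupled_coordinates_quadratic[OF \<delta>(2,1) sym ct(2,3) Q cs] ij by blast
  qed
qed

end
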